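(* Let $s03'$ be the unital $\mathbb{C}$-algebra defined in the context. For $\lambda\in\mathbb{C}$ let $V_\lambda=s03'/s03'(\tilde D-\lambda)$ be the universal left module generated by a vector $v_0$ with $\tilde Dv_0=\lambda v_0$. (1) If $\lambda\ne0$ and $V_\lambda\neq 0$, then $\lambda^2=1$, $\tilde B^2v_0=v_0$, $\tilde Cv_0=-\lambda\tilde Bv_0$, and $V_\lambda$ is a two-dimensional irreducible representation with basis $v_0,\tilde Bv_0$ and action $$\tilde B:\ v_0\mapsto\tilde Bv_0,\ \tilde Bv_0\mapsto v_0;\qquad \tilde C:\ v_0\mapsto-\lambda\tilde Bv_0,\ \tilde Bv_0\mapsto\lambda v_0;\qquad \tilde D:\ v_0\mapsto\lambda v_0,\ \tilde Bv_0\mapsto-\lambda\tilde Bv_0 ;$$ both $\tilde B^2$ and $\tilde D^2$ act as $1$. (2) If $\lambda=0$, then $V_0$ is five-dimensional with basis $v_0,\tilde Bv_0,\tilde Cv_0,\tilde B\tilde Cv_0,\tilde B^2v_0$. It is reducible: $w=(\tilde B^2-1)v_0$ spans a trivial one-dimensional subrepresentation, and the quotient by it is the direct sum of four one-dimensional representations spanned by $w_{\epsilon,\epsilon'}=(\tilde B+\epsilon 1-i\epsilon\epsilon'\tilde C-i\epsilon'\tilde B\tilde C)v_0$, $\epsilon,\epsilon'\in\{\pm1\}$, with $\tilde Bw_{\epsilon,\epsilon'}=\epsilon w_{\epsilon,\epsilon'}$, $\tilde Cw_{\epsilon,\epsilon'}=i\epsilon'w_{\epsilon,\epsilon'}$,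 $\tilde Dw_{\epsilon,\epsilon'}=0$. Consequently there are, up to isomorphism, six irreducible representations of $s03'$ obtained in this way: the trivial one, one two-dimensional with $\tilde B^2=\tilde D^2=1$, and four one-dimensional with $\tilde B^2=1$, $\tilde D^2=0$.
   Context: $s03'$ is the unital associative $\mathbb{C}$-algebra generated by $\tilde B,\tilde C,\tilde D$ with relations $\tilde D^3=\tilde B^2\tilde D=\tilde D\tilde B^2=\tilde D$; $\tilde B\tilde C-\tilde C\tilde B=-2\tilde D$; $\tilde D\tilde B=-\tilde B\tilde D=\tilde C\tilde D^2=\tilde D^2\tilde C$; $\tilde C\tilde D+\tilde D\tilde C=0$; $\tilde B^2+\tilde C^2=0$; $\tilde B^3=\tilde B$; $\tilde C^3=-\tilde C$. It has the nine-element basis $1,\tilde B,\tilde C,\tilde D,\tilde B\tilde C,\tilde B\tilde D,\tilde D\tilde C,\tilde B^2,\tilde D^2$. Trivial representation means that $\tilde B,\tilde C,\tilde D$ all act by zero. *)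

theory Defs
  imports
    "HOL-Library.Poly_Mapping"
    "HOL-Algebra.Algebra"
    "HOL-Algebra.Algebraic_Closure_Type"
begin

section \<open>Left modules over a not necessarily commutative ring\<close>

text \<open>The locale \<^locale>\<open>module\<close> of HOL-Algebra asks for a commutative ring of scalars; its record type
  and its \<^locale>\<open>submodule\<close> do not. The fields \<open>mult\<close> and \<open>one\<close> of that record play no role.\<close>

locale left_module = R?: ring R + M?: abelian_group M
  for R :: "('a, 'r) ring_scheme" (structure) and M :: "('a, 'b, 'm) module_scheme" (structure) +
  assumes smult_closed:
      "\<lbrakk>a \<in> carrier R; x \<in> carrier M\<rbrakk> \<Longrightarrow> a \<odot>\<^bsub>M\<^esub> x \<in> carrier M"
    and smult_l_distr:
      "\<lbrakk>a \<in> carrier R; b \<in> carrier R; x \<in> carrier M\<rbrakk> \<Longrightarrow>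
      (a \<oplus> b) \<odot>\<^bsub>M\<^esub> x = a \<odot>\<^bsub>M\<^esub> x \<oplus>\<^bsub>M\<^esub> b \<odot>\<^bsub>M\<^esub> x"
    and smult_r_distr:
      "\<lbrakk>a \<in> carrier R; x \<in> carrier M; y \<in> carrier M\<rbrakk> \<Longrightarrow>
      a \<odot>\<^bsub>M\<^esub> (x \<oplus>\<^bsub>M\<^esub> y) = a \<odot>\<^bsub>M\<^esub> x \<oplus>\<^bsub>M\<^esub> a \<odot>\<^bsub>M\<^esub> y"
    and smult_assoc1:
      "\<lbrakk>a \<in> carrier R; b \<in> carrier R; x \<in> carrier M\<rbrakk> \<Longrightarrow>
      (a \<otimes> b) \<odot>\<^bsub>M\<^esub> x = a \<odot>\<^bsub>M\<^esub> (b \<odot>\<^bsub>M\<^esub> x)"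
    and smult_one:
      "x \<in> carrier M \<Longrightarrow> \<one> \<odot>\<^bsub>M\<^esub> x = x"

definition regular_module :: "'a ring \<Rightarrow> ('a, 'a) module" where
  "regular_module R =
    \<lparr>carrier = carrier R, monoid.mult = (\<otimes>\<^bsub>R\<^esub>), one = \<one>\<^bsub>R\<^esub>, ring.zero = \<zero>\<^bsub>R\<^esub>, add = (\<oplus>\<^bsub>R\<^esub>), module.smult = (\<otimes>\<^bsub>R\<^esub>)\<rparr>"

definition quot_module :: "('a, 'b) module \<Rightarrow> 'b set \<Rightarrow> ('a, 'b set) module" where
  "quot_module M N =
    \<lparr>carrier = a_rcosets\<^bsub>M\<^esub> N, monoid.mult = undefined, one = undefined, ring.zero = N, add = set_add M,
     module.smult = (\<lambda>a Y. \<Union>x\<in>Y. N +>\<^bsub>M\<^esub> (a \<odot>\<^bsub>M\<^esub> x))\<rparr>"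

definition irreducible_module :: "'a ring \<Rightarrow> ('a, 'b) module \<Rightarrow> bool" where
  "irreducible_module R M \<longleftrightarrow>
    left_module R M \<and> carrier M \<noteq> {\<zero>\<^bsub>M\<^esub>} \<and>
    (\<forall>N. submodule N R M \<longrightarrow> N = {\<zero>\<^bsub>M\<^esub>} \<or> N = carrier M)"

definition reducible_module :: "'a ring \<Rightarrow> ('a, 'b) module \<Rightarrow> bool" where
  "reducible_module R M \<longleftrightarrow>
    left_module R M \<and> (\<exists>N. submodule N R M \<and> N \<noteq> {\<zero>\<^bsub>M\<^esub>} \<and> N \<noteq> carrier M)"

definition module_iso :: "'a ring \<Rightarrow> ('a, 'b) module \<Rightarrow> ('a, 'c) module \<Rightarrow> bool" where
  "module_iso R M N \<longleftrightarrow>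
    (\<exists>f. bij_betw f (carrier M) (carrier N) \<and>
      (\<forall>x\<in>carrier M. \<forall>y\<in>carrier M. f (x \<oplus>\<^bsub>M\<^esub> y) = f x \<oplus>\<^bsub>N\<^esub> f y) \<and>
      (\<forall>a\<in>carrier R. \<forall>x\<in>carrier M. f (a \<odot>\<^bsub>M\<^esub> x) = a \<odot>\<^bsub>N\<^esub> f x))"

definition internal_direct_sum :: "'a ring \<Rightarrow> ('a, 'b) module \<Rightarrow> 'i set \<Rightarrow> ('i \<Rightarrow> 'b set) \<Rightarrow> bool" where
  "internal_direct_sum R M I S \<longleftrightarrow>
    finite I \<and> (\<forall>i\<in>I. submodule (S i) R M) \<and>
    (\<forall>x\<in>carrier M. \<exists>!s. s \<in> (\<Pi>\<^sub>E i\<in>I. S i) \<and> x = (\<Oplus>\<^bsub>M\<^esub>i\<in>I. s i))"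


section \<open>The algebra s03'\<close>

text \<open>The free unital complex algebra on three generators is the monoid algebra of the monoid of
  words, i.e. the finitely supported complex functions on words with the convolution product.\<close>

datatype gen = GB | GC | GD

datatype word = Word "gen list"

instantiation word :: monoid_add
begin

definition zero_word :: word where "zero_word = Word []"

fun plus_word :: "word \<Rightarrow> word \<Rightarrow> word" where
  "plus_word (Word u) (Word v) = Word (u @ v)"

instance
proof
  fix a b c :: word
  show "a + b + c = a + (b + c)" by (cases a; cases b; cases c) simp
  show "0 + a = a" by (cases a) (simp add: zero_word_def)
  show "a + 0 = a" by (cases a) (simp add: zero_word_def)
qed

end

type_synonym free_alg = "word \<Rightarrow>\<^sub>0 complex"

definition fgen :: "gen \<Rightarrow> free_alg" where
  "fgen g = Poly_Mapping.single (Word [g]) 1"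

definition fconst :: "complex \<Rightarrow> free_alg" where
  "fconst c = Poly_Mapping.single 0 c"

definition s03_relators :: "free_alg set" where
  "s03_relators =
    (let B = fgen GB; C = fgen GC; D = fgen GD in
     {D^3 - D, B^2 * D - D, D * B^2 - D,
      B * C - C * B + fconst 2 * D,
      D * B + B * D, D * B - C * D^2, D * B - D^2 * C,
      C * D + D * C,
      B^2 + C^2,
      B^3 - B,
      C^3 + C})"

definition s03_ideal :: "free_alg set" where
  "s03_ideal = Idl\<^bsub>ring_of_type_algebra\<^esub> s03_relators"

type_synonym s03_elem = "free_alg set"

definition S03 :: "s03_elem ring" where
  "S03 = ring_of_type_algebra Quot s03_ideal"

definition s03_class :: "free_alg \<Rightarrow> s03_elem" where
  "s03_class x = s03_ideal +>\<^bsub>ring_of_type_algebra\<^esub> x"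

definition tB :: s03_elem where "tB = s03_class (fgen GB)"
definition tC :: s03_elem where "tC = s03_class (fgen GC)"
definition tD :: s03_elem where "tD = s03_class (fgen GD)"

text \<open>The structure map of the complex algebra \<^const>\<open>S03\<close>; through it every left module over
  \<^const>\<open>S03\<close> is a complex vector space.\<close>

definition sc :: "complex \<Rightarrow> s03_elem" where "sc c = s03_class (fconst c)"


section \<open>Complex linear algebra in modules over s03'\<close>

definition lincomb :: "(s03_elem, 'v) module \<Rightarrow> (nat \<Rightarrow> complex) \<Rightarrow> 'v list \<Rightarrow> 'v" where
  "lincomb M k vs = (\<Oplus>\<^bsub>M\<^esub>i\<in>{..<length vs}. sc (k i) \<odot>\<^bsub>M\<^esub> (vs ! i))"

definition is_basis :: "(s03_elem, 'v) module \<Rightarrow> 'v list \<Rightarrow> bool" where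
  "is_basis M vs \<longleftrightarrow>
    set vs \<subseteq> carrier M \<and>
    (\<forall>x\<in>carrier M. \<exists>k. x = lincomb M k vs) \<and>
    (\<forall>k. lincomb M k vs = \<zero>\<^bsub>M\<^esub> \<longrightarrow> (\<forall>i<length vs. k i = 0))"

definition has_dim :: "(s03_elem, 'v) module \<Rightarrow> nat \<Rightarrow> bool" where
  "has_dim M n \<longleftrightarrow> (\<exists>vs. length vs = n \<and> is_basis M vs)"

definition line :: "(s03_elem, 'v) module \<Rightarrow> 'v \<Rightarrow> 'v set" where
  "line M w = {sc c \<odot>\<^bsub>M\<^esub> w | c. True}"

definition trivial_rep :: "(s03_elem, 'v) module \<Rightarrow> bool" where
  "trivial_rep M \<longleftrightarrow>
    (\<forall>x\<in>carrier M. tB \<odot>\<^bsub>M\<^esub> x = \<zero>\<^bsub>M\<^esub> \<and> tC \<odot>\<^bsub>M\<^esub> x = \<zero>\<^bsub>M\<^esub> \<and> tD \<odot>\<^bsub>M\<^esub> x = \<zero>\<^bsub>M\<^esub>)"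


section \<open>The universal modules and the irreducible representations they yield\<close>

text \<open>In HOL-Algebra, \<^const>\<open>cgenideal\<close> is the set of left multiples of an element, hence the
  left ideal it generates also in a noncommutative ring.\<close>

definition V_ideal :: "complex \<Rightarrow> s03_elem set" where
  "V_ideal l = PIdl\<^bsub>S03\<^esub> (tD \<ominus>\<^bsub>S03\<^esub> sc l)"

definition Vmod :: "complex \<Rightarrow> (s03_elem, s03_elem set) module" where
  "Vmod l = quot_module (regular_module S03) (V_ideal l)"

definition v0 :: "complex \<Rightarrow> s03_elem set" where
  "v0 l = V_ideal l +>\<^bsub>S03\<^esub> \<one>\<^bsub>S03\<^esub>"

definition w0 :: "s03_elem set" where
  "w0 = (tB [^]\<^bsub>S03\<^esub> (2::nat) \<ominus>\<^bsub>S03\<^esub> \<one>\<^bsub>S03\<^esub>) \<odot>\<^bsub>Vmod 0\<^esub> v0 0"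

definition Tmod :: "(s03_elem, s03_elem set) module" where
  "Tmod = Vmod 0 \<lparr>carrier := line (Vmod 0) w0\<rparr>"

definition Qmod :: "(s03_elem, s03_elem set set) module" where
  "Qmod = quot_module (Vmod 0) (line (Vmod 0) w0)"

text \<open>The vectors \<open>w\<^sub>\<epsilon>\<^sub>,\<^sub>\<epsilon>\<^sub>'\<close> are eigenvectors only after passing to the quotient, so they are
  defined as elements of \<^const>\<open>Qmod\<close>.\<close>

definition wv :: "complex \<Rightarrow> complex \<Rightarrow> s03_elem set set" where
  "wv e e' = line (Vmod 0) w0 +>\<^bsub>Vmod 0\<^esub>
    ((tB \<oplus>\<^bsub>S03\<^esub> sc e \<ominus>\<^bsub>S03\<^esub> sc (\<i> * e * e') \<otimes>\<^bsub>S03\<^esub> tC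
         \<ominus>\<^bsub>S03\<^esub> sc (\<i> * e') \<otimes>\<^bsub>S03\<^esub> (tB \<otimes>\<^bsub>S03\<^esub> tC)) \<odot>\<^bsub>Vmod 0\<^esub> v0 0)"

definition Wmod :: "complex \<Rightarrow> complex \<Rightarrow> (s03_elem, s03_elem set set) module" where
  "Wmod e e' = Qmod \<lparr>carrier := line Qmod (wv e e')\<rparr>"

text \<open>Irreducible representations obtained from the universal modules: all irreducible subquotients
  (quotients of subrepresentations) of some \<^term>\<open>Vmod l\<close>.\<close>

definition irreps :: "(s03_elem, s03_elem set set) module set" where
  "irreps = {quot_module (Vmod l\<lparr>carrier := N\<rparr>) U | l N U.
     submodule N S03 (Vmod l) \<and> submodule U S03 (Vmod l\<lparr>carrier := N\<rparr>) \<and>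
     irreducible_module S03 (quot_module (Vmod l\<lparr>carrier := N\<rparr>) U)}"

definition irrep_classes :: "(s03_elem, s03_elem set set) module set set" where
  "irrep_classes = irreps // {(M, M'). M \<in> irreps \<and> M' \<in> irreps \<and> module_iso S03 M M'}"

end

theory Submission
  imports Defs "HOL-Library.Product_Plus"
begin

text \<open>Every module in sight is cyclic, so it is determined by the annihilator of a generator, a left
  ideal of s03', and all linear algebra becomes computation in s03' modulo a left ideal. If
  \<open>d - \<lambda>\<close> with \<open>\<lambda>\<^sup>2 = 1\<close> lies in the left ideal, every element is congruent to some \<open>j + k b\<close>, and
  \<open>d + \<lambda>\<close> isolates \<open>j\<close>, which gives irreducibility. If \<open>d\<close> lies in it, the algebra acts through the
  commuting elements \<open>b\<close>, \<open>c\<close>, whose five joint eigenvalues are separated by characters and split off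
  by idempotents. Isomorphism classes of irreducible subquotients are told apart by the eigenvalues of
  \<open>b\<close>, \<open>c\<close>, \<open>d\<close>.\<close>

section \<open>The algebra as a type\<close>

text \<open>The relations can only prove that elements coincide; that elements stay distinct must
  come from elsewhere. No basis of s03' itself is constructed. Concrete operators satisfying the
  relations are exhibited instead: five characters, and one two-dimensional model with d = diag(1,
  -1). They yield 1 \<noteq> 0 in s03', the independence of the five vectors spanning V_0, and V_1
  \<noteq> 0. Everywhere else non-vanishing is a hypothesis or part of irreducibility. The opposite
  direction consists of memberships in a left ideal A, each witnessed by an explicit cofactor. Since
  A absorbs factors on the left only, d may be replaced by \<lambda> only at the right end of a
  word; the cofactors record such chains of replacements. The values \<lambda> = 1 and \<lambda> =
  -1 lead to one isomorphism class because b anticommutes with d and squares to 1 there, hence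
  exchanges the two eigenspaces of d. The generator can therefore always be chosen with eigenvalue
  1.\<close>

lemma ring_ring_of_type_algebra: "ring (ring_of_type_algebra :: 'a::ring_1 ring)"
proof -
  have "\<exists>y. x + y = 0" for x :: 'a
    using add.right_inverse by blast
  then show ?thesis
    unfolding ring_of_type_algebra_def using add.right_inverse
    by unfold_locales (auto simp: algebra_simps Units_def)
qed

interpretation FA: ring "ring_of_type_algebra :: free_alg ring"
  by (rule ring_ring_of_type_algebra)

lemma ideal_s03_ideal: "ideal s03_ideal ring_of_type_algebra"
  unfolding s03_ideal_def
  by (rule FA.genideal_ideal) (simp add: ring_of_type_algebra_def)

interpretation S: ring S03
  unfolding S03_def by (rule ideal.quotient_is_ring[OF ideal_s03_ideal])

lemma ring_of_type_algebra_simps [simp]: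
  "carrier ring_of_type_algebra = UNIV"
  "monoid.mult ring_of_type_algebra = (*)"
  "one ring_of_type_algebra = 1"
  "ring.zero ring_of_type_algebra = 0"
  "add ring_of_type_algebra = (+)"
  by (auto simp: ring_of_type_algebra_def)

lemma a_inv_ring_of_type_algebra [simp]: "a_inv ring_of_type_algebra x = - (x :: free_alg)"
  using FA.minus_unique[of "- x" x x] by (simp add: FA.minus_equality)


lemma poly_mapping_single_induct [case_names single add]:
  assumes single: "\<And>w k. P (Poly_Mapping.single w k)"
    and add: "\<And>x y. P x \<Longrightarrow> P y \<Longrightarrow> P (x + y)"
  shows "P (f :: 'a \<Rightarrow>\<^sub>0 'b::monoid_add)"
proof (induction f rule: update_induct)
  case const
  show ?case using single[of _ 0] by simp
next
  case (update f a k)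
  \<comment> \<open>The key \<open>a\<close> is absent from \<open>f\<close>, so overwriting its
    value amounts to adding a monomial.\<close>
  have "Poly_Mapping.update a k f = f + Poly_Mapping.single a k"
    using update(1) by (intro poly_mapping_eqI)
      (auto simp: lookup_add lookup_update lookup_single in_keys_iff when_def)
  then show ?case using update(3) add single by simp
qed

section \<open>Operators satisfying the relations\<close>

primrec letters :: "word \<Rightarrow> gen list" where "letters (Word w) = w"

lemma letters_add [simp]: "letters (u + w) = letters u @ letters w"
  by (cases u; cases w) simp

text \<open>The source of all non-vanishing statements. The relations have the shape
  \<open>... = 0\<close> and are the images of the relators term by term, so that the relators
  visibly act by zero.\<close>

locale s03_model = vector_space scale
  for scale :: "complex \<Rightarrow> 'v::ab_group_add \<Rightarrow> 'v" +
  fixes f :: "gen \<Rightarrow> 'v \<Rightarrow> 'v"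
  assumes f_add: "f g (u + v) = f g u + f g v"
    and f_scale: "f g (scale k v) = scale k (f g v)"
    and f_relations:
      "f GD (f GD (f GD v)) - f GD v = 0"
      "f GB (f GB (f GD v)) - f GD v = 0"
      "f GD (f GB (f GB v)) - f GD v = 0"
      "f GB (f GC v) - f GC (f GB v) + scale 2 (f GD v) = 0"
      "f GD (f GB v) + f GB (f GD v) = 0"
      "f GD (f GB v) - f GC (f GD (f GD v)) = 0"
      "f GD (f GB v) - f GD (f GD (f GC v)) = 0"
      "f GC (f GD v) + f GD (f GC v) = 0"
      "f GB (f GB v) + f GC (f GC v) = 0"
      "f GB (f GB (f GB v)) - f GB v = 0"
      "f GC (f GC (f GC v)) + f GC v = 0"
begin

text \<open>The last letter of a word acts first, so that concatenation of words becomes composition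
  and the action is a left action.\<close>

definition act :: "free_alg \<Rightarrow> 'v \<Rightarrow> 'v" where
  "act x v = (\<Sum>w\<in>Poly_Mapping.keys x. scale (Poly_Mapping.lookup x w) (foldr f (letters w) v))"

lemma act_superset:
  assumes "finite A" "Poly_Mapping.keys x \<subseteq> A"
  shows "act x v = (\<Sum>w\<in>A. scale (Poly_Mapping.lookup x w) (foldr f (letters w) v))"
  unfolding act_def using assms by (intro sum.mono_neutral_left) (auto simp: in_keys_iff)

lemma act_add: "act (x + y) v = act x v + act y v"
proof -
  let ?A = "Poly_Mapping.keys x \<union> Poly_Mapping.keys y"
  have "act x v + act y v
      = (\<Sum>w\<in>?A. scale (Poly_Mapping.lookup x w) (foldr f (letters w) v))
        + (\<Sum>w\<in>?A. scale (Poly_Mapping.lookup y w) (foldr f (letters w) v))"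
    by (simp add: act_superset[of ?A])
  also have "\<dots> = act (x + y) v"
    by (simp add: act_superset[OF _ keys_add] lookup_add scale_left_distrib sum.distrib)
  finally show ?thesis ..
qed

lemma act_single: "act (Poly_Mapping.single w k) v = scale k (foldr f (letters w) v)"
  by (subst act_superset[of "{w}"]) auto

lemma foldr_linear:
  "foldr f w (u + v) = foldr f w u + foldr f w v"
  "foldr f w (scale k v) = scale k (foldr f w v)"
  by (induction w) (simp_all add: f_add f_scale)

lemma act_add_right: "act x (u + v) = act x u + act x v"
  by (simp add: act_def foldr_linear scale_right_distrib sum.distrib)

lemma act_mult: "act (x * y) v = act x (act y v)"
proof (induction x rule: poly_mapping_single_induct)
  case (single w k)
  show ?case
    by (induction y rule: poly_mapping_single_induct)
      (simp_all add: mult_single act_single foldr_linear distrib_left act_add act_add_right)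
qed (simp add: distrib_right act_add)

lemma act_zero [simp]: "act 0 v = 0"
  by (simp add: act_def)

lemma act_zero_right [simp]: "act x 0 = 0"
  using act_add_right[of x 0 0] by simp

lemma act_uminus: "act (- x) v = - act x v"
  using act_add[of x "- x" v] by (simp add: minus_unique)

lemma act_diff: "act (x - y) v = act x v - act y v"
  using act_add[of x "- y" v] by (simp add: act_uminus)

lemma act_fconst: "act (fconst k) v = scale k v"
  by (simp add: fconst_def act_single zero_word_def)

lemma act_fgen: "act (fgen g) v = f g v"
  by (simp add: fgen_def act_single)

text \<open>The elements acting by zero on every vector form a two-sided ideal that contains the
  relators, and \<open>s03_ideal\<close> is the least ideal containing them.\<close>

lemma act_s03_ideal:
  assumes "x \<in> s03_ideal"
  shows "act x v = 0"
proof -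
  let ?K = "{x. \<forall>v. act x v = 0}"
  have "ideal ?K (ring_of_type_algebra :: free_alg ring)"
  proof (rule idealI[OF FA.ring_axioms])
    show "subgroup ?K (add_monoid ring_of_type_algebra)"
    proof (rule FA.add.subgroupI)
      show "?K \<noteq> {}"
        using act_zero by blast
    qed (auto simp: act_add act_uminus simp flip: a_inv_def)
  qed (auto simp: act_mult)
  moreover have "s03_relators \<subseteq> ?K"
    by (auto simp: s03_relators_def Let_def power2_eq_square power3_eq_cube
        act_add act_diff act_mult act_fgen act_fconst f_relations mult.assoc)
  ultimately have "s03_ideal \<subseteq> ?K"
    unfolding s03_ideal_def by (rule FA.genideal_minimal)
  then show ?thesis using assms by auto
qed

end

text \<open>Operators on a line commute, so the commutator relation forces d to act by 0, and what
  remains of the relations is three equations for \<beta> and \<gamma>.\<close>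

lemma s03_model_character:
  fixes \<beta> \<gamma> :: complex
  assumes "\<beta>^2 + \<gamma>^2 = 0" "\<beta>^3 = \<beta>" "\<gamma>^3 = - \<gamma>"
  shows "s03_model (*) (\<lambda>g v. (case g of GB \<Rightarrow> \<beta> | GC \<Rightarrow> \<gamma> | GD \<Rightarrow> 0) * v)"
proof -
  have "\<beta> * \<beta> + \<gamma> * \<gamma> = 0" "\<beta> * (\<beta> * \<beta>) = \<beta>" "\<gamma> * (\<gamma> * \<gamma>) = - \<gamma>"
    using assms by (simp_all add: power2_eq_square power3_eq_cube mult.assoc)
  then have "\<beta> * (\<beta> * v) + \<gamma> * (\<gamma> * v) = 0" "\<beta> * (\<beta> * (\<beta> * v)) = \<beta> * v"
    "\<gamma> * (\<gamma> * (\<gamma> * v)) = - (\<gamma> * v)" for v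
    by (metis distrib_right mult.assoc mult_zero_left mult_minus_left)+
  then show ?thesis
    by unfold_locales (auto simp: algebra_simps split: gen.splits)
qed

text \<open>The trivial character kills the ideal and sends 1 to 1. This supplies the axiom 0
  \<noteq> 1 of the class \<open>ring_1\<close>.\<close>

lemma one_notin_s03_ideal: "1 \<notin> s03_ideal"
proof
  interpret s03_model "(*) :: complex \<Rightarrow> _" "\<lambda>g v. (case g of GB \<Rightarrow> 0 | GC \<Rightarrow> 0 | GD \<Rightarrow> 0) * v"
    by (rule s03_model_character) auto
  assume "1 \<in> s03_ideal"
  then have "act 1 1 = 0" by (rule act_s03_ideal)
  then show False using act_fconst[of 1 1] by (simp add: fconst_def)
qed

lemma s03_class_ring_hom: "s03_class \<in> ring_hom ring_of_type_algebra S03"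
  using ideal.rcos_ring_hom[OF ideal_s03_ideal] unfolding s03_class_def[abs_def] S03_def .

lemma s03_class_closed [simp]: "s03_class x \<in> carrier S03"
  using ring_hom_closed[OF s03_class_ring_hom, of x] by simp

lemma s03_class_mult: "s03_class (x * y) = s03_class x \<otimes>\<^bsub>S03\<^esub> s03_class y"
  using ring_hom_mult[OF s03_class_ring_hom, of x y] by simp

lemma s03_class_add: "s03_class (x + y) = s03_class x \<oplus>\<^bsub>S03\<^esub> s03_class y"
  using ring_hom_add[OF s03_class_ring_hom, of x y] by simp

lemma s03_class_one: "s03_class 1 = \<one>\<^bsub>S03\<^esub>"
  using ring_hom_one[OF s03_class_ring_hom] by simp

lemma s03_class_eq_zero_iff: "s03_class x = \<zero>\<^bsub>S03\<^esub> \<longleftrightarrow> x \<in> s03_ideal"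
proof -
  interpret ideal s03_ideal "ring_of_type_algebra :: free_alg ring" by (rule ideal_s03_ideal)
  show ?thesis
    using a_rcos_const[of x] a_rcos_self[of x] by (auto simp: s03_class_def S03_def FactRing_def)
qed

lemma carrier_S03: "carrier S03 = range s03_class"
  by (auto simp: S03_def FactRing_def s03_class_def A_RCOSETS_def' a_r_coset_def')

text \<open>As a type of class \<^class>\<open>ring_1\<close> the algebra is accessible to rewriting without carrier side
  conditions.\<close>

typedef s03 = "carrier S03"
  morphisms elt s03_of
  using S.zero_closed by blast

setup_lifting type_definition_s03

instantiation s03 :: ring_1
begin

lift_definition zero_s03 :: s03 is "\<zero>\<^bsub>S03\<^esub>" by simp
lift_definition one_s03 :: s03 is "\<one>\<^bsub>S03\<^esub>" by simp
lift_definition plus_s03 :: "s03 \<Rightarrow> s03 \<Rightarrow> s03" is "(\<oplus>\<^bsub>S03\<^esub>)" by simp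
lift_definition times_s03 :: "s03 \<Rightarrow> s03 \<Rightarrow> s03" is "(\<otimes>\<^bsub>S03\<^esub>)" by simp
lift_definition uminus_s03 :: "s03 \<Rightarrow> s03" is "a_inv S03" by simp
lift_definition minus_s03 :: "s03 \<Rightarrow> s03 \<Rightarrow> s03" is "a_minus S03" by simp

instance
proof
  fix a b c :: s03
  show "a + b + c = a + (b + c)" by transfer (rule S.a_assoc)
  show "a + b = b + a" by transfer (rule S.a_comm)
  show "0 + a = a" by transfer simp
  show "- a + a = 0" by transfer (rule S.l_neg)
  show "a - b = a + - b" by transfer (rule S.minus_eq)
  show "a * b * c = a * (b * c)" by transfer (rule S.m_assoc)
  show "1 * a = a" by transfer simp
  show "a * 1 = a" by transfer simp
  show "(a + b) * c = a * c + b * c" by transfer (rule S.l_distr)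
  show "a * (b + c) = a * b + a * c" by transfer (rule S.r_distr)
  show "(0::s03) \<noteq> 1"
    by transfer (metis one_notin_s03_ideal s03_class_eq_zero_iff s03_class_one)
qed

end

lemma elt_closed [simp]: "elt x \<in> carrier S03"
  by (rule elt)

lemma elt_power: "elt (x ^ n) = elt x [^]\<^bsub>S03\<^esub> n"
proof (induction n)
  case (Suc n)
  then show ?case
    by (metis S.nat_pow_Suc power_Suc2 times_s03.rep_eq)
qed (simp add: one_s03.rep_eq)

lift_definition s03_cls :: "free_alg \<Rightarrow> s03" is s03_class by simp

lemma s03_cls_mult: "s03_cls (x * y) = s03_cls x * s03_cls y"
  by transfer (rule s03_class_mult)

lemma s03_cls_add: "s03_cls (x + y) = s03_cls x + s03_cls y"
  by transfer (rule s03_class_add)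

lemma s03_cls_one: "s03_cls 1 = 1"
  by transfer (rule s03_class_one)

lemma s03_cls_uminus: "s03_cls (- x) = - s03_cls x"
  by (metis add.right_inverse add_cancel_right_right minus_unique s03_cls_add)

lemma s03_cls_diff: "s03_cls (x - y) = s03_cls x - s03_cls y"
  by (metis diff_conv_add_uminus s03_cls_add s03_cls_uminus)

lemma s03_cls_power: "s03_cls (x ^ n) = s03_cls x ^ n"
  by (induction n) (simp_all add: s03_cls_one s03_cls_mult)

lemma s03_cls_eq_zero_iff: "s03_cls x = 0 \<longleftrightarrow> x \<in> s03_ideal"
  by transfer (rule s03_class_eq_zero_iff)

lemma surj_s03_cls: "\<exists>y. x = s03_cls y"
  by transfer (auto simp: carrier_S03)

section \<open>Scalars, generators and relations inside the type\<close>

definition \<kappa> :: "complex \<Rightarrow> s03" where "\<kappa> c = s03_cls (fconst c)"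
definition \<b> :: s03 where "\<b> = s03_cls (fgen GB)"
definition \<c> :: s03 where "\<c> = s03_cls (fgen GC)"
definition \<d> :: s03 where "\<d> = s03_cls (fgen GD)"

text \<open>The bridge between the two levels: used from right to left it turns the carrier-level
  terms of the theorem into terms over the type.\<close>

lemma elt_generators: "elt (\<kappa> k) = sc k" "elt \<b> = tB" "elt \<c> = tC" "elt \<d> = tD"
  by (simp_all add: \<kappa>_def \<b>_def \<c>_def \<d>_def sc_def tB_def tC_def tD_def s03_cls.rep_eq)

lemma \<kappa>_0 [simp]: "\<kappa> 0 = 0"
  using s03_cls_add[of 0 0] by (simp add: \<kappa>_def fconst_def)

lemma \<kappa>_1 [simp]: "\<kappa> 1 = 1"
  by (simp add: \<kappa>_def fconst_def s03_cls_one)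

lemma \<kappa>_add: "\<kappa> (x + y) = \<kappa> x + \<kappa> y"
  by (simp add: \<kappa>_def fconst_def single_add s03_cls_add)

lemma \<kappa>_uminus: "\<kappa> (- x) = - \<kappa> x"
  by (simp add: \<kappa>_def fconst_def single_uminus s03_cls_uminus)

lemma \<kappa>_diff: "\<kappa> (x - y) = \<kappa> x - \<kappa> y"
  by (simp add: \<kappa>_def fconst_def single_diff s03_cls_diff)

lemma \<kappa>_mult: "\<kappa> (x * y) = \<kappa> x * \<kappa> y"
  by (simp add: \<kappa>_def fconst_def mult_single s03_cls_mult[symmetric])

lemma \<kappa>_numeral [simp]: "\<kappa> (numeral n) = numeral n"
proof -
  have "\<kappa> (of_nat m) = of_nat m" for m
    by (induction m) (simp_all add: \<kappa>_add)
  from this[of "numeral n"] show ?thesis by simp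
qed

lemma fconst_central: "fconst k * x = x * fconst k"
  by (induction x rule: poly_mapping_single_induct)
    (simp_all add: fconst_def mult_single mult.commute algebra_simps)

lemma \<kappa>_central: "x * \<kappa> k = \<kappa> k * x"
  using surj_s03_cls[of x] by (auto simp: \<kappa>_def fconst_central s03_cls_mult[symmetric])

lemma s03_relations:
  "\<d> ^ 3 = \<d>" "\<b> ^ 2 * \<d> = \<d>" "\<d> * \<b> ^ 2 = \<d>"
  "\<b> * \<c> - \<c> * \<b> + 2 * \<d> = 0"
  "\<d> * \<b> + \<b> * \<d> = 0" "\<d> * \<b> = \<c> * \<d> ^ 2" "\<d> * \<b> = \<d> ^ 2 * \<c>"
  "\<c> * \<d> + \<d> * \<c> = 0" "\<b> ^ 2 + \<c> ^ 2 = 0" "\<b> ^ 3 = \<b>" "\<c> ^ 3 + \<c> = 0"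
proof -
  have rel: "s03_cls r = 0" if "r \<in> s03_relators" for r
    using that FA.genideal_self[of s03_relators] by (auto simp: s03_cls_eq_zero_iff s03_ideal_def)
  note [simp] = s03_cls_add s03_cls_diff s03_cls_mult s03_cls_power
    \<b>_def[symmetric] \<c>_def[symmetric] \<d>_def[symmetric] \<kappa>_def[symmetric]
  show "\<d> ^ 3 = \<d>" "\<b> ^ 2 * \<d> = \<d>" "\<d> * \<b> ^ 2 = \<d>"
    "\<b> * \<c> - \<c> * \<b> + 2 * \<d> = 0"
    "\<d> * \<b> + \<b> * \<d> = 0" "\<d> * \<b> = \<c> * \<d> ^ 2" "\<d> * \<b> = \<d> ^ 2 * \<c>"
    "\<c> * \<d> + \<d> * \<c> = 0" "\<b> ^ 2 + \<c> ^ 2 = 0" "\<b> ^ 3 = \<b>" "\<c> ^ 3 + \<c> = 0"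
    using rel[of "fgen GD^3 - fgen GD"] rel[of "fgen GB^2 * fgen GD - fgen GD"]
      rel[of "fgen GD * fgen GB^2 - fgen GD"]
      rel[of "fgen GB * fgen GC - fgen GC * fgen GB + fconst 2 * fgen GD"]
      rel[of "fgen GD * fgen GB + fgen GB * fgen GD"]
      rel[of "fgen GD * fgen GB - fgen GC * fgen GD^2"]
      rel[of "fgen GD * fgen GB - fgen GD^2 * fgen GC"]
      rel[of "fgen GC * fgen GD + fgen GD * fgen GC"]
      rel[of "fgen GB^2 + fgen GC^2"] rel[of "fgen GB^3 - fgen GB"] rel[of "fgen GC^3 + fgen GC"]
    by (simp_all add: s03_relators_def Let_def)
qed

text \<open>Letters are only prepended. A congruence modulo a left ideal survives multiplication
  from the left, so this form of induction suits all the spanning arguments.\<close>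

lemma s03_induct [case_names const gen add]:
  assumes const: "\<And>k. P (\<kappa> k)"
    and gen: "\<And>x. P x \<Longrightarrow> P (\<b> * x) \<and> P (\<c> * x) \<and> P (\<d> * x)"
    and add: "\<And>x y. P x \<Longrightarrow> P y \<Longrightarrow> P (x + y)"
  shows "P x"
proof -
  have single: "P (s03_cls (Poly_Mapping.single (Word w) k))" for w k
  proof (induction w)
    case Nil
    then show ?case using const[of k] by (simp add: \<kappa>_def fconst_def zero_word_def)
  next
    case (Cons g w)
    have "Poly_Mapping.single (Word (g # w)) k = fgen g * Poly_Mapping.single (Word w) k"
      by (simp add: fgen_def mult_single)
    then show ?case
      using gen[OF Cons] by (cases g) (simp_all add: s03_cls_mult \<b>_def \<c>_def \<d>_def)
  qed
  have "P (s03_cls f)" for f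
    by (induction f rule: poly_mapping_single_induct)
      (auto simp: s03_cls_add add intro: single split: word.split, metis single word.exhaust)
  then show ?thesis using surj_s03_cls[of x] by auto
qed


context s03_model
begin

text \<open>The action of the free algebra descended to the quotient. The choice of a representative
  is harmless because \<open>s03_ideal\<close> acts by zero; \<open>rep_s03_cls\<close> records
  this.\<close>

definition rep :: "s03 \<Rightarrow> 'v \<Rightarrow> 'v" where
  "rep x = act (SOME y. x = s03_cls y)"

lemma rep_s03_cls: "rep (s03_cls y) v = act y v"
proof -
  have "s03_cls y = s03_cls (SOME z. s03_cls y = s03_cls z)"
    by (rule someI) (rule refl)
  then have "y - (SOME z. s03_cls y = s03_cls z) \<in> s03_ideal"
    by (simp flip: s03_cls_eq_zero_iff add: s03_cls_diff)
  from act_s03_ideal[OF this, of v] show ?thesis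
    by (simp add: rep_def act_diff)
qed

lemma rep_add: "rep (x + y) v = rep x v + rep y v"
  using surj_s03_cls[of x] surj_s03_cls[of y]
  by (auto simp: rep_s03_cls act_add simp flip: s03_cls_add)

lemma rep_mult: "rep (x * y) v = rep x (rep y v)"
  using surj_s03_cls[of x] surj_s03_cls[of y]
  by (auto simp: rep_s03_cls act_mult simp flip: s03_cls_mult)

lemma rep_diff: "rep (x - y) v = rep x v - rep y v"
  using rep_add[of "x - y" y v] by simp

lemma rep_zero_right: "rep x 0 = 0"
  using surj_s03_cls[of x] by (auto simp: rep_s03_cls)

lemma rep_generators: "rep (\<kappa> k) v = scale k v" "rep \<b> v = f GB v" "rep \<c> v = f GC v" "rep \<d> v = f GD v"
  by (simp_all add: \<kappa>_def \<b>_def \<c>_def \<d>_def rep_s03_cls act_fconst act_fgen)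

end

section \<open>Left modules: submodules and quotients\<close>

context left_module
begin

lemma smult_r_null: "a \<in> carrier R \<Longrightarrow> a \<odot>\<^bsub>M\<^esub> \<zero>\<^bsub>M\<^esub> = \<zero>\<^bsub>M\<^esub>"
  using smult_r_distr[of a "\<zero>\<^bsub>M\<^esub>" "\<zero>\<^bsub>M\<^esub>"] smult_closed[of a "\<zero>\<^bsub>M\<^esub>"]
    M.add.l_cancel_one'[of "a \<odot>\<^bsub>M\<^esub> \<zero>\<^bsub>M\<^esub>" "a \<odot>\<^bsub>M\<^esub> \<zero>\<^bsub>M\<^esub>"] by simp

lemma smult_l_null: "x \<in> carrier M \<Longrightarrow> \<zero> \<odot>\<^bsub>M\<^esub> x = \<zero>\<^bsub>M\<^esub>"
  using smult_l_distr[of \<zero> \<zero> x] smult_closed[of \<zero> x]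
    M.add.l_cancel_one'[of "\<zero> \<odot>\<^bsub>M\<^esub> x" "\<zero> \<odot>\<^bsub>M\<^esub> x"] by simp

lemma smult_l_minus:
  assumes "a \<in> carrier R" "x \<in> carrier M"
  shows "(\<ominus> a) \<odot>\<^bsub>M\<^esub> x = \<ominus>\<^bsub>M\<^esub> (a \<odot>\<^bsub>M\<^esub> x)"
proof (rule M.minus_equality[symmetric])
  show "(\<ominus> a) \<odot>\<^bsub>M\<^esub> x \<oplus>\<^bsub>M\<^esub> a \<odot>\<^bsub>M\<^esub> x = \<zero>\<^bsub>M\<^esub>"
    using assms by (simp add: R.l_neg smult_l_null flip: smult_l_distr)
qed (use assms in \<open>simp_all add: smult_closed\<close>)

text \<open>Closure under negatives follows from the action of
  \<open>\<ominus> \<one>\<close>.\<close>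

lemma submoduleI:
  assumes "N \<subseteq> carrier M" "N \<noteq> {}"
    and "\<And>x y. x \<in> N \<Longrightarrow> y \<in> N \<Longrightarrow> x \<oplus>\<^bsub>M\<^esub> y \<in> N"
    and smult: "\<And>a x. a \<in> carrier R \<Longrightarrow> x \<in> N \<Longrightarrow> a \<odot>\<^bsub>M\<^esub> x \<in> N"
  shows "submodule N R M"
proof -
  have "\<ominus>\<^bsub>M\<^esub> x \<in> N" if "x \<in> N" for x
  proof -
    have "\<ominus>\<^bsub>M\<^esub> x = (\<ominus> \<one>) \<odot>\<^bsub>M\<^esub> x"
      using that assms(1) by (simp add: smult_l_minus smult_one subset_iff)
    then show ?thesis using smult[OF _ that, of "\<ominus> \<one>"] by simp
  qed
  then have "subgroup N (add_monoid M)"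
    using assms by (intro M.add.subgroupI) (auto simp flip: a_inv_def)
  then show ?thesis
    using smult by (simp add: submodule_def submodule_axioms_def)
qed

lemma submodule_left_module:
  assumes "submodule N R M"
  shows "left_module R (M\<lparr>carrier := N\<rparr>)"
proof -
  interpret N: submodule N R M by fact
  have sub: "\<And>x. x \<in> N \<Longrightarrow> x \<in> carrier M"
    using N.subset by auto
  have "abelian_group (M\<lparr>carrier := N\<rparr>)"
  proof (rule abelian_groupI, goal_cases)
    case (6 x)
    have "\<ominus>\<^bsub>M\<^esub> x \<in> N" using N.m_inv_closed[of x] 6 by (simp add: a_inv_def)
    then show ?case using 6 sub by (auto intro!: bexI[of _ "\<ominus>\<^bsub>M\<^esub> x"] M.l_neg)
  next
    case (4 x y)
    then show ?case using M.a_comm[of x y] sub by simp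
  qed (use N.m_closed N.one_closed in \<open>simp_all add: sub M.a_assoc\<close>)
  then show ?thesis
    using R.ring_axioms
    by (simp add: left_module_def left_module_axioms_def smult_l_distr smult_r_distr smult_assoc1
        smult_one sub)
qed

lemma submodule_zero: "submodule {\<zero>\<^bsub>M\<^esub>} R M"
  by (rule submoduleI) (auto simp: smult_r_null)

lemma submodule_carrier: "submodule (carrier M) R M"
  by (rule submoduleI) (auto simp: smult_closed intro: M.zero_closed)

lemma submodule_abelian_subgroup:
  assumes "submodule N R M"
  shows "abelian_subgroup N M"
  using assms by (intro abelian_subgroupI3 additive_subgroupI)
    (simp_all add: submodule_def M.abelian_group_axioms)

end

locale quotient_module = left_module R M + submodule N R M
  for R :: "'a ring" and M :: "('a, 'b) module" (structure) and N
begin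

sublocale N: abelian_subgroup N M
  by (rule submodule_abelian_subgroup) (rule submodule_axioms)

abbreviation "Q \<equiv> quot_module M N"

lemma carrier_quot: "carrier Q = (\<lambda>x. N +> x) ` carrier M"
  by (auto simp: quot_module_def A_RCOSETS_def' a_r_coset_def')

lemma zero_quot: "\<zero>\<^bsub>Q\<^esub> = N"
  by (simp add: quot_module_def)

lemma add_quot: "x \<in> carrier M \<Longrightarrow> y \<in> carrier M \<Longrightarrow> (N +> x) \<oplus>\<^bsub>Q\<^esub> (N +> y) = N +> (x \<oplus> y)"
  by (simp add: quot_module_def N.a_rcos_sum)

lemma coset_eq_zero_iff: "x \<in> carrier M \<Longrightarrow> N +> x = \<zero>\<^bsub>Q\<^esub> \<longleftrightarrow> x \<in> N"
  using N.a_rcos_const[of x] N.a_rcos_self[of x] by (auto simp: zero_quot)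

text \<open>The action on a coset is a union over all its representatives. Two representatives
  differ by an element of N, and a N lies in N, so all members of the union are the same
  coset.\<close>

lemma smult_quot:
  assumes a: "a \<in> carrier R" and x: "x \<in> carrier M"
  shows "a \<odot>\<^bsub>Q\<^esub> (N +> x) = N +> (a \<odot> x)"
proof -
  have "N +> (a \<odot> y) = N +> (a \<odot> x)" if y: "y \<in> N +> x" for y
  proof -
    obtain n where n: "n \<in> N" "y = n \<oplus> x"
      using y by (auto simp: a_r_coset_def')
    have "n \<in> carrier M" using n N.a_subset by auto
    then have "a \<odot> y = (a \<odot> n) \<oplus> (a \<odot> x)" using n a x smult_r_distr by simp
    moreover have "a \<odot> n \<in> N" using a n(1) by (rule submodule.smult_closed[OF submodule_axioms])
    ultimately have "a \<odot> y \<in> N +> (a \<odot> x)" by (auto simp: a_r_coset_def')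
    then show ?thesis
      using N.a_repr_independence'[of "a \<odot> y" "a \<odot> x"] a x left_module.smult_closed[OF left_module_axioms]
      by simp
  qed
  moreover have "x \<in> N +> x" using x by (rule N.a_rcos_self)
  ultimately have "(\<Union>y\<in>N +> x. N +> (a \<odot> y)) = N +> (a \<odot> x)"
    by (intro UN_constant_eq ballI)
  then show ?thesis by (simp add: quot_module_def)
qed

lemma carrier_quotE:
  assumes "u \<in> carrier Q"
  obtains x where "x \<in> carrier M" "u = N +> x"
  using assms unfolding carrier_quot by (rule imageE)

lemma coset_closed: "x \<in> carrier M \<Longrightarrow> N +> x \<in> carrier Q"
  unfolding carrier_quot by (rule imageI)

lemma coset_zero: "N +> \<zero> = \<zero>\<^bsub>Q\<^esub>"
  by (simp add: coset_eq_zero_iff)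

lemma left_module_quot: "left_module R Q"
proof -
  note closed = left_module.smult_closed[OF left_module_axioms]
  have "abelian_group Q"
  proof (rule abelian_groupI, goal_cases)
    case (1 u v)
    then show ?case by (elim carrier_quotE) (simp add: add_quot coset_closed)
  next
    case 2
    show ?case by (metis M.zero_closed coset_closed coset_zero)
  next
    case (3 u v w)
    then show ?case by (elim carrier_quotE) (simp add: add_quot M.a_assoc)
  next
    case (4 u v)
    then show ?case by (elim carrier_quotE) (simp add: add_quot M.a_comm)
  next
    case (5 u)
    then show ?case by (elim carrier_quotE) (simp add: add_quot flip: coset_zero)
  next
    case (6 u)
    then obtain x where x: "x \<in> carrier M" "u = N +> x" by (rule carrier_quotE)
    then have "(N +> (\<ominus> x)) \<oplus>\<^bsub>Q\<^esub> u = \<zero>\<^bsub>Q\<^esub>"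
      by (simp add: add_quot M.l_neg coset_zero)
    moreover have "N +> (\<ominus> x) \<in> carrier Q" using x by (simp add: coset_closed)
    ultimately show ?case by blast
  qed
  moreover have "left_module_axioms R Q"
  proof (rule left_module_axioms.intro, goal_cases)
    case (1 a u)
    then show ?case by (elim carrier_quotE) (simp add: smult_quot coset_closed closed)
  next
    case (2 a b u)
    then show ?case by (elim carrier_quotE) (simp add: smult_quot add_quot smult_l_distr closed)
  next
    case (3 a u v)
    then show ?case by (elim carrier_quotE) (simp add: smult_quot add_quot smult_r_distr closed)
  next
    case (4 a b u)
    then show ?case by (elim carrier_quotE) (simp add: smult_quot smult_assoc1 closed)
  next
    case (5 u)
    then show ?case by (elim carrier_quotE) (simp add: smult_quot smult_one)
  qed
  ultimately show ?thesis
    using R.ring_axioms by (simp add: left_module_def)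
qed

end

lemma left_module_regular_module:
  assumes "ring R"
  shows "left_module R (regular_module R)"
proof -
  interpret ring R by fact
  have "abelian_group (regular_module R)"
  proof (rule abelian_groupI, goal_cases)
    case (4 x y)
    then show ?case by (simp add: regular_module_def a_comm)
  next
    case (6 x)
    then show ?case by (auto simp: regular_module_def intro!: bexI[of _ "\<ominus>\<^bsub>R\<^esub> x"] l_neg)
  qed (simp_all add: regular_module_def a_assoc)
  then show ?thesis
    by (simp add: left_module_def left_module_axioms_def regular_module_def ring_axioms
        l_distr r_distr m_assoc)
qed

section \<open>Modules over s03'\<close>

text \<open>Oriented as rewrite rules: the letters of a word are sorted into the order b, c, d, and
  c^2 is traded for -b^2. Writing 2d as d + d lets distributivity treat it without rules for
  numerals.\<close>

lemma s03_commutation: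
  "\<c> * \<b> = \<b> * \<c> + \<d> + \<d>" "\<d> * \<b> = - (\<b> * \<d>)" "\<d> * \<c> = - (\<c> * \<d>)" "\<c> * \<c> = - (\<b> * \<b>)"
proof -
  note r = s03_relations[unfolded power2_eq_square]
  show "\<c> * \<b> = \<b> * \<c> + \<d> + \<d>"
    using r(4) by (simp add: algebra_simps mult_2)
  show "\<d> * \<b> = - (\<b> * \<d>)" "\<d> * \<c> = - (\<c> * \<d>)" "\<c> * \<c> = - (\<b> * \<b>)"
    using r(5) r(8) r(9) by (simp_all add: add_eq_0_iff2 add_eq_0_iff)
qed

text \<open>These seven are exactly the words of length three left irreducible by
  \<open>s03_commutation\<close>. Together the rules reduce every word to a combination of 1, b, c,
  d, bb, bc, bd, cd, dd, which is the nine-element basis up to the sign of cd = -dc.\<close>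

lemma s03_products:
  "\<b> * (\<b> * \<b>) = \<b>" "\<b> * (\<b> * \<c>) = \<c>" "\<b> * (\<b> * \<d>) = \<d>" "\<d> * (\<d> * \<d>) = \<d>"
  "\<c> * (\<d> * \<d>) = - (\<b> * \<d>)" "\<b> * (\<d> * \<d>) = - (\<c> * \<d>)" "\<b> * (\<c> * \<d>) = - (\<d> * \<d>)"
proof -
  note r = s03_relations[unfolded power2_eq_square power3_eq_cube mult.assoc]
  show "\<b> * (\<b> * \<b>) = \<b>" by (rule r(10))
  show bbd: "\<b> * (\<b> * \<d>) = \<d>" by (rule r(2))
  show ddd: "\<d> * (\<d> * \<d>) = \<d>" by (rule r(1))
  show cdd: "\<c> * (\<d> * \<d>) = - (\<b> * \<d>)"
    using r(6) s03_commutation(2) by (simp only:)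
  \<comment> \<open>Substituting -c^2 for b^2 turns c^3 = -c into b^2 c = c.\<close>
  have bb: "\<b> * \<b> = - (\<c> * \<c>)"
    using s03_commutation(4) by simp
  have "\<c> * (\<c> * \<c>) = - \<c>"
    using r(11) by (simp add: add_eq_0_iff2)
  then show "\<b> * (\<b> * \<c>) = \<c>"
    using arg_cong[OF bb, of "\<lambda>x. x * \<c>"] by (simp add: mult.assoc)
  show bdd: "\<b> * (\<d> * \<d>) = - (\<c> * \<d>)"
    using arg_cong[OF cdd, of "\<lambda>x. - x * \<d>"] by (simp add: mult.assoc ddd)
  show "\<b> * (\<c> * \<d>) = - (\<d> * \<d>)"
    \<comment> \<open>The word b b d d is evaluated in two ways: as b (b d^2) = -b c d and as (b^2
      d) d = d^2.\<close>
    using arg_cong[OF bdd, of "\<lambda>x. - \<b> * x"] arg_cong[OF bbd, of "\<lambda>x. - x * \<d>"]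
    by (simp add: mult.assoc)
qed

text \<open>With products nested to the right, a rule for x y has to match also where x y is
  followed by further letters.\<close>

lemma mult_assoc_rewrite: "x * y = z \<Longrightarrow> x * (y * u) = z * (u :: 'a::semigroup_mult)"
  by (simp flip: mult.assoc)

lemma mult_assoc_rewrite3: "x * (y * z) = w \<Longrightarrow> x * (y * (z * u)) = w * (u :: 'a::semigroup_mult)"
  by (simp flip: mult.assoc)

lemmas \<kappa>_left = \<kappa>_central[of \<b>] \<kappa>_central[of \<c>] \<kappa>_central[of \<d>]

text \<open>Normalisation to the nine words with scalars merged in front. It verifies the cofactor
  identities that witness membership in left ideals.\<close>

lemmas s03_nf =
  s03_commutation s03_commutation[THEN mult_assoc_rewrite]
  s03_products s03_products[THEN mult_assoc_rewrite3]
  \<kappa>_left \<kappa>_left[THEN mult_assoc_rewrite] \<kappa>_mult[symmetric] \<kappa>_mult[symmetric, THEN mult_assoc_rewrite]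
  mult.assoc distrib_left distrib_right left_diff_distrib right_diff_distrib

section \<open>Modules with scalars taken from the type\<close>

locale s03_module = left_module S03 M for M :: "(s03_elem, 'v) module" (structure)

abbreviation star :: "s03 \<Rightarrow> (s03_elem, 'v) module \<Rightarrow> 'v \<Rightarrow> 'v" ("_ \<star>\<^bsub>_\<^esub> _" [76, 0, 75] 75)
  where "x \<star>\<^bsub>M\<^esub> m \<equiv> elt x \<odot>\<^bsub>M\<^esub> m"

context s03_module
begin

lemma star_closed [simp]: "m \<in> carrier M \<Longrightarrow> x \<star>\<^bsub>M\<^esub> m \<in> carrier M"
  by (simp add: smult_closed)

lemma star_add: "m \<in> carrier M \<Longrightarrow> (x + y) \<star>\<^bsub>M\<^esub> m = x \<star>\<^bsub>M\<^esub> m \<oplus> y \<star>\<^bsub>M\<^esub> m"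
  by (simp add: plus_s03.rep_eq smult_l_distr)

lemma star_mult: "m \<in> carrier M \<Longrightarrow> (x * y) \<star>\<^bsub>M\<^esub> m = x \<star>\<^bsub>M\<^esub> (y \<star>\<^bsub>M\<^esub> m)"
  by (simp add: times_s03.rep_eq smult_assoc1)

lemma star_one: "m \<in> carrier M \<Longrightarrow> 1 \<star>\<^bsub>M\<^esub> m = m"
  by (simp add: one_s03.rep_eq smult_one)

lemma star_zero: "m \<in> carrier M \<Longrightarrow> 0 \<star>\<^bsub>M\<^esub> m = \<zero>"
  by (simp add: zero_s03.rep_eq smult_l_null)

lemma star_zero_right: "x \<star>\<^bsub>M\<^esub> \<zero> = \<zero>"
  by (simp add: smult_r_null)

lemma star_uminus: "m \<in> carrier M \<Longrightarrow> (- x) \<star>\<^bsub>M\<^esub> m = \<ominus> (x \<star>\<^bsub>M\<^esub> m)"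
  by (simp add: uminus_s03.rep_eq smult_l_minus)

lemma star_add_right:
  "m \<in> carrier M \<Longrightarrow> n \<in> carrier M \<Longrightarrow> x \<star>\<^bsub>M\<^esub> (m \<oplus> n) = x \<star>\<^bsub>M\<^esub> m \<oplus> x \<star>\<^bsub>M\<^esub> n"
  by (simp add: smult_r_distr)

lemma star_eq_iff:
  assumes m: "m \<in> carrier M"
  shows "x \<star>\<^bsub>M\<^esub> m = y \<star>\<^bsub>M\<^esub> m \<longleftrightarrow> (x - y) \<star>\<^bsub>M\<^esub> m = \<zero>"
proof
  assume "x \<star>\<^bsub>M\<^esub> m = y \<star>\<^bsub>M\<^esub> m"
  then show "(x - y) \<star>\<^bsub>M\<^esub> m = \<zero>"
    using star_add[OF m, of x "- y"] m by (simp add: star_uminus M.r_neg)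
next
  assume "(x - y) \<star>\<^bsub>M\<^esub> m = \<zero>"
  then show "x \<star>\<^bsub>M\<^esub> m = y \<star>\<^bsub>M\<^esub> m"
    using star_add[OF m, of "x - y" y] m by simp
qed

lemma star_mult_eq_zero: "m \<in> carrier M \<Longrightarrow> y \<star>\<^bsub>M\<^esub> m = \<zero> \<Longrightarrow> (x * y) \<star>\<^bsub>M\<^esub> m = \<zero>"
  by (simp add: star_mult star_zero_right)

lemma \<kappa>_star_eq_zero:
  assumes "m \<in> carrier M" "\<kappa> k \<star>\<^bsub>M\<^esub> m = \<zero>"
  shows "k = 0 \<or> m = \<zero>"
proof (rule disjCI)
  assume "m \<noteq> \<zero>"
  show "k = 0"
  proof (rule ccontr)
    assume "k \<noteq> 0"
    then have "m = \<kappa> (1 / k * k) \<star>\<^bsub>M\<^esub> m" using assms by (simp add: star_one)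
    also have "\<dots> = \<zero>" unfolding \<kappa>_mult using assms by (rule star_mult_eq_zero)
    finally show False using \<open>m \<noteq> \<zero>\<close> by simp
  qed
qed

definition cyclic :: "'v \<Rightarrow> 'v set" where "cyclic y = range (\<lambda>x. x \<star>\<^bsub>M\<^esub> y)"

lemma submodule_cyclic:
  assumes "y \<in> carrier M"
  shows "submodule (cyclic y) S03 M"
proof (rule submoduleI)
  fix u v assume "u \<in> cyclic y" "v \<in> cyclic y"
  then obtain x x' where "u = x \<star>\<^bsub>M\<^esub> y" "v = x' \<star>\<^bsub>M\<^esub> y"
    unfolding cyclic_def by blast
  then have "u \<oplus> v = (x + x') \<star>\<^bsub>M\<^esub> y" using assms by (simp add: star_add)
  then show "u \<oplus> v \<in> cyclic y" by (simp add: cyclic_def)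
next
  fix a u assume "a \<in> carrier S03" "u \<in> cyclic y"
  then obtain x x' where "a = elt x" "u = x' \<star>\<^bsub>M\<^esub> y"
    unfolding cyclic_def by (auto elim: elt_cases)
  then have "a \<odot> u = (x * x') \<star>\<^bsub>M\<^esub> y" using assms by (simp add: star_mult)
  then show "a \<odot> u \<in> cyclic y" by (simp add: cyclic_def)
qed (use assms in \<open>auto simp: cyclic_def\<close>)

lemma mem_cyclic: "y \<in> carrier M \<Longrightarrow> y \<in> cyclic y"
  unfolding cyclic_def using star_one by (intro range_eqI[of _ _ 1]) simp

lemma finsum_star:
  assumes "finite I" "m \<in> carrier M"
  shows "(\<Oplus>i\<in>I. f i \<star>\<^bsub>M\<^esub> m) = (\<Sum>i\<in>I. f i) \<star>\<^bsub>M\<^esub> m"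
  using assms by (induction I) (simp_all add: star_zero star_add Pi_def)

lemma star_finsum:
  assumes "finite I" "\<And>i. i \<in> I \<Longrightarrow> f i \<in> carrier M"
  shows "x \<star>\<^bsub>M\<^esub> (\<Oplus>i\<in>I. f i) = (\<Oplus>i\<in>I. x \<star>\<^bsub>M\<^esub> f i)"
  using assms by (induction I) (simp_all add: star_zero_right star_add_right Pi_def M.finsum_closed)

lemma lincomb_star:
  assumes "y \<in> carrier M"
  shows "lincomb M k (map (\<lambda>x. x \<star>\<^bsub>M\<^esub> y) xs) = (\<Sum>i<length xs. \<kappa> (k i) * xs ! i) \<star>\<^bsub>M\<^esub> y"
proof -
  have "lincomb M k (map (\<lambda>x. x \<star>\<^bsub>M\<^esub> y) xs) = (\<Oplus>i\<in>{..<length xs}. (\<kappa> (k i) * xs ! i) \<star>\<^bsub>M\<^esub> y)"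
    unfolding lincomb_def
    using assms by (intro M.finsum_cong') (auto simp: star_mult simp flip: elt_generators)
  then show ?thesis using assms by (simp add: finsum_star)
qed

text \<open>For multiples of one vector y, spanning and independence are questions about
  coefficients in s03' modulo the annihilator of y.\<close>

lemma is_basis_starI:
  assumes "y \<in> carrier M"
    and span: "\<And>m. m \<in> carrier M \<Longrightarrow> \<exists>k. m = (\<Sum>i<length xs. \<kappa> (k i) * xs ! i) \<star>\<^bsub>M\<^esub> y"
    and indep: "\<And>k i. (\<Sum>i<length xs. \<kappa> (k i) * xs ! i) \<star>\<^bsub>M\<^esub> y = \<zero> \<Longrightarrow> i < length xs \<Longrightarrow> k i = 0"
  shows "is_basis M (map (\<lambda>x. x \<star>\<^bsub>M\<^esub> y) xs)"
  using assms by (auto simp: is_basis_def lincomb_star)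

lemma submodule_s03_module: "submodule N S03 M \<Longrightarrow> s03_module (M\<lparr>carrier := N\<rparr>)"
  unfolding s03_module_def by (rule submodule_left_module)

end

section \<open>Left ideals and annihilators\<close>

text \<open>Kept more general than annihilators of vectors, since the comparison of two modules
  works modulo the intersection of two annihilators.\<close>

definition left_ideal :: "s03 set \<Rightarrow> bool" where
  "left_ideal A \<longleftrightarrow> 0 \<in> A \<and> (\<forall>x\<in>A. \<forall>y\<in>A. x + y \<in> A) \<and> (\<forall>r. \<forall>x\<in>A. r * x \<in> A)"

context
  fixes A assumes A: "left_ideal A"
begin

lemma left_ideal_0: "0 \<in> A"
  and left_ideal_add: "x \<in> A \<Longrightarrow> y \<in> A \<Longrightarrow> x + y \<in> A"
  and left_ideal_mult: "x \<in> A \<Longrightarrow> r * x \<in> A"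
  using A by (auto simp: left_ideal_def)

lemma left_ideal_uminus: "x \<in> A \<Longrightarrow> - x \<in> A"
  using left_ideal_mult[of x "-1"] by simp

lemma left_ideal_diff: "x \<in> A \<Longrightarrow> y \<in> A \<Longrightarrow> x - y \<in> A"
  using left_ideal_add[of x "- y"] left_ideal_uminus by simp

lemma left_ideal_\<kappa>:
  assumes "\<kappa> k \<in> A" "1 \<notin> A"
  shows "k = 0"
  using left_ideal_mult[OF assms(1), of "\<kappa> (1 / k)"] assms(2) by (auto simp flip: \<kappa>_mult split: if_splits)

lemma congruent_scalar:
  assumes "\<b> - \<kappa> \<beta> \<in> A" "\<c> - \<kappa> \<gamma> \<in> A" "\<d> \<in> A"
  shows "\<exists>k. x - \<kappa> k \<in> A"
proof (induction x rule: s03_induct)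
  case (const k)
  show ?case using left_ideal_0 by (intro exI[of _ k]) simp
next
  case (gen x)
  then obtain k where k: "x - \<kappa> k \<in> A" by blast
  \<comment> \<open>Scalars are central, so in b (x - k) + k b the last b stands at the right end,
    where it may be replaced by \<beta>; likewise for c and d.\<close>
  have "\<b> * x - \<kappa> (k * \<beta>) = \<b> * (x - \<kappa> k) + \<kappa> k * (\<b> - \<kappa> \<beta>)"
    "\<c> * x - \<kappa> (k * \<gamma>) = \<c> * (x - \<kappa> k) + \<kappa> k * (\<c> - \<kappa> \<gamma>)"
    "\<d> * x - \<kappa> 0 = \<d> * (x - \<kappa> k) + \<kappa> k * \<d>"
    by (simp_all add: s03_nf del: \<kappa>_0) simp
  moreover have "\<b> * (x - \<kappa> k) + \<kappa> k * (\<b> - \<kappa> \<beta>) \<in> A"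
    "\<c> * (x - \<kappa> k) + \<kappa> k * (\<c> - \<kappa> \<gamma>) \<in> A" "\<d> * (x - \<kappa> k) + \<kappa> k * \<d> \<in> A"
    using k assms by (auto intro!: left_ideal_add left_ideal_mult)
  ultimately show ?case by metis
next
  case (add x y)
  then obtain j k where "x - \<kappa> j \<in> A" "y - \<kappa> k \<in> A" by blast
  from left_ideal_add[OF this] show ?case
    by (intro exI[of _ "j + k"]) (simp add: \<kappa>_add algebra_simps)
qed

lemma scalar_inverse:
  assumes "x - \<kappa> k \<in> A" "x \<notin> A"
  shows "\<exists>x'. x' * x - 1 \<in> A"
proof -
  have "k \<noteq> 0" using assms by auto
  then have "\<kappa> (1 / k) * x - 1 = \<kappa> (1 / k) * (x - \<kappa> k)"
    by (simp add: right_diff_distrib flip: \<kappa>_mult)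
  then show ?thesis using left_ideal_mult[OF assms(1)] by metis
qed

section \<open>Left ideals containing d - l with l^2 = 1\<close>

context
  fixes l :: complex
  assumes l: "l^2 = 1" and d: "\<d> - \<kappa> l \<in> A"
begin

lemma \<kappa>_square_eigenvalue: "\<kappa> l * \<kappa> l = 1" "\<kappa> l * (\<kappa> l * x) = x"
  using l by (simp_all add: power2_eq_square flip: \<kappa>_mult mult.assoc)

text \<open>Since (b^2 - 1) d = 0, multiplying d - l by b^2 - 1 from the left leaves -l (b^2 - 1),
  and l is its own inverse.\<close>

lemma b_square_congruent: "\<b> * \<b> - 1 \<in> A"
proof -
  have "\<b> * \<b> - 1 = (- \<kappa> l * (\<b> * \<b> - 1)) * (\<d> - \<kappa> l)"
    by (simp add: s03_nf \<kappa>_square_eigenvalue del: \<kappa>_mult) (simp add: \<kappa>_mult \<kappa>_square_eigenvalue)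
  then show ?thesis using left_ideal_mult[OF d] by metis
qed

text \<open>The chain behind the cofactor is c = l^2 c, which is congruent to c d^2 = -b d and hence
  to -l b.\<close>

lemma c_congruent: "\<c> + \<kappa> l * \<b> \<in> A"
proof -
  have "\<c> + \<kappa> l * \<b> = (- \<b> - \<c> * \<d> - \<kappa> l * \<c>) * (\<d> - \<kappa> l)"
    by (simp add: s03_nf) (simp add: \<kappa>_mult \<kappa>_square_eigenvalue)
  then show ?thesis using left_ideal_mult[OF d] by metis
qed

lemma congruent_pair: "\<exists>j k. x - (\<kappa> j + \<kappa> k * \<b>) \<in> A"
proof (induction x rule: s03_induct)
  case (const k)
  show ?case using left_ideal_0 by (intro exI[of _ k] exI[of _ 0]) simp
next
  case (gen x)
  then obtain j k where jk: "x - (\<kappa> j + \<kappa> k * \<b>) \<in> A" by blast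
  let ?x = "\<kappa> j + \<kappa> k * \<b>"
  have "\<b> * x - (\<kappa> k + \<kappa> j * \<b>) = \<b> * (x - ?x) + \<kappa> k * (\<b> * \<b> - 1)"
    by (simp add: s03_nf)
  then have 1: "\<b> * x - (\<kappa> k + \<kappa> j * \<b>) \<in> A"
    using jk b_square_congruent by (simp add: left_ideal_add left_ideal_mult)
  have "\<d> * x - (\<kappa> (j * l) + \<kappa> (- k * l) * \<b>) = \<d> * (x - ?x) + (\<kappa> j - \<kappa> k * \<b>) * (\<d> - \<kappa> l)"
    by (simp add: s03_nf \<kappa>_uminus)
  then have 2: "\<d> * x - (\<kappa> (j * l) + \<kappa> (- k * l) * \<b>) \<in> A"
    using jk d by (simp add: left_ideal_add left_ideal_mult)
  \<comment> \<open>Here c b = b c + 2d is congruent to -l b^2 + 2l, hence to l. The three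
    corrections after the first summand replace c by -l b, d by l and b^2 by 1.\<close>
  have "\<c> * x - (\<kappa> (k * l) + \<kappa> (- j * l) * \<b>)
     = \<c> * (x - ?x) + (\<kappa> j + \<kappa> k * \<b>) * (\<c> + \<kappa> l * \<b>)
       + (\<kappa> k + \<kappa> k) * (\<d> - \<kappa> l) - \<kappa> (k * l) * (\<b> * \<b> - 1)"
    by (simp add: s03_nf \<kappa>_uminus)
  then have 3: "\<c> * x - (\<kappa> (k * l) + \<kappa> (- j * l) * \<b>) \<in> A"
    using jk d c_congruent b_square_congruent
    by (simp add: left_ideal_add left_ideal_diff left_ideal_mult)
  show ?case using 1 2 3 by blast
next
  case (add x y)
  then obtain j k j' k' where "x - (\<kappa> j + \<kappa> k * \<b>) \<in> A" "y - (\<kappa> j' + \<kappa> k' * \<b>) \<in> A" by blast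
  from left_ideal_add[OF this] show ?case
    by (intro exI[of _ "j + j'"] exI[of _ "k + k'"]) (simp add: \<kappa>_add algebra_simps)
qed

text \<open>As b anticommutes with d, the left factor d acts on 1 and b with the opposite
  eigenvalues l and -l. So d + l kills the b part and multiplies the constant part by 2l.\<close>

lemma double_coefficient:
  assumes "x - (\<kappa> j + \<kappa> k * \<b>) \<in> A"
  shows "(\<d> + \<kappa> l) * x - \<kappa> (2 * l * j) \<in> A"
proof -
  have "\<kappa> (2 * l * j) = \<kappa> (l * j) + \<kappa> (l * j)"
    by (simp add: mult_ac flip: \<kappa>_add)
  then have "(\<d> + \<kappa> l) * x - \<kappa> (2 * l * j)
      = (\<d> + \<kappa> l) * (x - (\<kappa> j + \<kappa> k * \<b>)) + (\<kappa> j - \<kappa> k * \<b>) * (\<d> - \<kappa> l)"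
    by (simp add: s03_nf mult_ac)
  then show ?thesis using assms d by (simp add: left_ideal_add left_ideal_mult)
qed

text \<open>Multiplication by b exchanges the two coefficients, so whatever d + l reveals about the
  first becomes available for the second.\<close>

lemma b_pair:
  assumes "x - (\<kappa> j + \<kappa> k * \<b>) \<in> A"
  shows "\<b> * x - (\<kappa> k + \<kappa> j * \<b>) \<in> A"
proof -
  have "\<b> * x - (\<kappa> k + \<kappa> j * \<b>) = \<b> * (x - (\<kappa> j + \<kappa> k * \<b>)) + \<kappa> k * (\<b> * \<b> - 1)"
    by (simp add: s03_nf)
  then show ?thesis using assms b_square_congruent by (simp add: left_ideal_add left_ideal_mult)
qed

lemma pair_independent:
  assumes "\<kappa> j + \<kappa> k * \<b> \<in> A" "1 \<notin> A"
  shows "j = 0 \<and> k = 0"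
proof -
  have "l \<noteq> 0" using l by auto
  \<comment> \<open>The hypothesis is read as a congruence between 0 and the pair, so that
    \<open>double_coefficient\<close> applies to x = 0.\<close>
  have eq0: "j = 0" if "0 - (\<kappa> j + \<kappa> k * \<b>) \<in> A" for j k
    using left_ideal_uminus[OF double_coefficient[OF that]] left_ideal_\<kappa>[of "2 * l * j"] assms(2) \<open>l \<noteq> 0\<close>
    by simp
  have "0 - (\<kappa> j + \<kappa> k * \<b>) \<in> A"
    using left_ideal_uminus[OF assms(1)] by simp
  then show ?thesis using eq0 eq0[of k j] b_pair[of 0 j k] by simp
qed

text \<open>One of the two coefficients is nonzero. If it is the constant one, d + l turns x into a
  nonzero scalar, which can be inverted; otherwise b is applied first.\<close>

lemma pair_inverse:
  assumes "x \<notin> A"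
  shows "\<exists>x'. x' * x - 1 \<in> A"
proof -
  have "l \<noteq> 0" using l by auto
  obtain j k where jk: "x - (\<kappa> j + \<kappa> k * \<b>) \<in> A" using congruent_pair by blast
  have *: "\<exists>x'. x' * x - 1 \<in> A" if "x - (\<kappa> j + \<kappa> k * \<b>) \<in> A" "j \<noteq> 0" for x j k
  proof -
    have "\<kappa> (1 / (2 * l * j)) * ((\<d> + \<kappa> l) * x - \<kappa> (2 * l * j)) \<in> A"
      using double_coefficient[OF that(1)] by (rule left_ideal_mult)
    then show ?thesis
      using that(2) \<open>l \<noteq> 0\<close>
      by (intro exI[of _ "\<kappa> (1 / (2 * l * j)) * (\<d> + \<kappa> l)"])
        (simp add: right_diff_distrib mult.assoc flip: \<kappa>_mult)
  qed
  show ?thesis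
  proof (cases "j = 0")
    case True
    have "k \<noteq> 0" using True jk assms by auto
    then obtain x' where "x' * (\<b> * x) - 1 \<in> A" using *[OF b_pair[OF jk]] by blast
    then show ?thesis by (intro exI[of _ "x' * \<b>"]) (simp add: mult.assoc)
  qed (use * jk in blast)
qed

end

text \<open>Once d is discarded, b and c commute, and b^3 = b, b^2 c = c, c^2 = -b^2 leave only the
  five words 1, b, c, bc, bb.\<close>

lemma congruent_quintuple:
  assumes d: "\<d> \<in> A"
  shows "\<exists>p q r s t. x - (\<kappa> p + \<kappa> q * \<b> + \<kappa> r * \<c> + \<kappa> s * (\<b> * \<c>) + \<kappa> t * (\<b> * \<b>)) \<in> A"
proof (induction x rule: s03_induct)
  case (const k)
  show ?case using left_ideal_0
    by (intro exI[of _ k] exI[of _ 0]) simp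
next
  case (gen x)
  then obtain p q r s t
    where jk: "x - (\<kappa> p + \<kappa> q * \<b> + \<kappa> r * \<c> + \<kappa> s * (\<b> * \<c>) + \<kappa> t * (\<b> * \<b>)) \<in> A"
      (is "x - ?x \<in> A") by blast
  have "\<b> * x - (\<kappa> 0 + \<kappa> (p + t) * \<b> + \<kappa> s * \<c> + \<kappa> r * (\<b> * \<c>) + \<kappa> q * (\<b> * \<b>)) = \<b> * (x - ?x)"
    by (simp add: s03_nf \<kappa>_add)
  then have 1: "\<b> * x - (\<kappa> 0 + \<kappa> (p + t) * \<b> + \<kappa> s * \<c> + \<kappa> r * (\<b> * \<c>) + \<kappa> q * (\<b> * \<b>)) \<in> A"
    using left_ideal_mult[OF jk, of \<b>] by (simp only:)
  \<comment> \<open>Moving c past b costs 2d. The cofactor collects this for b and for bc, where 2 d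
    c = -2 c d; for bb the two costs 2bd and 2db cancel.\<close>
  have "\<c> * x - (\<kappa> 0 + \<kappa> (- s) * \<b> + \<kappa> (p + t) * \<c> + \<kappa> q * (\<b> * \<c>) + \<kappa> (- r) * (\<b> * \<b>))
      = \<c> * (x - ?x) + ((\<kappa> q + \<kappa> q) + (- \<kappa> s - \<kappa> s) * \<c>) * \<d>"
    by (simp add: s03_nf \<kappa>_add \<kappa>_uminus)
  then have 2: "\<c> * x - (\<kappa> 0 + \<kappa> (- s) * \<b> + \<kappa> (p + t) * \<c> + \<kappa> q * (\<b> * \<c>) + \<kappa> (- r) * (\<b> * \<b>)) \<in> A"
    using left_ideal_add[OF left_ideal_mult[OF jk, of \<c>]
        left_ideal_mult[OF d, of "((\<kappa> q + \<kappa> q) + (- \<kappa> s - \<kappa> s) * \<c>)"]]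
    by (simp only:)
  \<comment> \<open>Anticommutation carries d to the right end of each of the five words; for bc the
    result b c d equals -d^2.\<close>
  have "\<d> * x - (\<kappa> 0 + \<kappa> 0 * \<b> + \<kappa> 0 * \<c> + \<kappa> 0 * (\<b> * \<c>) + \<kappa> 0 * (\<b> * \<b>))
      = \<d> * (x - ?x) + (\<kappa> p - \<kappa> q * \<b> - \<kappa> r * \<c> - \<kappa> s * \<d> + \<kappa> t) * \<d>"
    by (simp add: s03_nf)
  then have 3: "\<d> * x - (\<kappa> 0 + \<kappa> 0 * \<b> + \<kappa> 0 * \<c> + \<kappa> 0 * (\<b> * \<c>) + \<kappa> 0 * (\<b> * \<b>)) \<in> A"
    using left_ideal_add[OF left_ideal_mult[OF jk, of \<d>]
        left_ideal_mult[OF d, of "(\<kappa> p - \<kappa> q * \<b> - \<kappa> r * \<c> - \<kappa> s * \<d> + \<kappa> t)"]]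
    by (simp only:)
  show ?case using 1 2 3 by blast
next
  case (add x y)
  then obtain p q r s t p' q' r' s' t' where
    "x - (\<kappa> p + \<kappa> q * \<b> + \<kappa> r * \<c> + \<kappa> s * (\<b> * \<c>) + \<kappa> t * (\<b> * \<b>)) \<in> A"
    "y - (\<kappa> p' + \<kappa> q' * \<b> + \<kappa> r' * \<c> + \<kappa> s' * (\<b> * \<c>) + \<kappa> t' * (\<b> * \<b>)) \<in> A"
    by blast
  from left_ideal_add[OF this] show ?case
    by (intro exI[of _ "p + p'"] exI[of _ "q + q'"] exI[of _ "r + r'"] exI[of _ "s + s'"]
        exI[of _ "t + t'"]) (simp add: \<kappa>_add algebra_simps)
qed

end

section \<open>Characters and their idempotents\<close>

text \<open>Modulo \<open>d\<close> these are the orthogonal idempotents of the five characters: the interpolation polynomial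
  \<open>\<beta> (b + \<beta>) (1 - \<gamma> c) / 4\<close> multiplied by \<open>b\<^sup>2\<close>, so that it vanishes at \<open>b = c = 0\<close>.\<close>

definition \<epsilon> :: "complex \<Rightarrow> complex \<Rightarrow> s03" where
  "\<epsilon> \<beta> \<gamma> = (if \<beta> = 0 then 1 - \<b> * \<b>
     else \<kappa> (1/4) * (\<b> * \<b> + \<kappa> \<beta> * \<b> - \<kappa> \<gamma> * \<c> - \<kappa> (\<beta> * \<gamma>) * (\<b> * \<c>)))"

text \<open>These are all solutions of the three equations in \<open>s03_model_character\<close>:
  \<beta> is 0, 1 or -1, and \<gamma>^2 = -\<beta>^2.\<close>

definition weights :: "(complex \<times> complex) set" where
  "weights = insert (0, 0) ({1, -1} \<times> {\<i>, -\<i>})"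

lemma weights_eq: "weights = {(0, 0), (1, \<i>), (1, -\<i>), (-1, \<i>), (-1, -\<i>)}"
  by (auto simp: weights_def)

text \<open>For b the product vanishes already in s03'. For c the commutator of c and b leaves a
  left multiple of d, which the hypothesis on d absorbs.\<close>

lemma \<epsilon>_eigen:
  assumes A: "left_ideal A" and d: "\<d> \<in> A" and w: "(\<beta>, \<gamma>) \<in> weights"
  shows "(\<b> - \<kappa> \<beta>) * \<epsilon> \<beta> \<gamma> \<in> A" "(\<c> - \<kappa> \<gamma>) * \<epsilon> \<beta> \<gamma> \<in> A"
proof -
  have "(\<b> - \<kappa> \<beta>) * \<epsilon> \<beta> \<gamma> = 0"
    using w by (auto simp: weights_eq \<epsilon>_def s03_nf \<kappa>_uminus)
  then show "(\<b> - \<kappa> \<beta>) * \<epsilon> \<beta> \<gamma> \<in> A"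
    using left_ideal_0[OF A] by simp
  have "(\<c> - \<kappa> \<gamma>) * \<epsilon> \<beta> \<gamma>
      = (\<kappa> (\<beta> / 4) + \<kappa> (\<beta> / 4) + (\<kappa> (\<beta> * \<gamma> / 4) + \<kappa> (\<beta> * \<gamma> / 4)) * \<c>) * \<d>"
    using w by (auto simp: weights_eq \<epsilon>_def s03_nf \<kappa>_uminus)
  then show "(\<c> - \<kappa> \<gamma>) * \<epsilon> \<beta> \<gamma> \<in> A"
    using left_ideal_mult[OF A d] by simp
qed

text \<open>Over the four nonzero weights the terms in b, c and bc cancel by sign and the four
  quarters of b^2 add up; 1 - b^2 is the complement.\<close>

lemma sum_\<epsilon>: "(\<Sum>(\<beta>, \<gamma>)\<in>weights. \<epsilon> \<beta> \<gamma>) = 1"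
proof -
  have "\<kappa> (1/4) + (\<kappa> (1/4) + (\<kappa> (1/4) + \<kappa> (1/4))) = 1"
    by (simp flip: \<kappa>_add)
  then have "\<kappa> (1/4) * x + (\<kappa> (1/4) * x + (\<kappa> (1/4) * x + \<kappa> (1/4) * x)) = x" for x
    by (simp flip: distrib_right)
  then show ?thesis
    by (simp add: weights_eq \<epsilon>_def right_diff_distrib distrib_left \<kappa>_uminus complex_eq_iff
        algebra_simps)
qed

lemma character_exists:
  assumes "(\<beta>, \<gamma>) \<in> weights"
  obtains \<chi> :: "s03 \<Rightarrow> complex" where "\<And>x y. \<chi> (x + y) = \<chi> x + \<chi> y" "\<And>x y. \<chi> (x * y) = \<chi> x * \<chi> y"
    "\<And>k. \<chi> (\<kappa> k) = k" "\<chi> \<b> = \<beta>" "\<chi> \<c> = \<gamma>" "\<chi> \<d> = 0"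
proof -
  interpret s03_model "(*)" "\<lambda>g v. (case g of GB \<Rightarrow> \<beta> | GC \<Rightarrow> \<gamma> | GD \<Rightarrow> 0) * v"
    using assms by (intro s03_model_character) (auto simp: weights_eq power3_eq_cube)
  have scalar: "\<exists>k. \<forall>v. rep x v = k * v" for x
  proof (induction x rule: s03_induct)
    case (gen x)
    then obtain k where "\<forall>v. rep x v = k * v" by blast
    then have "rep (\<b> * x) v = (\<beta> * k) * v" "rep (\<c> * x) v = (\<gamma> * k) * v"
      "rep (\<d> * x) v = 0 * v" for v
      by (simp_all only: rep_mult rep_generators gen.case mult.assoc mult_zero_left)
    then show ?case by blast
  next
    case (add x y)
    then obtain j k where "\<forall>v. rep x v = j * v" "\<forall>v. rep y v = k * v" by blast
    then have "\<forall>v. rep (x + y) v = (j + k) * v" by (simp add: rep_add distrib_right)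
    then show ?case by blast
  next
    case (const k)
    show ?case by (intro exI[of _ k]) (simp add: rep_generators)
  qed
  \<comment> \<open>Each element acts on the line by a number, so evaluation at the vector 1 is
    multiplicative.\<close>
  have scal: "rep x (rep y 1) = rep x 1 * rep y 1" for x y
  proof -
    obtain k where "\<forall>v. rep x v = k * v" using scalar by blast
    then show ?thesis by (simp only: mult_1_right)
  qed
  show ?thesis
  proof (rule that[of "\<lambda>x. rep x 1"])
    show "rep (x * y) 1 = rep x 1 * rep y 1" for x y
      using scal by (simp only: rep_mult)
  qed (simp_all add: rep_add rep_generators)
qed

section \<open>Irreducible modules\<close>

text \<open>The label \<^const>\<open>None\<close> stands for the two-dimensional representation, \<open>Some (\<beta>, \<gamma>)\<close> for the
  one-dimensional one in which \<open>b\<close>, \<open>c\<close>, \<open>d\<close> act by \<open>\<beta>\<close>, \<open>\<gamma>\<close>, \<open>0\<close>.\<close>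

definition has_label :: "(s03_elem, 'v) module \<Rightarrow> (complex \<times> complex) option \<Rightarrow> bool" where
  "has_label M t = (case t of
     None \<Rightarrow> \<forall>m\<in>carrier M. (\<b> * \<b>) \<star>\<^bsub>M\<^esub> m = m \<and> (\<d> * \<d>) \<star>\<^bsub>M\<^esub> m = m
   | Some (\<beta>, \<gamma>) \<Rightarrow> \<forall>m\<in>carrier M. \<b> \<star>\<^bsub>M\<^esub> m = \<kappa> \<beta> \<star>\<^bsub>M\<^esub> m \<and> \<c> \<star>\<^bsub>M\<^esub> m = \<kappa> \<gamma> \<star>\<^bsub>M\<^esub> m
       \<and> \<d> \<star>\<^bsub>M\<^esub> m = \<zero>\<^bsub>M\<^esub>)"

definition labels :: "(complex \<times> complex) option set" where
  "labels = insert None (Some ` weights)"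

lemma card_labels: "card labels = 6" "finite labels"
  by (simp_all add: labels_def weights_eq card_image complex_eq_iff)

context s03_module
begin

definition ann :: "'v \<Rightarrow> s03 set" where "ann y = {x. x \<star>\<^bsub>M\<^esub> y = \<zero>}"

lemma left_ideal_ann: "y \<in> carrier M \<Longrightarrow> left_ideal (ann y)"
  by (simp add: left_ideal_def ann_def star_zero star_add star_mult_eq_zero)

lemma diff_mem_ann_iff: "y \<in> carrier M \<Longrightarrow> x - x' \<in> ann y \<longleftrightarrow> x \<star>\<^bsub>M\<^esub> y = x' \<star>\<^bsub>M\<^esub> y"
  by (simp add: ann_def star_eq_iff)

lemma mem_ann_iff: "x \<in> ann y \<longleftrightarrow> x \<star>\<^bsub>M\<^esub> y = \<zero>"
  by (simp add: ann_def)

lemma mem_ann_cong: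
  assumes "y \<in> carrier M" "x - x' \<in> ann y"
  shows "x \<in> ann y \<longleftrightarrow> x' \<in> ann y"
  using iffD1[OF diff_mem_ann_iff[OF assms(1)] assms(2)] by (simp add: mem_ann_iff)

lemma one_mem_ann_iff: "y \<in> carrier M \<Longrightarrow> 1 \<in> ann y \<longleftrightarrow> y = \<zero>"
  by (simp add: ann_def star_one)

lemma mem_ann_star: "y \<in> carrier M \<Longrightarrow> x \<in> ann (x' \<star>\<^bsub>M\<^esub> y) \<longleftrightarrow> x * x' \<in> ann y"
  by (simp add: ann_def star_mult)

lemma cyclicE:
  assumes "carrier M = cyclic y" "m \<in> carrier M"
  obtains x where "m = x \<star>\<^bsub>M\<^esub> y"
  using assms unfolding cyclic_def by blast

text \<open>A nonzero vector is x y with x outside \<open>ann y\<close>, and a left inverse of x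
  modulo \<open>ann y\<close> carries it back to the generator. So every nonzero submodule contains
  y.\<close>

lemma irreducible_cyclicI:
  assumes y: "y \<in> carrier M" "y \<noteq> \<zero>" and M: "carrier M = cyclic y"
    and inverse: "\<And>x. x \<notin> ann y \<Longrightarrow> \<exists>x'. x' * x - 1 \<in> ann y"
  shows "irreducible_module S03 M"
proof -
  have "N = carrier M" if N: "submodule N S03 M" "N \<noteq> {\<zero>}" for N
  proof -
    interpret N: submodule N S03 M by (rule N(1))
    obtain n where n: "n \<in> N" "n \<noteq> \<zero>" using N(2) N.one_closed by auto
    have "n \<in> carrier M" using N.subset n by auto
    then obtain x where x: "n = x \<star>\<^bsub>M\<^esub> y" by (rule cyclicE[OF M])
    obtain x' where "x' * x - 1 \<in> ann y"
      using inverse[of x] n x by (auto simp: mem_ann_iff)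
    then have "x' \<star>\<^bsub>M\<^esub> n = y" using y x by (simp add: diff_mem_ann_iff star_one star_mult)
    then have "y \<in> N" using N.smult_closed[OF elt_closed n(1)] by metis
    then have "carrier M \<subseteq> N" unfolding M cyclic_def by (auto intro: N.smult_closed)
    then show ?thesis using N.subset by auto
  qed
  then show ?thesis
    using y left_module_axioms unfolding irreducible_module_def by auto
qed

lemma irreducible_cyclic:
  assumes "irreducible_module S03 M" "y \<in> carrier M" "y \<noteq> \<zero>"
  shows "carrier M = cyclic y"
proof -
  have "cyclic y \<noteq> {\<zero>}" using mem_cyclic[OF assms(2)] assms(3) by auto
  then show ?thesis
    using assms(1) submodule_cyclic[OF assms(2)] unfolding irreducible_module_def by auto
qed

lemma irreducible_nonzero:
  assumes "irreducible_module S03 M"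
  obtains y where "y \<in> carrier M" "y \<noteq> \<zero>"
  using assms M.zero_closed unfolding irreducible_module_def by blast

section \<open>Cyclic modules generated by a joint eigenvector of b, c and d\<close>

context
  fixes \<beta> \<gamma> y
  assumes y: "y \<in> carrier M" and M: "carrier M = cyclic y"
    and eigen: "\<b> - \<kappa> \<beta> \<in> ann y" "\<c> - \<kappa> \<gamma> \<in> ann y" "\<d> \<in> ann y"
begin

lemma eigen_cyclicE:
  assumes "m \<in> carrier M"
  obtains k where "m = \<kappa> k \<star>\<^bsub>M\<^esub> y"
proof -
  obtain x where x: "m = x \<star>\<^bsub>M\<^esub> y" using assms by (rule cyclicE[OF M])
  obtain k where "x - \<kappa> k \<in> ann y"
    using congruent_scalar[OF left_ideal_ann[OF y] eigen] by blast
  then have "m = \<kappa> k \<star>\<^bsub>M\<^esub> y" using x y by (simp add: diff_mem_ann_iff)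
  then show ?thesis by (rule that)
qed

lemma eigen_has_label: "has_label M (Some (\<beta>, \<gamma>))"
proof -
  have "\<b> \<star>\<^bsub>M\<^esub> m = \<kappa> \<beta> \<star>\<^bsub>M\<^esub> m \<and> \<c> \<star>\<^bsub>M\<^esub> m = \<kappa> \<gamma> \<star>\<^bsub>M\<^esub> m \<and> \<d> \<star>\<^bsub>M\<^esub> m = \<zero>"
    if mM: "m \<in> carrier M" for m
  proof -
    obtain k where m: "m = \<kappa> k \<star>\<^bsub>M\<^esub> y" using mM by (rule eigen_cyclicE)
    have "(\<b> - \<kappa> \<beta>) * \<kappa> k = \<kappa> k * (\<b> - \<kappa> \<beta>)" "(\<c> - \<kappa> \<gamma>) * \<kappa> k = \<kappa> k * (\<c> - \<kappa> \<gamma>)"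
      "\<d> * \<kappa> k = \<kappa> k * \<d>"
      by (simp_all add: s03_nf mult.commute)
    then have "(\<b> - \<kappa> \<beta>) * \<kappa> k \<in> ann y" "(\<c> - \<kappa> \<gamma>) * \<kappa> k \<in> ann y" "\<d> * \<kappa> k \<in> ann y"
      using left_ideal_mult[OF left_ideal_ann[OF y]] eigen by auto
    then show ?thesis
      unfolding m using y mem_ann_star[OF y, symmetric]
      by (simp add: diff_mem_ann_iff[of "\<kappa> k \<star>\<^bsub>M\<^esub> y", symmetric])
        (simp add: mem_ann_iff)
  qed
  then show ?thesis by (simp add: has_label_def)
qed

lemma eigen_irreducible: "y \<noteq> \<zero> \<Longrightarrow> irreducible_module S03 M"
  using congruent_scalar[OF left_ideal_ann[OF y] eigen] scalar_inverse[OF left_ideal_ann[OF y]]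
  by (intro irreducible_cyclicI[OF y _ M]) blast+

lemma eigen_basis:
  assumes "y \<noteq> \<zero>"
  shows "is_basis M [y]"
proof -
  have "is_basis M (map (\<lambda>x. x \<star>\<^bsub>M\<^esub> y) [1])"
  proof (rule is_basis_starI[OF y], goal_cases)
    case (1 m)
    then obtain k where "m = \<kappa> k \<star>\<^bsub>M\<^esub> y" by (rule eigen_cyclicE)
    then show ?case by (intro exI[of _ "\<lambda>_. k"]) simp
  next
    case (2 k i)
    then show ?case using \<kappa>_star_eq_zero[OF y, of "k 0"] assms by simp
  qed
  then show ?thesis using y by (simp add: star_one)
qed

end

section \<open>Cyclic modules generated by an eigenvector of d with square eigenvalue 1\<close>

context
  fixes l y
  assumes y: "y \<in> carrier M" and M: "carrier M = cyclic y"
    and l: "l^2 = 1" and d: "\<d> - \<kappa> l \<in> ann y"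
begin

lemma pair_cyclicE:
  assumes "m \<in> carrier M"
  obtains j k where "m = (\<kappa> j + \<kappa> k * \<b>) \<star>\<^bsub>M\<^esub> y"
proof -
  obtain x where x: "m = x \<star>\<^bsub>M\<^esub> y" using assms by (rule cyclicE[OF M])
  obtain j k where "x - (\<kappa> j + \<kappa> k * \<b>) \<in> ann y"
    using congruent_pair[OF left_ideal_ann[OF y] l d] by blast
  then have "m = (\<kappa> j + \<kappa> k * \<b>) \<star>\<^bsub>M\<^esub> y" using x y by (simp add: diff_mem_ann_iff)
  then show ?thesis by (rule that)
qed

lemma pair_has_label: "has_label M None"
proof -
  note A = left_ideal_ann[OF y]
  have "(\<b> * \<b>) \<star>\<^bsub>M\<^esub> m = m \<and> (\<d> * \<d>) \<star>\<^bsub>M\<^esub> m = m" if mM: "m \<in> carrier M" for m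
  proof -
    obtain j k where m: "m = (\<kappa> j + \<kappa> k * \<b>) \<star>\<^bsub>M\<^esub> y" using mM by (rule pair_cyclicE)
    let ?x = "\<kappa> j + \<kappa> k * \<b>"
    \<comment> \<open>As b^3 = b, only the constant term contributes to the first difference. In the
      second, d^2 commutes with b, and d^2 - 1 = (d + l) (d - l) brings the factor in
      \<open>ann y\<close> to the right end.\<close>
    have "\<b> * \<b> * ?x - ?x = \<kappa> j * (\<b> * \<b> - 1)"
      "\<d> * \<d> * ?x - ?x = (?x * (\<d> + \<kappa> l)) * (\<d> - \<kappa> l)"
      using \<kappa>_square_eigenvalue[OF A l d]
      by (simp_all add: s03_nf) (simp_all add: \<kappa>_mult mult.assoc)
    then have "\<b> * \<b> * ?x - ?x \<in> ann y" "\<d> * \<d> * ?x - ?x \<in> ann y"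
      using b_square_congruent[OF A l d] d left_ideal_mult[OF A] by auto
    then show ?thesis
      using y by (simp add: m diff_mem_ann_iff star_mult)
  qed
  then show ?thesis by (simp add: has_label_def)
qed

lemma pair_irreducible: "y \<noteq> \<zero> \<Longrightarrow> irreducible_module S03 M"
  using pair_inverse[OF left_ideal_ann[OF y] l d]
  by (intro irreducible_cyclicI[OF y _ M]) blast+

lemma pair_basis:
  assumes "y \<noteq> \<zero>"
  shows "is_basis M [y, \<b> \<star>\<^bsub>M\<^esub> y]"
proof -
  have "is_basis M (map (\<lambda>x. x \<star>\<^bsub>M\<^esub> y) [1, \<b>])"
  proof (rule is_basis_starI[OF y], goal_cases)
    case (1 m)
    then obtain j k where "m = (\<kappa> j + \<kappa> k * \<b>) \<star>\<^bsub>M\<^esub> y" by (rule pair_cyclicE)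
    then show ?case by (intro exI[of _ "\<lambda>i. if i = 0 then j else k"]) simp
  next
    case (2 k i)
    then have "\<kappa> (k 0) + \<kappa> (k 1) * \<b> \<in> ann y" by (simp add: mem_ann_iff)
    then have "k 0 = 0 \<and> k 1 = 0"
      using pair_independent[OF left_ideal_ann[OF y] l d] assms one_mem_ann_iff[OF y] by blast
    then show ?case using 2 by (auto simp: less_Suc_eq)
  qed
  then show ?thesis using y by (simp add: star_one)
qed

end

lemma has_label_unique:
  assumes y: "y \<in> carrier M" "y \<noteq> \<zero>"
    and t: "has_label M t" and t': "has_label M t'"
  shows "t = t'"
proof -
  have False if "has_label M None" "has_label M (Some (\<beta>, \<gamma>))" for \<beta> \<gamma>
    using that y by (auto simp: has_label_def star_mult star_zero_right)
  moreover have "\<beta> = \<beta>'" if "\<kappa> \<beta> \<star>\<^bsub>M\<^esub> y = \<kappa> \<beta>' \<star>\<^bsub>M\<^esub> y" for \<beta> \<beta>'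
    using that y \<kappa>_star_eq_zero[of y "\<beta> - \<beta>'"] by (simp add: star_eq_iff \<kappa>_diff)
  ultimately show ?thesis
    using t t' y by (cases t; cases t') (auto simp: has_label_def split: prod.splits)
qed

text \<open>The idempotents add up to 1, so one of them does not kill y. Its image of y is a joint
  eigenvector, and by irreducibility it generates M.\<close>

lemma irreducible_has_weight:
  assumes irr: "irreducible_module S03 M" and d: "\<And>m. m \<in> carrier M \<Longrightarrow> \<d> \<star>\<^bsub>M\<^esub> m = \<zero>"
  shows "\<exists>t\<in>Some ` weights. has_label M t"
proof -
  obtain y where y: "y \<in> carrier M" "y \<noteq> \<zero>" using irr by (rule irreducible_nonzero)
  note A = left_ideal_ann[OF y(1)]
  have sum: "(\<Sum>w\<in>W. f w) \<in> ann y" if "\<forall>w\<in>W. f w \<in> ann y" for f :: "complex \<times> complex \<Rightarrow> s03" and W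
    using that by (induction W rule: infinite_finite_induct) (auto intro: left_ideal_0[OF A] left_ideal_add[OF A])
  have "\<exists>w\<in>weights. (case w of (\<beta>, \<gamma>) \<Rightarrow> \<epsilon> \<beta> \<gamma>) \<notin> ann y"
    using sum[of weights "\<lambda>(\<beta>, \<gamma>). \<epsilon> \<beta> \<gamma>"] y unfolding sum_\<epsilon> by (auto simp: one_mem_ann_iff)
  then obtain \<beta> \<gamma> where w: "(\<beta>, \<gamma>) \<in> weights" "\<epsilon> \<beta> \<gamma> \<notin> ann y" by auto
  let ?z = "\<epsilon> \<beta> \<gamma> \<star>\<^bsub>M\<^esub> y"
  have z: "?z \<in> carrier M" "?z \<noteq> \<zero>" using y w by (simp_all add: mem_ann_iff)
  have "\<d> \<in> ann y" "\<d> \<in> ann ?z" using d y(1) z(1) by (auto simp: mem_ann_iff)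
  moreover have "\<b> - \<kappa> \<beta> \<in> ann ?z" "\<c> - \<kappa> \<gamma> \<in> ann ?z"
    using \<epsilon>_eigen[OF A _ w(1)] y \<open>\<d> \<in> ann y\<close> by (simp_all add: mem_ann_star)
  ultimately have "has_label M (Some (\<beta>, \<gamma>))"
    using eigen_has_label[OF z(1) irreducible_cyclic[OF irr z]] by blast
  then show ?thesis using w(1) by blast
qed

text \<open>Because d^2 = 1, the vector (d + 1) y has eigenvalue 1 unless it is zero. If it is zero,
  d acts on y by -1 and b moves y to the other eigenspace. This normalisation merges \<lambda> = 1
  and \<lambda> = -1.\<close>

lemma has_label_None_eigenvector:
  assumes "has_label M None" "y \<in> carrier M" "y \<noteq> \<zero>"
  obtains z where "z \<in> carrier M" "z \<noteq> \<zero>" "\<d> - \<kappa> 1 \<in> ann z"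
proof (cases "(\<d> + 1) \<star>\<^bsub>M\<^esub> y = \<zero>")
  case True
  let ?z = "\<b> \<star>\<^bsub>M\<^esub> y"
  have z: "?z \<in> carrier M" using assms by simp
  have "\<b> \<star>\<^bsub>M\<^esub> ?z = y" using assms by (simp add: has_label_def flip: star_mult)
  then have "?z \<noteq> \<zero>" using assms(3) star_zero_right by metis
  moreover have "(\<d> - \<kappa> 1) * \<b> = - \<b> * (\<d> + 1)" by (simp add: s03_nf)
  then have "(\<d> - \<kappa> 1) * \<b> \<in> ann y"
    using left_ideal_mult[OF left_ideal_ann[OF assms(2)], of "\<d> + 1" "- \<b>"] True
    by (simp only: mem_ann_iff)
  then have "\<d> - \<kappa> 1 \<in> ann ?z"
    using assms by (simp only: mem_ann_star)
  ultimately show ?thesis using that z by blast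
next
  case False
  have "(\<d> - \<kappa> 1) * (\<d> + 1) = \<d> * \<d> - 1" by (simp add: algebra_simps)
  moreover have "\<d> * \<d> - 1 \<in> ann y"
    using assms by (simp add: diff_mem_ann_iff has_label_def star_one)
  ultimately show ?thesis
    using that[of "(\<d> + 1) \<star>\<^bsub>M\<^esub> y"] False assms by (simp add: mem_ann_star)
qed

end

text \<open>The map sends x y to x z. Equality of the annihilators makes it well defined, whatever x
  the choice operator picks, and also injective.\<close>

lemma module_iso_cyclic:
  assumes M: "s03_module M" and N: "s03_module N"
    and y: "y \<in> carrier M" "carrier M = s03_module.cyclic M y"
    and z: "z \<in> carrier N" "carrier N = s03_module.cyclic N z"
    and ann: "s03_module.ann M y = s03_module.ann N z"
  shows "module_iso S03 M N"
proof -
  interpret M: s03_module M by fact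
  interpret N: s03_module N by fact
  define f where "f m = (SOME x. m = x \<star>\<^bsub>M\<^esub> y) \<star>\<^bsub>N\<^esub> z" for m
  have eq_iff: "x \<star>\<^bsub>M\<^esub> y = x' \<star>\<^bsub>M\<^esub> y \<longleftrightarrow> x \<star>\<^bsub>N\<^esub> z = x' \<star>\<^bsub>N\<^esub> z" for x x'
    using y z ann by (simp flip: M.diff_mem_ann_iff N.diff_mem_ann_iff)
  have f: "f (x \<star>\<^bsub>M\<^esub> y) = x \<star>\<^bsub>N\<^esub> z" for x
  proof -
    have "x \<star>\<^bsub>M\<^esub> y = (SOME x'. x \<star>\<^bsub>M\<^esub> y = x' \<star>\<^bsub>M\<^esub> y) \<star>\<^bsub>M\<^esub> y"
      by (rule someI) (rule refl)
    then show ?thesis unfolding f_def eq_iff by (rule sym)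
  qed
  show ?thesis
    unfolding module_iso_def
  proof (intro exI conjI ballI)
    show "bij_betw f (carrier M) (carrier N)"
      by (auto simp: bij_betw_def inj_on_def y(2) z(2) M.cyclic_def N.cyclic_def f eq_iff image_image)
    fix m n assume "m \<in> carrier M" "n \<in> carrier M"
    then obtain x x' where "m = x \<star>\<^bsub>M\<^esub> y" "n = x' \<star>\<^bsub>M\<^esub> y"
      using M.cyclicE[OF y(2)] by metis
    then show "f (m \<oplus>\<^bsub>M\<^esub> n) = f m \<oplus>\<^bsub>N\<^esub> f n"
      using y z by (simp add: f flip: M.star_add N.star_add)
  next
    fix a m assume "a \<in> carrier S03" "m \<in> carrier M"
    then obtain x x' where "a = elt x" "m = x' \<star>\<^bsub>M\<^esub> y"
      using M.cyclicE[OF y(2)] elt_cases by metis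
    then show "f (a \<odot>\<^bsub>M\<^esub> m) = a \<odot>\<^bsub>N\<^esub> f m"
      using y z by (simp add: f flip: M.star_mult N.star_mult)
  qed
qed

lemma module_iso_star:
  assumes "module_iso S03 M N"
  obtains f where "bij_betw f (carrier M) (carrier N)"
    "\<And>x m. m \<in> carrier M \<Longrightarrow> f (x \<star>\<^bsub>M\<^esub> m) = x \<star>\<^bsub>N\<^esub> f m"
  using assms unfolding module_iso_def by (metis elt_closed)

lemma has_label_module_iso:
  assumes M: "s03_module M" and N: "s03_module N" and iso: "module_iso S03 M N" and t: "has_label M t"
  shows "has_label N t"
proof -
  interpret M: s03_module M by fact
  interpret N: s03_module N by fact
  obtain f where f: "bij_betw f (carrier M) (carrier N)"
    "\<And>x m. m \<in> carrier M \<Longrightarrow> f (x \<star>\<^bsub>M\<^esub> m) = x \<star>\<^bsub>N\<^esub> f m"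
    using iso by (rule module_iso_star) blast
  have N_eq: "carrier N = f ` carrier M" using f(1) by (simp add: bij_betw_def)
  \<comment> \<open>Only compatibility with the action has been retained for f, so f 0 = 0 is
    obtained from the action of the scalar 0.\<close>
  have "f \<zero>\<^bsub>M\<^esub> = 0 \<star>\<^bsub>N\<^esub> f \<zero>\<^bsub>M\<^esub>"
    using f(2)[of "\<zero>\<^bsub>M\<^esub>" 0] by (simp add: M.star_zero)
  then have "f \<zero>\<^bsub>M\<^esub> = \<zero>\<^bsub>N\<^esub>"
    using N_eq by (simp add: N.star_zero)
  then show ?thesis
    using t unfolding has_label_def N_eq by (auto split: option.splits simp flip: f(2))
qed

text \<open>By \<open>module_iso_cyclic\<close> it suffices to find generators with equal
  annihilators. The label provides a reduced form of each x, and in either module x kills the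
  generator exactly when all coefficients of that form vanish.\<close>

lemma irreducible_module_iso:
  assumes M: "irreducible_module S03 M" and N: "irreducible_module S03 N"
    and t: "has_label M t" "has_label N t"
  shows "module_iso S03 M N"
proof -
  interpret M: s03_module M using M by (simp add: irreducible_module_def s03_module_def)
  interpret N: s03_module N using N by (simp add: irreducible_module_def s03_module_def)
  obtain y0 where y0: "y0 \<in> carrier M" "y0 \<noteq> \<zero>\<^bsub>M\<^esub>" using M by (rule M.irreducible_nonzero)
  obtain z0 where z0: "z0 \<in> carrier N" "z0 \<noteq> \<zero>\<^bsub>N\<^esub>" using N by (rule N.irreducible_nonzero)
  \<comment> \<open>Reducing modulo the intersection gives one reduced form that is valid in both
    modules at once.\<close>
  have left_ideal_Int: "left_ideal (M.ann y \<inter> N.ann z)" if "y \<in> carrier M" "z \<in> carrier N" for y z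
    using M.left_ideal_ann[OF that(1)] N.left_ideal_ann[OF that(2)] unfolding left_ideal_def by blast
  show ?thesis
  proof (cases t)
    case (Some w)
    obtain \<beta> \<gamma> where w: "w = (\<beta>, \<gamma>)" by (cases w)
    let ?A = "M.ann y0 \<inter> N.ann z0"
    have "\<d> \<in> ?A"
      using t y0 z0 by (auto simp: Some w has_label_def M.mem_ann_iff N.mem_ann_iff)
    moreover have "\<b> - \<kappa> \<beta> \<in> ?A" "\<c> - \<kappa> \<gamma> \<in> ?A"
      using t y0 z0 by (auto simp: Some w has_label_def M.diff_mem_ann_iff N.diff_mem_ann_iff)
    ultimately have eigen: "\<b> - \<kappa> \<beta> \<in> ?A" "\<c> - \<kappa> \<gamma> \<in> ?A" "\<d> \<in> ?A"
      by blast+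
    have "x \<in> M.ann y0 \<longleftrightarrow> x \<in> N.ann z0" for x
    proof -
      obtain k where k: "x - \<kappa> k \<in> ?A"
        using congruent_scalar[OF left_ideal_Int eigen] y0 z0 by blast
      have "x \<in> M.ann y0 \<longleftrightarrow> k = 0"
        using k y0 M.\<kappa>_star_eq_zero[of y0 k] M.mem_ann_cong[of y0 x "\<kappa> k"]
        by (auto simp: M.mem_ann_iff M.star_zero)
      moreover have "x \<in> N.ann z0 \<longleftrightarrow> k = 0"
        using k z0 N.\<kappa>_star_eq_zero[of z0 k] N.mem_ann_cong[of z0 x "\<kappa> k"]
        by (auto simp: N.mem_ann_iff N.star_zero)
      ultimately show ?thesis by simp
    qed
    then show ?thesis
      using y0 z0 M.irreducible_cyclic[OF M] N.irreducible_cyclic[OF N]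
      by (intro module_iso_cyclic[of M N y0 z0] M.s03_module_axioms N.s03_module_axioms) auto
  next
    case None
    obtain y where y: "y \<in> carrier M" "y \<noteq> \<zero>\<^bsub>M\<^esub>" "\<d> - \<kappa> 1 \<in> M.ann y"
      using t(1) y0 unfolding None by (rule M.has_label_None_eigenvector)
    obtain z where z: "z \<in> carrier N" "z \<noteq> \<zero>\<^bsub>N\<^esub>" "\<d> - \<kappa> 1 \<in> N.ann z"
      using t(2) z0 unfolding None by (rule N.has_label_None_eigenvector)
    have "x \<in> M.ann y \<longleftrightarrow> x \<in> N.ann z" for x
    proof -
      obtain j k where jk: "x - (\<kappa> j + \<kappa> k * \<b>) \<in> M.ann y \<inter> N.ann z"
        using congruent_pair[OF left_ideal_Int, of y z 1 x] y z by auto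
      have "x \<in> M.ann y \<longleftrightarrow> \<kappa> j + \<kappa> k * \<b> \<in> M.ann y" "x \<in> N.ann z \<longleftrightarrow> \<kappa> j + \<kappa> k * \<b> \<in> N.ann z"
        using jk y z by (auto simp: M.mem_ann_cong N.mem_ann_cong)
      moreover have "\<kappa> j + \<kappa> k * \<b> \<in> M.ann y \<longleftrightarrow> j = 0 \<and> k = 0"
        using pair_independent[OF M.left_ideal_ann, of y 1 j k] left_ideal_0[OF M.left_ideal_ann] y
        by (auto simp: M.one_mem_ann_iff)
      moreover have "\<kappa> j + \<kappa> k * \<b> \<in> N.ann z \<longleftrightarrow> j = 0 \<and> k = 0"
        using pair_independent[OF N.left_ideal_ann, of z 1 j k] left_ideal_0[OF N.left_ideal_ann] z
        by (auto simp: N.one_mem_ann_iff)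
      ultimately show ?thesis by simp
    qed
    then show ?thesis
      using y z M.irreducible_cyclic[OF M] N.irreducible_cyclic[OF N]
      by (intro module_iso_cyclic[of M N y z] M.s03_module_axioms N.s03_module_axioms) auto
  qed
qed

context s03_module
begin

lemma submodule_cyclic_eq:
  assumes "submodule N S03 M"
  shows "s03_module.cyclic (M\<lparr>carrier := N\<rparr>) = cyclic" "s03_module.ann (M\<lparr>carrier := N\<rparr>) = ann"
  by (auto simp: fun_eq_iff cyclic_def ann_def s03_module.cyclic_def[OF submodule_s03_module[OF assms]]
      s03_module.ann_def[OF submodule_s03_module[OF assms]])

context
  fixes \<beta> \<gamma> y
  assumes y: "y \<in> carrier M"
    and eigen: "\<b> - \<kappa> \<beta> \<in> ann y" "\<c> - \<kappa> \<gamma> \<in> ann y" "\<d> \<in> ann y"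
begin

text \<open>On a joint eigenvector every element of s03' acts by a number, so the complex line is
  the whole submodule generated.\<close>

lemma line_eq_cyclic: "line M y = cyclic y"
proof -
  have "\<exists>k. x \<star>\<^bsub>M\<^esub> y = \<kappa> k \<star>\<^bsub>M\<^esub> y" for x
    using congruent_scalar[OF left_ideal_ann[OF y] eigen, of x] y by (simp add: diff_mem_ann_iff)
  then show ?thesis
    by (auto simp: line_def cyclic_def simp flip: elt_generators)
qed

lemma submodule_line: "submodule (line M y) S03 M"
  unfolding line_eq_cyclic by (rule submodule_cyclic[OF y])

lemma line_module:
  assumes "y \<noteq> \<zero>"
  shows "irreducible_module S03 (M\<lparr>carrier := line M y\<rparr>)"
    "has_label (M\<lparr>carrier := line M y\<rparr>) (Some (\<beta>, \<gamma>))"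
    "is_basis (M\<lparr>carrier := line M y\<rparr>) [y]"
proof -
  interpret L: s03_module "M\<lparr>carrier := line M y\<rparr>"
    by (rule submodule_s03_module[OF submodule_line])
  have *: "y \<in> carrier (M\<lparr>carrier := line M y\<rparr>)"
    "carrier (M\<lparr>carrier := line M y\<rparr>) = L.cyclic y"
    unfolding submodule_cyclic_eq[OF submodule_line] using mem_cyclic[OF y]
    by (simp_all add: line_eq_cyclic)
  have eigen': "\<b> - \<kappa> \<beta> \<in> L.ann y" "\<c> - \<kappa> \<gamma> \<in> L.ann y" "\<d> \<in> L.ann y"
    using eigen by (simp_all only: submodule_cyclic_eq[OF submodule_line])
  have "y \<noteq> \<zero>\<^bsub>M\<lparr>carrier := line M y\<rparr>\<^esub>" using assms by simp
  then show "irreducible_module S03 (M\<lparr>carrier := line M y\<rparr>)"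
    "is_basis (M\<lparr>carrier := line M y\<rparr>) [y]"
    by (rule L.eigen_irreducible[OF * eigen'] L.eigen_basis[OF * eigen'])+
  show "has_label (M\<lparr>carrier := line M y\<rparr>) (Some (\<beta>, \<gamma>))"
    by (rule L.eigen_has_label[OF * eigen'])
qed

end

end

lemma quotient_moduleI: "s03_module M \<Longrightarrow> submodule N S03 M \<Longrightarrow> quotient_module S03 M N"
  by (simp add: quotient_module_def s03_module_def)

lemma quot_s03_module: "s03_module M \<Longrightarrow> submodule N S03 M \<Longrightarrow> s03_module (quot_module M N)"
  unfolding s03_module_def
  by (rule quotient_module.left_module_quot) (simp add: quotient_module_def)

text \<open>Used to carry identities valid throughout V_l over to all its subquotients.\<close>

lemma quot_star_eq_zero:
  assumes M: "s03_module M" "submodule N S03 M" and x: "\<And>m. m \<in> carrier M \<Longrightarrow> x \<star>\<^bsub>M\<^esub> m = \<zero>\<^bsub>M\<^esub>"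
    and m: "m \<in> carrier (quot_module M N)"
  shows "x \<star>\<^bsub>quot_module M N\<^esub> m = \<zero>\<^bsub>quot_module M N\<^esub>"
proof -
  interpret quotient_module S03 M N using M by (rule quotient_moduleI)
  obtain m' where "m' \<in> carrier M" "m = N +>\<^bsub>M\<^esub> m'" using m by (rule carrier_quotE)
  then show ?thesis by (simp add: smult_quot x coset_zero)
qed

section \<open>The universal modules\<close>

lemma carrier_S03_eq_range_elt: "carrier S03 = range elt"
  by (rule type_definition.Rep_range[OF type_definition_s03, symmetric])

lemma V_ideal_eq: "V_ideal l = range (\<lambda>p. elt (p * (\<d> - \<kappa> l)))"
  by (auto simp: V_ideal_def cgenideal_def carrier_S03_eq_range_elt times_s03.rep_eq minus_s03.rep_eq
      elt_generators)

lemma quotient_module_V: "quotient_module S03 (regular_module S03) (V_ideal l)"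
proof -
  interpret left_module S03 "regular_module S03"
    by (rule left_module_regular_module) (rule S.ring_axioms)
  have "submodule (V_ideal l) S03 (regular_module S03)"
  proof (rule submoduleI)
    fix u v assume "u \<in> V_ideal l" "v \<in> V_ideal l"
    then obtain p q where "u = elt (p * (\<d> - \<kappa> l))" "v = elt (q * (\<d> - \<kappa> l))"
      unfolding V_ideal_eq by blast
    then have "u \<oplus>\<^bsub>regular_module S03\<^esub> v = elt ((p + q) * (\<d> - \<kappa> l))"
      by (simp add: regular_module_def distrib_right plus_s03.rep_eq)
    then show "u \<oplus>\<^bsub>regular_module S03\<^esub> v \<in> V_ideal l" unfolding V_ideal_eq by blast
  next
    fix a u assume "a \<in> carrier S03" "u \<in> V_ideal l"
    then obtain x p where "a = elt x" "u = elt (p * (\<d> - \<kappa> l))"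
      unfolding V_ideal_eq carrier_S03_eq_range_elt by blast
    then have "a \<odot>\<^bsub>regular_module S03\<^esub> u = elt ((x * p) * (\<d> - \<kappa> l))"
      by (simp add: regular_module_def mult.assoc times_s03.rep_eq)
    then show "a \<odot>\<^bsub>regular_module S03\<^esub> u \<in> V_ideal l" unfolding V_ideal_eq by blast
  qed (auto simp: V_ideal_eq regular_module_def)
  then show ?thesis using left_module_axioms by (simp add: quotient_module_def)
qed

lemma s03_module_Vmod: "s03_module (Vmod l)"
  unfolding s03_module_def Vmod_def by (rule quotient_module.left_module_quot[OF quotient_module_V])

lemma star_v0: "x \<star>\<^bsub>Vmod l\<^esub> v0 l = V_ideal l +>\<^bsub>regular_module S03\<^esub> elt x"
proof -
  interpret quotient_module S03 "regular_module S03" "V_ideal l" by (rule quotient_module_V)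
  have v0: "v0 l = V_ideal l +>\<^bsub>regular_module S03\<^esub> \<one>\<^bsub>S03\<^esub>"
    by (simp add: v0_def a_r_coset_def' regular_module_def)
  have "elt x \<odot>\<^bsub>regular_module S03\<^esub> \<one>\<^bsub>S03\<^esub> = elt x" "\<one>\<^bsub>S03\<^esub> \<in> carrier (regular_module S03)"
    by (simp_all add: regular_module_def)
  then show ?thesis by (simp add: v0 Vmod_def smult_quot)
qed

lemma v0_closed: "v0 l \<in> carrier (Vmod l)"
  and carrier_Vmod: "carrier (Vmod l) = s03_module.cyclic (Vmod l) (v0 l)"
  and ann_v0: "s03_module.ann (Vmod l) (v0 l) = range (\<lambda>p. p * (\<d> - \<kappa> l))"
proof -
  interpret quotient_module S03 "regular_module S03" "V_ideal l" by (rule quotient_module_V)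
  interpret V: s03_module "Vmod l" by (rule s03_module_Vmod)
  have carrier: "carrier (regular_module S03) = range elt"
    by (simp add: regular_module_def carrier_S03_eq_range_elt)
  show eq: "carrier (Vmod l) = V.cyclic (v0 l)"
    unfolding V.cyclic_def star_v0 by (simp add: carrier image_image Vmod_def carrier_quot)
  have "v0 l = V_ideal l +>\<^bsub>regular_module S03\<^esub> elt 1"
    by (simp add: v0_def a_r_coset_def' regular_module_def one_s03.rep_eq)
  also have "\<dots> = 1 \<star>\<^bsub>Vmod l\<^esub> v0 l" by (simp add: star_v0)
  finally show "v0 l \<in> carrier (Vmod l)" unfolding eq V.cyclic_def by blast
  have "x \<in> V.ann (v0 l) \<longleftrightarrow> elt x \<in> V_ideal l" for x
    unfolding V.mem_ann_iff star_v0 using coset_eq_zero_iff[of "elt x"] carrier by (simp add: Vmod_def)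
  then show "V.ann (v0 l) = range (\<lambda>p. p * (\<d> - \<kappa> l))"
    by (auto simp: V_ideal_eq elt_inject)
qed

lemma eigenvector_v0: "\<d> - \<kappa> l \<in> s03_module.ann (Vmod l) (v0 l)"
  unfolding ann_v0 by (intro range_eqI[of _ _ 1]) simp

text \<open>From d^3 = d follows l^3 = l. The cofactor is the one of d^3 - l^3 = (d^2 + l d + l^2)
  (d - l), less 1 for the linear term.\<close>

lemma eigenvalue_square:
  assumes A: "left_ideal A" and d: "\<d> - \<kappa> l \<in> A" and "l \<noteq> 0" "1 \<notin> A"
  shows "l^2 = 1"
proof -
  have "\<kappa> (l - l * (l * l)) = (\<d> * \<d> + \<kappa> l * \<d> + \<kappa> (l * l) - 1) * (\<d> - \<kappa> l)"
    by (simp add: s03_nf \<kappa>_diff)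
  then have "\<kappa> (l - l * (l * l)) \<in> A" using left_ideal_mult[OF A d] by simp
  then have "l - l * (l * l) = 0" using left_ideal_\<kappa>[OF A] \<open>1 \<notin> A\<close> by blast
  then show ?thesis using \<open>l \<noteq> 0\<close> by (simp add: power2_eq_square)
qed

lemma Vmod_nonzero_iff: "carrier (Vmod l) \<noteq> {\<zero>\<^bsub>Vmod l\<^esub>} \<longleftrightarrow> v0 l \<noteq> \<zero>\<^bsub>Vmod l\<^esub>"
proof -
  interpret V: s03_module "Vmod l" by (rule s03_module_Vmod)
  show ?thesis
  proof (cases "v0 l = \<zero>\<^bsub>Vmod l\<^esub>")
    case True
    then have "carrier (Vmod l) = {\<zero>\<^bsub>Vmod l\<^esub>}"
      unfolding carrier_Vmod V.cyclic_def by (simp add: V.star_zero_right)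
    then show ?thesis using True by simp
  qed (use v0_closed in auto)
qed

lemma Vmod_eigenvalue_square:
  assumes "l \<noteq> 0" "v0 l \<noteq> \<zero>\<^bsub>Vmod l\<^esub>"
  shows "l^2 = 1"
proof -
  interpret V: s03_module "Vmod l" by (rule s03_module_Vmod)
  show ?thesis
    using eigenvalue_square[OF V.left_ideal_ann[OF v0_closed] eigenvector_v0 assms(1)] assms(2)
    by (simp add: V.one_mem_ann_iff v0_closed)
qed

lemma Vmod_pair:
  assumes "l^2 = 1" "v0 l \<noteq> \<zero>\<^bsub>Vmod l\<^esub>"
  shows "irreducible_module S03 (Vmod l)" "has_label (Vmod l) None"
    "is_basis (Vmod l) [v0 l, \<b> \<star>\<^bsub>Vmod l\<^esub> v0 l]"
proof -
  interpret V: s03_module "Vmod l" by (rule s03_module_Vmod)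
  note * = v0_closed carrier_Vmod assms(1) eigenvector_v0
  show "irreducible_module S03 (Vmod l)" by (rule V.pair_irreducible[OF * assms(2)])
  show "has_label (Vmod l) None" by (rule V.pair_has_label[OF *])
  show "is_basis (Vmod l) [v0 l, \<b> \<star>\<^bsub>Vmod l\<^esub> v0 l]" by (rule V.pair_basis[OF * assms(2)])
qed

lemma Vmod_pair_action:
  assumes "l^2 = 1"
  shows "\<b> \<star>\<^bsub>Vmod l\<^esub> (\<b> \<star>\<^bsub>Vmod l\<^esub> v0 l) = v0 l"
    "\<c> \<star>\<^bsub>Vmod l\<^esub> v0 l = \<kappa> (- l) \<star>\<^bsub>Vmod l\<^esub> (\<b> \<star>\<^bsub>Vmod l\<^esub> v0 l)"
    "\<c> \<star>\<^bsub>Vmod l\<^esub> (\<b> \<star>\<^bsub>Vmod l\<^esub> v0 l) = \<kappa> l \<star>\<^bsub>Vmod l\<^esub> v0 l"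
    "\<d> \<star>\<^bsub>Vmod l\<^esub> v0 l = \<kappa> l \<star>\<^bsub>Vmod l\<^esub> v0 l"
    "\<d> \<star>\<^bsub>Vmod l\<^esub> (\<b> \<star>\<^bsub>Vmod l\<^esub> v0 l) = \<kappa> (- l) \<star>\<^bsub>Vmod l\<^esub> (\<b> \<star>\<^bsub>Vmod l\<^esub> v0 l)"
proof -
  interpret V: s03_module "Vmod l" by (rule s03_module_Vmod)
  note v = v0_closed[of l]
  note A = V.left_ideal_ann[OF v]
  note d = eigenvector_v0[of l]
  note bb = b_square_congruent[OF A assms d] and c = c_congruent[OF A assms d]
  have eq: "x \<star>\<^bsub>Vmod l\<^esub> v0 l = x' \<star>\<^bsub>Vmod l\<^esub> v0 l" if "x - x' \<in> V.ann (v0 l)" for x x'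
    using that v by (simp add: V.diff_mem_ann_iff)
  show "\<b> \<star>\<^bsub>Vmod l\<^esub> (\<b> \<star>\<^bsub>Vmod l\<^esub> v0 l) = v0 l"
    using eq[OF bb] v by (simp add: V.star_mult V.star_one)
  have "\<c> - \<kappa> (- l) * \<b> \<in> V.ann (v0 l)"
    using c by (simp add: \<kappa>_uminus)
  from eq[OF this] show "\<c> \<star>\<^bsub>Vmod l\<^esub> v0 l = \<kappa> (- l) \<star>\<^bsub>Vmod l\<^esub> (\<b> \<star>\<^bsub>Vmod l\<^esub> v0 l)"
    using v by (simp add: V.star_mult)
  \<comment> \<open>Here c b = b c + 2d is congruent to -l b^2 + 2l, hence to l.\<close>
  have "\<c> * \<b> - \<kappa> l = \<b> * (\<c> + \<kappa> l * \<b>) - \<kappa> l * (\<b> * \<b> - 1) + ((\<d> - \<kappa> l) + (\<d> - \<kappa> l))"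
    by (simp add: s03_nf)
  then have "\<c> * \<b> - \<kappa> l \<in> V.ann (v0 l)"
    by (simp only: left_ideal_add[OF A] left_ideal_diff[OF A] left_ideal_mult[OF A] bb c d)
  from eq[OF this] show "\<c> \<star>\<^bsub>Vmod l\<^esub> (\<b> \<star>\<^bsub>Vmod l\<^esub> v0 l) = \<kappa> l \<star>\<^bsub>Vmod l\<^esub> v0 l"
    using v by (simp add: V.star_mult)
  show "\<d> \<star>\<^bsub>Vmod l\<^esub> v0 l = \<kappa> l \<star>\<^bsub>Vmod l\<^esub> v0 l"
    by (rule eq[OF d])
  have "\<d> * \<b> - \<kappa> (- l) * \<b> = - \<b> * (\<d> - \<kappa> l)"
    by (simp add: s03_nf \<kappa>_uminus)
  then have "\<d> * \<b> - \<kappa> (- l) * \<b> \<in> V.ann (v0 l)"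
    using left_ideal_mult[OF A d] by (simp only:)
  from eq[OF this] show "\<d> \<star>\<^bsub>Vmod l\<^esub> (\<b> \<star>\<^bsub>Vmod l\<^esub> v0 l) = \<kappa> (- l) \<star>\<^bsub>Vmod l\<^esub> (\<b> \<star>\<^bsub>Vmod l\<^esub> v0 l)"
    using v by (simp add: V.star_mult)
qed

lemma nonzero_eigenvalue_module:
  assumes "l \<noteq> 0" "carrier (Vmod l) \<noteq> {\<zero>\<^bsub>Vmod l\<^esub>}"
  shows "let B = (\<lambda>x. tB \<odot>\<^bsub>Vmod l\<^esub> x); C = (\<lambda>x. tC \<odot>\<^bsub>Vmod l\<^esub> x); D = (\<lambda>x. tD \<odot>\<^bsub>Vmod l\<^esub> x);
            scale = (\<lambda>c x. sc c \<odot>\<^bsub>Vmod l\<^esub> x); v = v0 l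
        in l^2 = 1
         \<and> (tB [^]\<^bsub>S03\<^esub> (2::nat)) \<odot>\<^bsub>Vmod l\<^esub> v = v
         \<and> C v = scale (- l) (B v)
         \<and> is_basis (Vmod l) [v, B v]
         \<and> irreducible_module S03 (Vmod l)
         \<and> B (B v) = v
         \<and> C (B v) = scale l v
         \<and> D v = scale l v
         \<and> D (B v) = scale (- l) (B v)
         \<and> (\<forall>x\<in>carrier (Vmod l). (tB [^]\<^bsub>S03\<^esub> (2::nat)) \<odot>\<^bsub>Vmod l\<^esub> x = x
                            \<and> (tD [^]\<^bsub>S03\<^esub> (2::nat)) \<odot>\<^bsub>Vmod l\<^esub> x = x)"
proof -
  have v: "v0 l \<noteq> \<zero>\<^bsub>Vmod l\<^esub>" using iffD1[OF Vmod_nonzero_iff assms(2)] .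
  have l: "l^2 = 1" using assms(1) v by (rule Vmod_eigenvalue_square)
  have squares: "(tB [^]\<^bsub>S03\<^esub> (2::nat)) \<odot>\<^bsub>Vmod l\<^esub> x = x \<and> (tD [^]\<^bsub>S03\<^esub> (2::nat)) \<odot>\<^bsub>Vmod l\<^esub> x = x"
    if "x \<in> carrier (Vmod l)" for x
    using Vmod_pair(2)[OF l v] that
    by (simp add: has_label_def power2_eq_square flip: elt_generators elt_power)
  show ?thesis
    unfolding Let_def elt_generators[symmetric]
    using l squares[unfolded elt_generators[symmetric]] v0_closed[of l] Vmod_pair[OF l v]
      Vmod_pair_action[OF l] by auto
qed

section \<open>The module with eigenvalue zero\<close>

lemma ann_v0_0: "s03_module.ann (Vmod 0) (v0 0) = range (\<lambda>p. p * \<d>)"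
  by (simp add: ann_v0)

text \<open>The left ideal generated by d is two-sided, because d anticommutes with b and c. Hence d
  acts by zero on all of V_0 and not merely on v0.\<close>

lemma d_normal: "\<exists>p. \<d> * x = p * \<d>"
proof (induction x rule: s03_induct)
  case (const k)
  show ?case by (intro exI[of _ "\<kappa> k"]) (simp add: s03_nf)
next
  case (gen x)
  then obtain p where p: "\<d> * x = p * \<d>" by blast
  have "\<d> * (\<b> * x) = (- \<b> * p) * \<d>" "\<d> * (\<c> * x) = (- \<c> * p) * \<d>" "\<d> * (\<d> * x) = (\<d> * p) * \<d>"
    using p by (simp_all add: s03_commutation[THEN mult_assoc_rewrite] mult.assoc)
  then show ?case by blast
next
  case (add x y)
  then obtain p q where "\<d> * x = p * \<d>" "\<d> * y = q * \<d>" by blast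
  then have "\<d> * (x + y) = (p + q) * \<d>" by (simp add: distrib_left distrib_right)
  then show ?case by blast
qed

lemma d_Vmod_0:
  assumes "m \<in> carrier (Vmod 0)"
  shows "\<d> \<star>\<^bsub>Vmod 0\<^esub> m = \<zero>\<^bsub>Vmod 0\<^esub>"
proof -
  interpret V: s03_module "Vmod 0" by (rule s03_module_Vmod)
  obtain x where x: "m = x \<star>\<^bsub>Vmod 0\<^esub> v0 0" using assms by (rule V.cyclicE[OF carrier_Vmod])
  have "\<d> * x \<in> V.ann (v0 0)" using d_normal[of x] by (auto simp: ann_v0_0)
  then show ?thesis using x v0_closed by (simp add: V.mem_ann_iff V.star_mult)
qed

lemma character_exists_v0:
  assumes "(\<beta>, \<gamma>) \<in> weights"
  obtains \<chi> :: "s03 \<Rightarrow> complex" where "\<And>x y. \<chi> (x + y) = \<chi> x + \<chi> y" "\<And>x y. \<chi> (x * y) = \<chi> x * \<chi> y"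
    "\<And>k. \<chi> (\<kappa> k) = k" "\<chi> \<b> = \<beta>" "\<chi> \<c> = \<gamma>" "\<And>x. x \<in> s03_module.ann (Vmod 0) (v0 0) \<Longrightarrow> \<chi> x = 0"
proof -
  obtain \<chi> :: "s03 \<Rightarrow> complex" where "\<And>x y. \<chi> (x + y) = \<chi> x + \<chi> y" "\<And>x y. \<chi> (x * y) = \<chi> x * \<chi> y"
    "\<And>k. \<chi> (\<kappa> k) = k" "\<chi> \<b> = \<beta>" "\<chi> \<c> = \<gamma>" "\<chi> \<d> = 0"
    using character_exists[OF assms] by blast
  then show ?thesis by (intro that[of \<chi>]) (auto simp: ann_v0_0)
qed

text \<open>The five characters vanish on d, hence on the annihilator of v0, so each gives one
  linear equation for the coefficients. The five joint eigenvalues make the system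
  nonsingular.\<close>

lemma quintuple_independent:
  assumes "\<kappa> p + \<kappa> q * \<b> + \<kappa> r * \<c> + \<kappa> s * (\<b> * \<c>) + \<kappa> t * (\<b> * \<b>) \<in> s03_module.ann (Vmod 0) (v0 0)"
  shows "p = 0" "q = 0" "r = 0" "s = 0" "t = 0"
proof -
  have eq: "p + q * \<beta> + r * \<gamma> + s * (\<beta> * \<gamma>) + t * (\<beta> * \<beta>) = 0" if w: "(\<beta>, \<gamma>) \<in> weights" for \<beta> \<gamma>
  proof -
    obtain \<chi> :: "s03 \<Rightarrow> complex" where \<chi>: "\<And>x y. \<chi> (x + y) = \<chi> x + \<chi> y" "\<And>x y. \<chi> (x * y) = \<chi> x * \<chi> y"
      "\<And>k. \<chi> (\<kappa> k) = k" "\<chi> \<b> = \<beta>" "\<chi> \<c> = \<gamma>"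
      "\<And>x. x \<in> s03_module.ann (Vmod 0) (v0 0) \<Longrightarrow> \<chi> x = 0"
      using character_exists_v0[OF w] by blast
    show ?thesis using \<chi>(6)[OF assms] by (simp add: \<chi>(1-5))
  qed
  have w: "(0, 0) \<in> weights" "(1, \<i>) \<in> weights" "(1, -\<i>) \<in> weights" "(-1, \<i>) \<in> weights"
    "(-1, -\<i>) \<in> weights"
    by (simp_all add: weights_eq)
  show p: "p = 0" using eq[OF w(1)] by simp
  have pp: "q + r * \<i> + s * \<i> + t = 0" using eq[OF w(2)] p by simp
  have pm: "q - r * \<i> - s * \<i> + t = 0" using eq[OF w(3)] p by simp
  have mp: "- q + r * \<i> - s * \<i> + t = 0" using eq[OF w(4)] p by simp
  have mm: "- q - r * \<i> + s * \<i> + t = 0" using eq[OF w(5)] p by simp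
  \<comment> \<open>After p = 0 the four remaining equations have coefficients 1 and -1 in q, r
    \<i>, s \<i>, t with orthogonal columns. Summing them with the signs of one column isolates four
    times one unknown.\<close>
  have "4 * q = (q + r * \<i> + s * \<i> + t) + (q - r * \<i> - s * \<i> + t)
      - (- q + r * \<i> - s * \<i> + t) - (- q - r * \<i> + s * \<i> + t)" by simp
  then show "q = 0" unfolding pp pm mp mm by simp
  have "4 * t = (q + r * \<i> + s * \<i> + t) + (q - r * \<i> - s * \<i> + t)
      + (- q + r * \<i> - s * \<i> + t) + (- q - r * \<i> + s * \<i> + t)" by simp
  then show "t = 0" unfolding pp pm mp mm by simp
  have "4 * (r * \<i>) = (q + r * \<i> + s * \<i> + t) - (q - r * \<i> - s * \<i> + t)
      + (- q + r * \<i> - s * \<i> + t) - (- q - r * \<i> + s * \<i> + t)" by simp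
  then show "r = 0" unfolding pp pm mp mm by simp
  have "4 * (s * \<i>) = (q + r * \<i> + s * \<i> + t) - (q - r * \<i> - s * \<i> + t)
      - (- q + r * \<i> - s * \<i> + t) + (- q - r * \<i> + s * \<i> + t)" by simp
  then show "s = 0" unfolding pp pm mp mm by simp
qed

lemma Vmod_0_basis:
  "is_basis (Vmod 0) [v0 0, \<b> \<star>\<^bsub>Vmod 0\<^esub> v0 0, \<c> \<star>\<^bsub>Vmod 0\<^esub> v0 0, (\<b> * \<c>) \<star>\<^bsub>Vmod 0\<^esub> v0 0,
    (\<b> * \<b>) \<star>\<^bsub>Vmod 0\<^esub> v0 0]"
proof -
  interpret V: s03_module "Vmod 0" by (rule s03_module_Vmod)
  have "is_basis (Vmod 0) (map (\<lambda>x. x \<star>\<^bsub>Vmod 0\<^esub> v0 0) [1, \<b>, \<c>, \<b> * \<c>, \<b> * \<b>])"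
  proof (rule V.is_basis_starI[OF v0_closed], goal_cases)
    case (1 m)
    then obtain x where x: "m = x \<star>\<^bsub>Vmod 0\<^esub> v0 0" by (rule V.cyclicE[OF carrier_Vmod])
    have "\<d> \<in> V.ann (v0 0)" using eigenvector_v0[of 0] by simp
    then obtain p q r s t
      where "x - (\<kappa> p + \<kappa> q * \<b> + \<kappa> r * \<c> + \<kappa> s * (\<b> * \<c>) + \<kappa> t * (\<b> * \<b>)) \<in> V.ann (v0 0)"
      using congruent_quintuple[OF V.left_ideal_ann[OF v0_closed], of x] by blast
    then show ?case
      by (intro exI[of _ "\<lambda>i. [p, q, r, s, t] ! i"])
        (simp add: x V.diff_mem_ann_iff v0_closed eval_nat_numeral add.assoc)
  next
    case (2 k i)
    then have "\<kappa> (k 0) + \<kappa> (k 1) * \<b> + \<kappa> (k 2) * \<c> + \<kappa> (k 3) * (\<b> * \<c>) + \<kappa> (k 4) * (\<b> * \<b>) \<in> V.ann (v0 0)"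
      by (simp add: V.mem_ann_iff eval_nat_numeral add.assoc)
    note quintuple_independent[OF this]
    then show ?case using 2(2) by (auto simp: less_Suc_eq eval_nat_numeral)
  qed
  then show ?thesis using v0_closed[of 0] by (simp add: V.star_one)
qed

lemma w0_eq: "w0 = (\<b> * \<b> - 1) \<star>\<^bsub>Vmod 0\<^esub> v0 0"
  by (simp add: w0_def minus_s03.rep_eq one_s03.rep_eq power2_eq_square
      flip: elt_generators elt_power)

text \<open>Up to sign w0 is the image of v0 under the idempotent \<open>\<epsilon> 0 0\<close> of
  the trivial character: b and c annihilate b^2 - 1.\<close>

lemma w0_eigen:
  "w0 \<in> carrier (Vmod 0)" "w0 \<noteq> \<zero>\<^bsub>Vmod 0\<^esub>"
  "\<b> - \<kappa> 0 \<in> s03_module.ann (Vmod 0) w0" "\<c> - \<kappa> 0 \<in> s03_module.ann (Vmod 0) w0"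
  "\<d> \<in> s03_module.ann (Vmod 0) w0"
proof -
  interpret V: s03_module "Vmod 0" by (rule s03_module_Vmod)
  note A = V.left_ideal_ann[OF v0_closed]
  show w0: "w0 \<in> carrier (Vmod 0)" by (simp add: w0_eq v0_closed)
  have "\<b> * \<b> - 1 \<notin> V.ann (v0 0)"
    using quintuple_independent(1)[of "-1" 0 0 0 1] by (auto simp: \<kappa>_uminus)
  then show "w0 \<noteq> \<zero>\<^bsub>Vmod 0\<^esub>" by (simp add: w0_eq V.mem_ann_iff)
  have "(\<b> - \<kappa> 0) * (\<b> * \<b> - 1) = 0" "(\<c> - \<kappa> 0) * (\<b> * \<b> - 1) = 0"
    by (simp_all add: s03_nf)
  then show "\<b> - \<kappa> 0 \<in> V.ann w0" "\<c> - \<kappa> 0 \<in> V.ann w0"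
    unfolding w0_eq V.mem_ann_star[OF v0_closed] using left_ideal_0[OF A] by simp_all
  show "\<d> \<in> V.ann w0" using d_Vmod_0[OF w0] by (simp add: V.mem_ann_iff)
qed

lemma submodule_line_w0: "submodule (line (Vmod 0) w0) S03 (Vmod 0)"
  by (rule s03_module.submodule_line[OF s03_module_Vmod w0_eigen(1,3-5)])

lemma Tmod_module:
  "irreducible_module S03 Tmod" "has_label Tmod (Some (0, 0))" "is_basis Tmod [w0]"
  unfolding Tmod_def
  by (rule s03_module.line_module[OF s03_module_Vmod w0_eigen(1,3-5) w0_eigen(2)])+

lemma trivial_rep_iff:
  assumes "s03_module M"
  shows "trivial_rep M \<longleftrightarrow> has_label M (Some (0, 0))"
proof -
  interpret s03_module M by fact
  show ?thesis
    by (auto simp: trivial_rep_def has_label_def star_zero simp flip: elt_generators)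
qed

lemma mem_line_w0_iff:
  "x \<star>\<^bsub>Vmod 0\<^esub> v0 0 \<in> line (Vmod 0) w0
    \<longleftrightarrow> (\<exists>k. x - \<kappa> k * (\<b> * \<b> - 1) \<in> s03_module.ann (Vmod 0) (v0 0))"
proof -
  interpret V: s03_module "Vmod 0" by (rule s03_module_Vmod)
  show ?thesis
    by (simp add: line_def w0_eq V.diff_mem_ann_iff v0_closed V.star_mult flip: elt_generators)
qed

lemma reducible_Vmod_0: "reducible_module S03 (Vmod 0)"
proof -
  interpret V: s03_module "Vmod 0" by (rule s03_module_Vmod)
  have "w0 \<in> line (Vmod 0) w0"
    using V.mem_cyclic[OF w0_eigen(1)] by (simp add: V.line_eq_cyclic[OF w0_eigen(1,3-5)])
  then have "line (Vmod 0) w0 \<noteq> {\<zero>\<^bsub>Vmod 0\<^esub>}" using w0_eigen(2) by auto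
  moreover have "1 \<star>\<^bsub>Vmod 0\<^esub> v0 0 \<notin> line (Vmod 0) w0"
  proof
    assume "1 \<star>\<^bsub>Vmod 0\<^esub> v0 0 \<in> line (Vmod 0) w0"
    then obtain k where "1 - \<kappa> k * (\<b> * \<b> - 1) \<in> V.ann (v0 0)"
      unfolding mem_line_w0_iff by blast
    \<comment> \<open>The coefficients of v0 and of B^2 v0 are 1 + k and -k, which cannot both
      vanish.\<close>
    then have "\<kappa> (1 + k) + \<kappa> 0 * \<b> + \<kappa> 0 * \<c> + \<kappa> 0 * (\<b> * \<c>) + \<kappa> (- k) * (\<b> * \<b>) \<in> V.ann (v0 0)"
      by (simp add: \<kappa>_add \<kappa>_uminus algebra_simps)
    from quintuple_independent(1,5)[OF this] show False by simp
  qed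
  then have "line (Vmod 0) w0 \<noteq> carrier (Vmod 0)" using v0_closed[of 0] by (auto simp: V.star_one)
  ultimately show ?thesis
    using submodule_line_w0 V.left_module_axioms unfolding reducible_module_def by blast
qed

section \<open>The quotient of V0 by the trivial line\<close>

lemma s03_module_Qmod: "s03_module Qmod"
  unfolding Qmod_def by (rule quot_s03_module[OF s03_module_Vmod submodule_line_w0])

definition q0 :: "s03_elem set set" where "q0 = line (Vmod 0) w0 +>\<^bsub>Vmod 0\<^esub> v0 0"

lemma star_q0: "x \<star>\<^bsub>Qmod\<^esub> q0 = line (Vmod 0) w0 +>\<^bsub>Vmod 0\<^esub> (x \<star>\<^bsub>Vmod 0\<^esub> v0 0)"
  unfolding Qmod_def q0_def
  by (rule quotient_module.smult_quot[OF quotient_moduleI[OF s03_module_Vmod submodule_line_w0]])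
    (simp_all add: v0_closed)

lemma q0_closed: "q0 \<in> carrier Qmod"
  unfolding Qmod_def q0_def
  by (rule quotient_module.coset_closed[OF quotient_moduleI[OF s03_module_Vmod submodule_line_w0]])
    (rule v0_closed)

lemma carrier_Qmod: "carrier Qmod = s03_module.cyclic Qmod q0"
proof -
  interpret V: s03_module "Vmod 0" by (rule s03_module_Vmod)
  interpret Q: s03_module Qmod by (rule s03_module_Qmod)
  have "carrier Qmod = (\<lambda>m. line (Vmod 0) w0 +>\<^bsub>Vmod 0\<^esub> m) ` carrier (Vmod 0)"
    unfolding Qmod_def
    by (rule quotient_module.carrier_quot[OF quotient_moduleI[OF s03_module_Vmod submodule_line_w0]])
  then show ?thesis
    unfolding Q.cyclic_def star_q0 carrier_Vmod V.cyclic_def by (simp add: image_image)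
qed

text \<open>Passing to the quotient enlarges the annihilator of the generator by the complex line
  through b^2 - 1.\<close>

lemma mem_ann_q0_iff:
  "x \<in> s03_module.ann Qmod q0
    \<longleftrightarrow> (\<exists>k. x - \<kappa> k * (\<b> * \<b> - 1) \<in> s03_module.ann (Vmod 0) (v0 0))"
proof -
  interpret V: s03_module "Vmod 0" by (rule s03_module_Vmod)
  interpret Q: s03_module Qmod by (rule s03_module_Qmod)
  show ?thesis
    unfolding Q.mem_ann_iff star_q0 mem_line_w0_iff[symmetric] unfolding Qmod_def
    by (rule quotient_module.coset_eq_zero_iff[OF quotient_moduleI[OF s03_module_Vmod submodule_line_w0]])
      (simp add: v0_closed)
qed

lemma d_Qmod:
  assumes "m \<in> carrier Qmod"
  shows "\<d> \<star>\<^bsub>Qmod\<^esub> m = \<zero>\<^bsub>Qmod\<^esub>"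
  using assms unfolding Qmod_def
  by (intro quot_star_eq_zero[OF s03_module_Vmod submodule_line_w0 d_Vmod_0])

section \<open>Idempotents and joint eigenvectors in the quotient\<close>

lemma character_\<epsilon>:
  assumes "(\<beta>, \<gamma>) \<in> weights"
    and \<chi>: "\<And>x y. \<chi> (x + y) = \<chi> x + \<chi> y" "\<And>x y. \<chi> (x * y) = \<chi> x * \<chi> y" "\<And>k. \<chi> (\<kappa> k) = k"
      "\<chi> \<b> = \<beta>" "\<chi> \<c> = \<gamma>"
  shows "\<chi> (\<epsilon> \<beta> \<gamma>) = 1"
proof -
  have "\<chi> (x - y) = \<chi> x - \<chi> y" for x y
    using \<chi>(1)[of "x - y" y] by simp
  moreover have "\<chi> 1 = 1" using \<chi>(3)[of 1] by simp
  ultimately show ?thesis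
    using assms(1) by (auto simp: weights_eq \<epsilon>_def \<chi>)
qed

text \<open>The character of the same weight takes the value 1 on the idempotent and vanishes on the
  annihilator of v0. For \<beta> \<noteq> 0 it vanishes on b^2 - 1 as well, hence on the annihilator
  of q0.\<close>

lemma \<epsilon>_notin_ann:
  assumes w: "(\<beta>, \<gamma>) \<in> weights"
  shows "\<epsilon> \<beta> \<gamma> \<notin> s03_module.ann (Vmod 0) (v0 0)" "\<beta> \<noteq> 0 \<Longrightarrow> \<epsilon> \<beta> \<gamma> \<notin> s03_module.ann Qmod q0"
proof -
  obtain \<chi> :: "s03 \<Rightarrow> complex" where \<chi>: "\<And>x y. \<chi> (x + y) = \<chi> x + \<chi> y" "\<And>x y. \<chi> (x * y) = \<chi> x * \<chi> y"
    "\<And>k. \<chi> (\<kappa> k) = k" "\<chi> \<b> = \<beta>" "\<chi> \<c> = \<gamma>" "\<And>x. x \<in> s03_module.ann (Vmod 0) (v0 0) \<Longrightarrow> \<chi> x = 0"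
    using character_exists_v0[OF w] by blast
  have 1: "\<chi> (\<epsilon> \<beta> \<gamma>) = 1" by (rule character_\<epsilon>[OF w \<chi>(1-5)])
  then show "\<epsilon> \<beta> \<gamma> \<notin> s03_module.ann (Vmod 0) (v0 0)" using \<chi>(6) by force
  have diff: "\<chi> (x - y) = \<chi> x - \<chi> y" for x y
    using \<chi>(1)[of "x - y" y] by simp
  assume "\<beta> \<noteq> 0"
  then have "\<chi> (\<b> * \<b> - 1) = 0"
    using w \<chi>(3)[of 1] by (auto simp: weights_eq diff \<chi>(2,4))
  then have "\<chi> (\<epsilon> \<beta> \<gamma> - \<kappa> k * (\<b> * \<b> - 1)) = 1" for k
    using 1 by (simp add: diff \<chi>(2))
  then show "\<epsilon> \<beta> \<gamma> \<notin> s03_module.ann Qmod q0"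
    unfolding mem_ann_q0_iff using \<chi>(6) by force
qed

lemma bb_q0: "\<b> * \<b> - 1 \<in> s03_module.ann Qmod q0"
  unfolding mem_ann_q0_iff
  using left_ideal_0[OF s03_module.left_ideal_ann[OF s03_module_Vmod v0_closed]]
  by (intro exI[of _ 1]) simp

lemma wv_eq:
  assumes "e \<in> {1, -1}" "e' \<in> {1, -1}"
  shows "wv e e' = (\<kappa> (4 * e) * \<epsilon> e (\<i> * e')) \<star>\<^bsub>Qmod\<^esub> q0"
proof -
  interpret V: s03_module "Vmod 0" by (rule s03_module_Vmod)
  interpret Q: s03_module Qmod by (rule s03_module_Qmod)
  let ?w = "\<b> + \<kappa> e - \<kappa> (\<i> * e * e') * \<c> - \<kappa> (\<i> * e') * (\<b> * \<c>)"
  have "wv e e' = ?w \<star>\<^bsub>Qmod\<^esub> q0"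
    unfolding star_q0 wv_def
    by (simp add: minus_s03.rep_eq plus_s03.rep_eq times_s03.rep_eq elt_generators)
  \<comment> \<open>Since e^2 = 1, the factor 4e turns the idempotent into e b^2 + b - \<i> e e' c -
    \<i> e' b c. The vector of the theorem has e in place of e b^2, which makes no difference on
    q0.\<close>
  moreover have "?w - \<kappa> (4 * e) * \<epsilon> e (\<i> * e') = - \<kappa> e * (\<b> * \<b> - 1)"
    using assms by (auto simp: \<epsilon>_def s03_nf \<kappa>_uminus)
  then have "?w - \<kappa> (4 * e) * \<epsilon> e (\<i> * e') \<in> Q.ann q0"
    using left_ideal_mult[OF Q.left_ideal_ann[OF q0_closed] bb_q0] by (simp only:)
  ultimately show ?thesis by (simp add: Q.diff_mem_ann_iff q0_closed)
qed

lemma wv_eigen: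
  assumes e: "e \<in> {1, -1}" "e' \<in> {1, -1}"
  shows "wv e e' \<in> carrier Qmod" "wv e e' \<noteq> \<zero>\<^bsub>Qmod\<^esub>"
    "\<b> - \<kappa> e \<in> s03_module.ann Qmod (wv e e')" "\<c> - \<kappa> (\<i> * e') \<in> s03_module.ann Qmod (wv e e')"
    "\<d> \<in> s03_module.ann Qmod (wv e e')"
proof -
  interpret Q: s03_module Qmod by (rule s03_module_Qmod)
  note A = Q.left_ideal_ann[OF q0_closed]
  have w: "(e, \<i> * e') \<in> weights" and "e \<noteq> 0" using e by (auto simp: weights_eq)
  show wv: "wv e e' \<in> carrier Qmod" by (simp add: wv_eq[OF e] q0_closed)
  show "wv e e' \<noteq> \<zero>\<^bsub>Qmod\<^esub>"
    using Q.\<kappa>_star_eq_zero[of "\<epsilon> e (\<i> * e') \<star>\<^bsub>Qmod\<^esub> q0" "4 * e"] \<epsilon>_notin_ann(2)[OF w] \<open>e \<noteq> 0\<close>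
    by (auto simp: wv_eq[OF e] Q.star_mult q0_closed Q.mem_ann_iff simp del: mult_eq_0_iff)
  have d: "\<d> \<in> Q.ann q0" using d_Qmod[OF q0_closed] by (simp add: Q.mem_ann_iff)
  have "(\<b> - \<kappa> e) * (\<kappa> (4 * e) * \<epsilon> e (\<i> * e')) = \<kappa> (4 * e) * ((\<b> - \<kappa> e) * \<epsilon> e (\<i> * e'))"
    "(\<c> - \<kappa> (\<i> * e')) * (\<kappa> (4 * e) * \<epsilon> e (\<i> * e')) = \<kappa> (4 * e) * ((\<c> - \<kappa> (\<i> * e')) * \<epsilon> e (\<i> * e'))"
    by (simp_all flip: mult.assoc add: \<kappa>_central[of "\<b> - \<kappa> e"] \<kappa>_central[of "\<c> - \<kappa> (\<i> * e')"])
  then show "\<b> - \<kappa> e \<in> Q.ann (wv e e')" "\<c> - \<kappa> (\<i> * e') \<in> Q.ann (wv e e')"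
    unfolding wv_eq[OF e] Q.mem_ann_star[OF q0_closed]
    using left_ideal_mult[OF A] \<epsilon>_eigen[OF A d w] by (simp_all only:)
  show "\<d> \<in> Q.ann (wv e e')" using d_Qmod[OF wv] by (simp add: Q.mem_ann_iff)
qed

lemma Wmod_module:
  assumes e: "e \<in> {1, -1}" "e' \<in> {1, -1}"
  shows "irreducible_module S03 (Wmod e e')" "has_label (Wmod e e') (Some (e, \<i> * e'))"
    "is_basis (Wmod e e') [wv e e']"
  unfolding Wmod_def
  by (rule s03_module.line_module[OF s03_module_Qmod wv_eigen(1,3-5)[OF e] wv_eigen(2)[OF e]])+

text \<open>Evaluated at (\<beta>, \<gamma>) with \<beta>^2 = 1, the polynomial is (1 + \<beta>'
  \<beta>) (1 - \<gamma>' \<gamma>) / 4, and on the nonzero weights this is the Kronecker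
  delta.\<close>

lemma \<epsilon>_congruent:
  assumes A: "left_ideal A" and eigen: "\<b> - \<kappa> \<beta> \<in> A" "\<c> - \<kappa> \<gamma> \<in> A"
    and w: "(\<beta>, \<gamma>) \<in> weights" "(\<beta>', \<gamma>') \<in> weights" "\<beta> \<noteq> 0" "\<beta>' \<noteq> 0"
  shows "\<epsilon> \<beta>' \<gamma>' - \<kappa> (if (\<beta>', \<gamma>') = (\<beta>, \<gamma>) then 1 else 0) \<in> A"
proof -
  have "(if (\<beta>', \<gamma>') = (\<beta>, \<gamma>) then 1 else 0)
      = 1/4 * (\<beta> * \<beta> + \<beta>' * \<beta> - \<gamma>' * \<gamma> - \<beta>' * \<gamma>' * (\<beta> * \<gamma>))"
    using w by (auto simp: weights_eq complex_eq_iff)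
  \<comment> \<open>Division with remainder: c is replaced by \<gamma> and b by \<beta>, always at
    the right end of a word, and the two left factors collect the quotients.\<close>
  moreover have "\<b> * \<b> + \<kappa> \<beta>' * \<b> - \<kappa> \<gamma>' * \<c> - \<kappa> (\<beta>' * \<gamma>') * (\<b> * \<c>)
      - (\<kappa> (\<beta> * \<beta>) + \<kappa> (\<beta>' * \<beta>) - \<kappa> (\<gamma>' * \<gamma>) - \<kappa> (\<beta>' * \<gamma>' * (\<beta> * \<gamma>)))
      = (\<b> + \<kappa> \<beta> + \<kappa> \<beta>' - \<kappa> (\<beta>' * \<gamma>') * \<kappa> \<gamma>) * (\<b> - \<kappa> \<beta>)
          - (\<kappa> \<gamma>' + \<kappa> (\<beta>' * \<gamma>') * \<b>) * (\<c> - \<kappa> \<gamma>)"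
    by (simp add: s03_nf mult_ac)
  then have "\<epsilon> \<beta>' \<gamma>' - \<kappa> (1/4 * (\<beta> * \<beta> + \<beta>' * \<beta> - \<gamma>' * \<gamma> - \<beta>' * \<gamma>' * (\<beta> * \<gamma>)))
      = \<kappa> (1/4) * ((\<b> + \<kappa> \<beta> + \<kappa> \<beta>' - \<kappa> (\<beta>' * \<gamma>') * \<kappa> \<gamma>) * (\<b> - \<kappa> \<beta>)
          - (\<kappa> \<gamma>' + \<kappa> (\<beta>' * \<gamma>') * \<b>) * (\<c> - \<kappa> \<gamma>))"
    using w(4) unfolding \<kappa>_mult[of "1/4"] \<kappa>_add \<kappa>_diff \<epsilon>_def
    by (simp only: if_False right_diff_distrib[symmetric])
  ultimately show ?thesis
    using eigen by (simp only: left_ideal_diff[OF A] left_ideal_mult[OF A])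
qed

lemma line_wv_subset:
  assumes e: "e \<in> {1, -1}" "e' \<in> {1, -1}"
  shows "submodule (line Qmod (wv e e')) S03 Qmod" "line Qmod (wv e e') \<subseteq> carrier Qmod"
proof -
  interpret Q: s03_module Qmod by (rule s03_module_Qmod)
  show sub: "submodule (line Qmod (wv e e')) S03 Qmod"
    by (rule Q.submodule_line[OF wv_eigen(1,3-5)[OF e]])
  interpret submodule "line Qmod (wv e e')" S03 Qmod by (rule sub)
  show "line Qmod (wv e e') \<subseteq> carrier Qmod" using subset by simp
qed

lemma projection_line:
  assumes e: "e \<in> {1, -1}" "e' \<in> {1, -1}" and f: "f \<in> {1, -1}" "f' \<in> {1, -1}"
    and u: "u \<in> line Qmod (wv e e')"
  shows "\<epsilon> f (\<i> * f') \<star>\<^bsub>Qmod\<^esub> u = (if (f, f') = (e, e') then u else \<zero>\<^bsub>Qmod\<^esub>)"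
proof -
  interpret Q: s03_module Qmod by (rule s03_module_Qmod)
  have u': "u \<in> carrier Qmod" using u line_wv_subset(2)[OF e] by blast
  have "\<b> \<star>\<^bsub>Qmod\<^esub> u = \<kappa> e \<star>\<^bsub>Qmod\<^esub> u" "\<c> \<star>\<^bsub>Qmod\<^esub> u = \<kappa> (\<i> * e') \<star>\<^bsub>Qmod\<^esub> u"
    using Wmod_module(2)[OF e] u by (simp_all add: has_label_def Wmod_def)
  then have eigen: "\<b> - \<kappa> e \<in> Q.ann u" "\<c> - \<kappa> (\<i> * e') \<in> Q.ann u"
    using u' by (simp_all add: Q.diff_mem_ann_iff)
  have "\<epsilon> f (\<i> * f') - \<kappa> (if (f, \<i> * f') = (e, \<i> * e') then 1 else 0) \<in> Q.ann u"
    by (rule \<epsilon>_congruent[OF Q.left_ideal_ann[OF u'] eigen]) (use e f in \<open>auto simp: weights_eq\<close>)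
  then show ?thesis
    using u' by (auto simp: Q.diff_mem_ann_iff Q.star_one Q.star_zero)
qed

text \<open>The sum is 1 minus the idempotent of the trivial character. On q0 it acts as the
  identity, since b^2 - 1 annihilates q0.\<close>

lemma sum_projections: "(\<Sum>(e, e')\<in>{1, -1} \<times> {1, -1}. \<epsilon> e (\<i> * e')) = \<b> * \<b>"
proof -
  have I: "{1, -1} \<times> {1, -1} = {(1, 1), (1, -1), (-1, 1), (-1, -1 :: complex)}"
    by auto
  have "(\<Sum>(e, e')\<in>{1, -1} \<times> {1, -1}. \<epsilon> e (\<i> * e')) + \<epsilon> 0 0 = 1"
    using sum_\<epsilon> unfolding I weights_eq by (simp add: complex_eq_iff add_ac)
  then have "(\<Sum>(e, e')\<in>{1, -1} \<times> {1, -1}. \<epsilon> e (\<i> * e')) = 1 - \<epsilon> 0 0"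
    by (simp only: eq_diff_eq)
  then show ?thesis by (simp only: \<epsilon>_def) simp
qed

lemma projection_mem_line:
  assumes e: "e \<in> {1, -1}" "e' \<in> {1, -1}"
  shows "\<epsilon> e (\<i> * e') \<star>\<^bsub>Qmod\<^esub> q0 \<in> line Qmod (wv e e')"
proof -
  interpret Q: s03_module Qmod by (rule s03_module_Qmod)
  have "\<kappa> (e / 4) * \<kappa> (4 * e) = 1"
    using e by (auto simp flip: \<kappa>_mult)
  then have "\<epsilon> e (\<i> * e') = \<kappa> (e / 4) * (\<kappa> (4 * e) * \<epsilon> e (\<i> * e'))"
    by (simp flip: mult.assoc)
  then have "\<epsilon> e (\<i> * e') \<star>\<^bsub>Qmod\<^esub> q0 = \<kappa> (e / 4) \<star>\<^bsub>Qmod\<^esub> wv e e'"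
    unfolding wv_eq[OF e] using Q.star_mult[OF q0_closed] by metis
  then show ?thesis by (auto simp: line_def elt_generators)
qed

text \<open>Applying the idempotents to q0 decomposes the generator and hence every vector x q0.
  Uniqueness holds because each idempotent is the identity on its own line and zero on the other
  three.\<close>

lemma Qmod_direct_sum:
  "internal_direct_sum S03 Qmod ({1, -1} \<times> {1, -1}) (\<lambda>(e, e'). line Qmod (wv e e'))"
proof -
  interpret Q: s03_module Qmod by (rule s03_module_Qmod)
  define I :: "(complex \<times> complex) set" where "I = {1, -1} \<times> {1, -1}"
  define L where "L = (\<lambda>(e, e'). line Qmod (wv e e'))"
  define P where "P = (\<lambda>(e, e'). \<epsilon> e (\<i> * e'))"
  have I: "finite I" by (simp add: I_def)
  have sum_P: "sum P I = \<b> * \<b>" unfolding P_def I_def by (rule sum_projections)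
  have i: "fst i \<in> {1, -1}" "snd i \<in> {1, -1}" if "i \<in> I" for i
    using that by (auto simp: I_def)
  have sub: "submodule (L i) S03 Qmod" and L_closed: "L i \<subseteq> carrier Qmod"
    and P_mem: "P i \<star>\<^bsub>Qmod\<^esub> q0 \<in> L i" if "i \<in> I" for i
    using line_wv_subset[OF i[OF that]] projection_mem_line[OF i[OF that]]
    by (simp_all add: L_def P_def split_beta)
  have P: "P j \<star>\<^bsub>Qmod\<^esub> u = (if i = j then u else \<zero>\<^bsub>Qmod\<^esub>)" if "i \<in> I" "j \<in> I" "u \<in> L i" for i j u
    using projection_line[OF i[OF that(1)] i[OF that(2)], of u] that(3)
    by (cases i; cases j) (auto simp: L_def P_def)
  have component: "P j \<star>\<^bsub>Qmod\<^esub> (\<Oplus>\<^bsub>Qmod\<^esub>i\<in>I. s i) = s j" if s: "s \<in> (\<Pi>\<^sub>E i\<in>I. L i)" and j: "j \<in> I" for s j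
  proof -
    have sL: "s i \<in> L i" if "i \<in> I" for i using s that by (auto simp: PiE_def)
    then have s_closed: "s i \<in> carrier Qmod" if "i \<in> I" for i using L_closed that by blast
    have "P j \<star>\<^bsub>Qmod\<^esub> (\<Oplus>\<^bsub>Qmod\<^esub>i\<in>I. s i) = (\<Oplus>\<^bsub>Qmod\<^esub>i\<in>I. P j \<star>\<^bsub>Qmod\<^esub> s i)"
      by (rule Q.star_finsum[OF I s_closed])
    also have "\<dots> = (\<Oplus>\<^bsub>Qmod\<^esub>i\<in>I. if i = j then s i else \<zero>\<^bsub>Qmod\<^esub>)"
      using P sL j s_closed by (intro Q.M.finsum_cong') auto
    also have "\<dots> = s j"
      using s_closed by (intro Q.M.add.finprod_singleton_swap[OF j I]) auto
    finally show ?thesis .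
  qed
  have unique: "\<exists>!s. s \<in> (\<Pi>\<^sub>E i\<in>I. L i) \<and> m = (\<Oplus>\<^bsub>Qmod\<^esub>i\<in>I. s i)" if m: "m \<in> carrier Qmod" for m
  proof (rule ex_ex1I)
    obtain x where x: "m = x \<star>\<^bsub>Qmod\<^esub> q0" using m by (rule Q.cyclicE[OF carrier_Qmod])
    \<comment> \<open>The idempotent acts on the generator before x does, so the component lies in
      its line because the line is a submodule.\<close>
    let ?s = "\<lambda>i\<in>I. (x * P i) \<star>\<^bsub>Qmod\<^esub> q0"
    have "(x * P i) \<star>\<^bsub>Qmod\<^esub> q0 \<in> L i" if "i \<in> I" for i
      using submodule.smult_closed[OF sub[OF that] elt_closed P_mem[OF that]]
      by (simp add: Q.star_mult q0_closed)
    then have "?s \<in> (\<Pi>\<^sub>E i\<in>I. L i)" by auto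
    moreover have "(\<Oplus>\<^bsub>Qmod\<^esub>i\<in>I. ?s i) = (\<Oplus>\<^bsub>Qmod\<^esub>i\<in>I. (x * P i) \<star>\<^bsub>Qmod\<^esub> q0)"
      by (rule Q.M.finsum_cong') (auto simp: q0_closed)
    moreover have "\<dots> = (x * (\<b> * \<b>)) \<star>\<^bsub>Qmod\<^esub> q0"
      unfolding Q.finsum_star[OF I q0_closed] sum_P[symmetric] by (simp only: sum_distrib_left)
    moreover have "(x * (\<b> * \<b>)) \<star>\<^bsub>Qmod\<^esub> q0 = m"
      using bb_q0 by (simp add: x Q.diff_mem_ann_iff Q.star_mult Q.star_one q0_closed)
    ultimately show "\<exists>s. s \<in> (\<Pi>\<^sub>E i\<in>I. L i) \<and> m = (\<Oplus>\<^bsub>Qmod\<^esub>i\<in>I. s i)"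
      by (intro exI[of _ ?s] conjI) (simp_all only:)
  next
    fix s s' assume "s \<in> (\<Pi>\<^sub>E i\<in>I. L i) \<and> m = (\<Oplus>\<^bsub>Qmod\<^esub>i\<in>I. s i)"
      "s' \<in> (\<Pi>\<^sub>E i\<in>I. L i) \<and> m = (\<Oplus>\<^bsub>Qmod\<^esub>i\<in>I. s' i)"
    then have s: "s \<in> (\<Pi>\<^sub>E i\<in>I. L i)" "s' \<in> (\<Pi>\<^sub>E i\<in>I. L i)"
      and eq: "(\<Oplus>\<^bsub>Qmod\<^esub>i\<in>I. s i) = (\<Oplus>\<^bsub>Qmod\<^esub>i\<in>I. s' i)" by auto
    have "s j = s' j" if "j \<in> I" for j
      using component[OF s(1) that] component[OF s(2) that] unfolding eq by (rule trans[OF sym])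
    then show "s = s'" by (rule PiE_ext[OF s])
  qed
  show ?thesis
    unfolding internal_direct_sum_def I_def[symmetric] L_def[symmetric]
    by (intro conjI ballI I sub unique)
qed

section \<open>Irreducible subquotients\<close>

text \<open>The model is the action stated in the theorem for \<lambda> = 1, in the coordinates v0,
  B v0. There d - 1 kills (1, 0), so 1 is no left multiple of d - 1. This makes the two-dimensional
  class actually occur.\<close>

lemma V_1_nonzero: "v0 1 \<noteq> \<zero>\<^bsub>Vmod 1\<^esub>"
proof -
  interpret V: s03_module "Vmod 1" by (rule s03_module_Vmod)
  let ?f = "\<lambda>g v. case g of GB \<Rightarrow> (case v of (x, y) \<Rightarrow> (y, x))
    | GC \<Rightarrow> (case v of (x, y) \<Rightarrow> (y, - x)) | GD \<Rightarrow> (case v of (x, y) \<Rightarrow> (x, - y))"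
  interpret s03_model "\<lambda>k (x, y). (k * x, k * y)" ?f
    by unfold_locales (auto simp: algebra_simps plus_prod_def zero_prod_def split: gen.splits)
  have False if "1 = p * (\<d> - \<kappa> 1)" for p
  proof -
    have "rep 1 (1, 0) = rep p (rep (\<d> - \<kappa> 1) (1, 0))"
      by (subst that) (simp only: rep_mult)
    also have "\<dots> = 0"
      by (simp only: rep_diff rep_generators) (simp add: rep_zero_right minus_prod_def flip: zero_prod_def)
    finally show False using rep_generators(1)[of 1 "(1, 0)"] by (simp add: zero_prod_def)
  qed
  then have "1 \<notin> V.ann (v0 1)" unfolding ann_v0 by blast
  then show ?thesis by (simp add: V.one_mem_ann_iff v0_closed)
qed

text \<open>Members of \<open>irreps\<close> are quotients by construction, so an irreducible
  submodule of V_l enters through its quotient by zero.\<close>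

lemma quot_zero_module:
  assumes M: "irreducible_module S03 M" and t: "has_label M t"
  shows "irreducible_module S03 (quot_module M {\<zero>\<^bsub>M\<^esub>})" "has_label (quot_module M {\<zero>\<^bsub>M\<^esub>}) t"
proof -
  let ?Q = "quot_module M {\<zero>\<^bsub>M\<^esub>}"
  interpret M: s03_module M using M by (simp add: irreducible_module_def s03_module_def)
  interpret quotient_module S03 M "{\<zero>\<^bsub>M\<^esub>}"
    by (rule quotient_moduleI[OF M.s03_module_axioms M.submodule_zero])
  interpret Q: s03_module ?Q by (rule quot_s03_module[OF M.s03_module_axioms M.submodule_zero])
  obtain y where y: "y \<in> carrier M" "y \<noteq> \<zero>\<^bsub>M\<^esub>" using M by (rule M.irreducible_nonzero)
  let ?z = "{\<zero>\<^bsub>M\<^esub>} +>\<^bsub>M\<^esub> y"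
  have z: "?z \<in> carrier ?Q" using y by (rule_tac coset_closed)
  have cyc: "carrier M = M.cyclic y" by (rule M.irreducible_cyclic[OF M y])
  have star_z: "x \<star>\<^bsub>?Q\<^esub> ?z = {\<zero>\<^bsub>M\<^esub>} +>\<^bsub>M\<^esub> (x \<star>\<^bsub>M\<^esub> y)" for x
    by (rule smult_quot[OF elt_closed y(1)])
  have cyc': "carrier ?Q = Q.cyclic ?z"
    unfolding carrier_quot cyc M.cyclic_def Q.cyclic_def star_z by (simp add: image_image)
  have "x \<in> M.ann y \<longleftrightarrow> x \<in> Q.ann ?z" for x
    unfolding M.mem_ann_iff Q.mem_ann_iff star_z using y coset_eq_zero_iff[of "x \<star>\<^bsub>M\<^esub> y"] by simp
  then have ann: "M.ann y = Q.ann ?z" by blast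
  have "module_iso S03 M ?Q"
    by (rule module_iso_cyclic[OF M.s03_module_axioms Q.s03_module_axioms y(1) cyc z cyc' ann])
  then show "has_label ?Q t"
    by (rule has_label_module_iso[OF M.s03_module_axioms Q.s03_module_axioms _ t])
  \<comment> \<open>The converse of \<open>irreducible_cyclicI\<close>: the nonzero vector x y
    generates M, so some x' carries it back to y. The conclusion concerns only the annihilator,
    which the quotient shares.\<close>
  have "\<exists>x'. x' * x - 1 \<in> M.ann y" if x: "x \<notin> M.ann y" for x
  proof -
    have "y \<in> M.cyclic (x \<star>\<^bsub>M\<^esub> y)"
      using M.irreducible_cyclic[OF M, of "x \<star>\<^bsub>M\<^esub> y"] x y by (simp add: M.mem_ann_iff)
    then obtain x' where "y = x' \<star>\<^bsub>M\<^esub> (x \<star>\<^bsub>M\<^esub> y)"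
      unfolding M.cyclic_def by blast
    from this[symmetric] have "x' * x - 1 \<in> M.ann y" using y by (simp add: M.diff_mem_ann_iff M.star_one M.star_mult)
    then show ?thesis by blast
  qed
  moreover have "?z \<noteq> \<zero>\<^bsub>?Q\<^esub>" using y by (simp add: coset_eq_zero_iff)
  ultimately show "irreducible_module S03 ?Q"
    using z cyc' unfolding ann by (intro Q.irreducible_cyclicI) auto
qed

text \<open>A subquotient inherits the identities of V_l: d = 0 for l = 0, and b^2 = d^2 = 1 for l
  \<noteq> 0. In the first case irreducibility then singles out a weight.\<close>

lemma irreps_D:
  assumes "M \<in> irreps"
  shows "irreducible_module S03 M" "s03_module M" "\<exists>t\<in>labels. has_label M t"
proof -
  obtain l N U where M: "M = quot_module (Vmod l\<lparr>carrier := N\<rparr>) U"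
    and N: "submodule N S03 (Vmod l)" and U: "submodule U S03 (Vmod l\<lparr>carrier := N\<rparr>)"
    and irr: "irreducible_module S03 M"
    using assms unfolding irreps_def by blast
  show "irreducible_module S03 M" by (rule irr)
  then show "s03_module M" by (simp add: irreducible_module_def s03_module_def)
  interpret M: s03_module M by fact
  interpret V: s03_module "Vmod l" by (rule s03_module_Vmod)
  interpret N: submodule N S03 "Vmod l" by (rule N)
  have zero: "x \<star>\<^bsub>M\<^esub> m = \<zero>\<^bsub>M\<^esub>"
    if x: "\<And>m. m \<in> carrier (Vmod l) \<Longrightarrow> x \<star>\<^bsub>Vmod l\<^esub> m = \<zero>\<^bsub>Vmod l\<^esub>" and m: "m \<in> carrier M" for x m
    unfolding M
  proof (rule quot_star_eq_zero[OF V.submodule_s03_module[OF N] U])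
    show "m \<in> carrier (quot_module (Vmod l\<lparr>carrier := N\<rparr>) U)" using m by (simp only: M)
    fix n assume "n \<in> carrier (Vmod l\<lparr>carrier := N\<rparr>)"
    then have "n \<in> carrier (Vmod l)" using N.subset by auto
    then show "x \<star>\<^bsub>Vmod l\<lparr>carrier := N\<rparr>\<^esub> n = \<zero>\<^bsub>Vmod l\<lparr>carrier := N\<rparr>\<^esub>"
      by (simp add: x)
  qed
  obtain y where y: "y \<in> carrier M" "y \<noteq> \<zero>\<^bsub>M\<^esub>" using irr by (rule M.irreducible_nonzero)
  show "\<exists>t\<in>labels. has_label M t"
  proof (cases "l = 0")
    case True
    have "\<d> \<star>\<^bsub>M\<^esub> m = \<zero>\<^bsub>M\<^esub>" if "m \<in> carrier M" for m
      by (rule zero[OF _ that]) (simp only: True d_Vmod_0)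
    from M.irreducible_has_weight[OF irr this] show ?thesis unfolding labels_def by blast
  next
    case False
    \<comment> \<open>If V_l were zero, 1 would act by zero on it and therefore also on the nonzero
      subquotient M.\<close>
    have "carrier (Vmod l) \<noteq> {\<zero>\<^bsub>Vmod l\<^esub>}"
    proof
      assume "carrier (Vmod l) = {\<zero>\<^bsub>Vmod l\<^esub>}"
      then have "1 \<star>\<^bsub>M\<^esub> y = \<zero>\<^bsub>M\<^esub>" using y by (intro zero) (auto simp: V.star_one)
      then show False using y by (simp add: M.star_one)
    qed
    then have v: "v0 l \<noteq> \<zero>\<^bsub>Vmod l\<^esub>" using Vmod_nonzero_iff by blast
    have "has_label (Vmod l) None" by (rule Vmod_pair(2)[OF Vmod_eigenvalue_square[OF False v] v])
    then have V: "(\<b> * \<b> - 1) \<star>\<^bsub>Vmod l\<^esub> m = \<zero>\<^bsub>Vmod l\<^esub>" "(\<d> * \<d> - 1) \<star>\<^bsub>Vmod l\<^esub> m = \<zero>\<^bsub>Vmod l\<^esub>"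
      if "m \<in> carrier (Vmod l)" for m
      unfolding V.star_eq_iff[OF that, symmetric] V.star_one[OF that]
      using that by (simp_all add: has_label_def)
    have "(\<b> * \<b>) \<star>\<^bsub>M\<^esub> m = m" "(\<d> * \<d>) \<star>\<^bsub>M\<^esub> m = m" if "m \<in> carrier M" for m
      using zero[OF V(1) that] zero[OF V(2) that] M.star_eq_iff[OF that, of _ 1] M.star_one[OF that]
      by simp_all
    then have "has_label M None" by (simp add: has_label_def)
    then show ?thesis by (auto simp: labels_def)
  qed
qed

lemma irreps_I:
  assumes "submodule N S03 (Vmod l)" "irreducible_module S03 (Vmod l\<lparr>carrier := N\<rparr>)"
    "has_label (Vmod l\<lparr>carrier := N\<rparr>) t"
  shows "\<exists>M\<in>irreps. has_label M t"
proof -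
  have "left_module S03 (Vmod l\<lparr>carrier := N\<rparr>)"
    using assms(2) by (simp add: irreducible_module_def)
  from left_module.submodule_zero[OF this] show ?thesis
    using quot_zero_module[OF assms(2,3)] assms(1) unfolding irreps_def by blast
qed

text \<open>All one-dimensional representations already occur as submodules of V_0, as lines through
  the images of v0 under the idempotents. The two-dimensional one is V_1 itself.\<close>

lemma irreps_exists:
  assumes "t \<in> labels"
  shows "\<exists>M\<in>irreps. has_label M t"
proof (cases t)
  case None
  interpret V: s03_module "Vmod 1" by (rule s03_module_Vmod)
  have "Vmod 1\<lparr>carrier := carrier (Vmod 1)\<rparr> = Vmod 1" by simp
  then show ?thesis
    using irreps_I[of "carrier (Vmod 1)" 1 t] V.submodule_carrier Vmod_pair[of 1] V_1_nonzero None by simp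
next
  case (Some w)
  obtain \<beta> \<gamma> where w: "w = (\<beta>, \<gamma>)" by (cases w)
  then have w': "(\<beta>, \<gamma>) \<in> weights" using assms Some by (auto simp: labels_def)
  interpret V: s03_module "Vmod 0" by (rule s03_module_Vmod)
  let ?y = "\<epsilon> \<beta> \<gamma> \<star>\<^bsub>Vmod 0\<^esub> v0 0"
  have y: "?y \<in> carrier (Vmod 0)" by (simp add: v0_closed)
  have "\<d> \<in> V.ann (v0 0)" "\<d> \<in> V.ann ?y" using d_Vmod_0 y v0_closed by (simp_all add: V.mem_ann_iff)
  moreover have "\<b> - \<kappa> \<beta> \<in> V.ann ?y" "\<c> - \<kappa> \<gamma> \<in> V.ann ?y"
    using \<epsilon>_eigen[OF V.left_ideal_ann[OF v0_closed] _ w'] \<open>\<d> \<in> V.ann (v0 0)\<close>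
    by (simp_all add: V.mem_ann_star v0_closed)
  ultimately have eigen: "\<b> - \<kappa> \<beta> \<in> V.ann ?y" "\<c> - \<kappa> \<gamma> \<in> V.ann ?y" "\<d> \<in> V.ann ?y" by blast+
  have "?y \<noteq> \<zero>\<^bsub>Vmod 0\<^esub>" using \<epsilon>_notin_ann(1)[OF w'] by (simp add: V.mem_ann_iff)
  from V.line_module[OF y eigen this] V.submodule_line[OF y eigen] show ?thesis
    unfolding Some w by (intro irreps_I)
qed

section \<open>Isomorphism classes and their labels\<close>

definition label_class :: "(complex \<times> complex) option \<Rightarrow> (s03_elem, s03_elem set set) module set" where
  "label_class t = {M \<in> irreps. has_label M t}"

lemma label_class_nonempty: "t \<in> labels \<Longrightarrow> label_class t \<noteq> {}"
  using irreps_exists by (auto simp: label_class_def)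

lemma irreps_label_unique:
  assumes "M \<in> irreps" "has_label M t" "has_label M t'"
  shows "t = t'"
proof -
  interpret s03_module M using assms(1) by (rule irreps_D)
  obtain y where "y \<in> carrier M" "y \<noteq> \<zero>\<^bsub>M\<^esub>" using irreps_D(1)[OF assms(1)] by (rule irreducible_nonzero)
  then show ?thesis using assms(2,3) by (rule has_label_unique)
qed

lemma irreps_iso_iff:
  assumes "M \<in> irreps" "N \<in> irreps" "has_label M t"
  shows "module_iso S03 M N \<longleftrightarrow> has_label N t"
  using has_label_module_iso[OF irreps_D(2)[OF assms(1)] irreps_D(2)[OF assms(2)] _ assms(3)]
    irreducible_module_iso[OF irreps_D(1)[OF assms(1)] irreps_D(1)[OF assms(2)] assms(3)] by blast

text \<open>The label is a complete isomorphism invariant on \<open>irreps\<close>, and each of the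
  six labels is attained.\<close>

lemma irrep_classes_eq: "irrep_classes = label_class ` labels"
proof -
  let ?R = "{(M, M'). M \<in> irreps \<and> M' \<in> irreps \<and> module_iso S03 M M'}"
  have R: "?R `` {M} = label_class t" if "M \<in> irreps" "has_label M t" for M t
    using that irreps_iso_iff by (auto simp: label_class_def)
  show ?thesis
  proof
    show "irrep_classes \<subseteq> label_class ` labels"
      unfolding irrep_classes_def quotient_def using R irreps_D(3) by fastforce
    show "label_class ` labels \<subseteq> irrep_classes"
      unfolding irrep_classes_def quotient_def using R irreps_exists by fastforce
  qed
qed

lemma inj_on_label_class: "inj_on label_class labels"
proof (rule inj_onI)
  fix t t' assume "t \<in> labels" "label_class t = label_class t'"
  then show "t = t'"
    using label_class_nonempty[of t] irreps_label_unique by (auto simp: label_class_def)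
qed

text \<open>Classes correspond bijectively to labels, so counting classes with a property becomes
  counting labels.\<close>

lemma card_classes_where:
  assumes "\<And>t. t \<in> labels \<Longrightarrow> (\<forall>M\<in>label_class t. P M) \<longleftrightarrow> t \<in> T" "T \<subseteq> labels"
  shows "card {Y \<in> irrep_classes. \<forall>M\<in>Y. P M} = card T"
proof -
  have "{Y \<in> irrep_classes. \<forall>M\<in>Y. P M} = label_class ` T"
    unfolding irrep_classes_eq using assms by auto
  then show ?thesis
    using card_image[OF inj_on_subset[OF inj_on_label_class assms(2)]] by simp
qed

lemma irreps_has_dim:
  assumes M: "M \<in> irreps" "has_label M t"
  shows "has_dim M (if t = None then 2 else 1)"
proof -
  interpret s03_module M using M(1) by (rule irreps_D)
  note irr = irreps_D(1)[OF M(1)]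
  obtain y where y: "y \<in> carrier M" "y \<noteq> \<zero>\<^bsub>M\<^esub>" using irr by (rule irreducible_nonzero)
  show ?thesis
  proof (cases t)
    case None
    obtain z where z: "z \<in> carrier M" "z \<noteq> \<zero>\<^bsub>M\<^esub>" "\<d> - \<kappa> 1 \<in> ann z"
      using M(2) y unfolding None by (rule has_label_None_eigenvector)
    have "is_basis M [z, \<b> \<star>\<^bsub>M\<^esub> z]"
      by (rule pair_basis[OF z(1) irreducible_cyclic[OF irr z(1,2)] _ z(3,2)]) simp
    then show ?thesis unfolding has_dim_def None by (intro exI) auto
  next
    case (Some w)
    obtain \<beta> \<gamma> where w: "w = (\<beta>, \<gamma>)" by (cases w)
    have "\<d> \<in> ann y" using M(2) y by (simp add: Some w has_label_def mem_ann_iff)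
    moreover have "\<b> - \<kappa> \<beta> \<in> ann y" "\<c> - \<kappa> \<gamma> \<in> ann y"
      using M(2) y by (simp_all add: Some w has_label_def diff_mem_ann_iff)
    ultimately have "is_basis M [y]"
      using eigen_basis[OF y(1) irreducible_cyclic[OF irr y]] y(2) by blast
    then show ?thesis unfolding has_dim_def Some by (intro exI[of _ "[y]"]) auto
  qed
qed

lemma power2_has_label:
  assumes M: "M \<in> irreps" "has_label M t" "t \<in> labels" and m: "m \<in> carrier M"
  shows "(tB [^]\<^bsub>S03\<^esub> (2::nat)) \<odot>\<^bsub>M\<^esub> m = (if t = Some (0, 0) then \<zero>\<^bsub>M\<^esub> else m)"
    "(tD [^]\<^bsub>S03\<^esub> (2::nat)) \<odot>\<^bsub>M\<^esub> m = (if t = None then m else \<zero>\<^bsub>M\<^esub>)"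
proof -
  interpret s03_module M using M(1) by (rule irreps_D)
  have eq: "tB [^]\<^bsub>S03\<^esub> (2::nat) = elt (\<b> * \<b>)" "tD [^]\<^bsub>S03\<^esub> (2::nat) = elt (\<d> * \<d>)"
    by (simp_all add: power2_eq_square flip: elt_generators elt_power)
  have "(\<b> * \<b>) \<star>\<^bsub>M\<^esub> m = (if t = Some (0, 0) then \<zero>\<^bsub>M\<^esub> else m)
      \<and> (\<d> * \<d>) \<star>\<^bsub>M\<^esub> m = (if t = None then m else \<zero>\<^bsub>M\<^esub>)"
  proof (cases t)
    case None
    then show ?thesis using M(2) m by (simp add: has_label_def)
  next
    case (Some w)
    obtain \<beta> \<gamma> where w: "w = (\<beta>, \<gamma>)" by (cases w)
    have h: "\<b> \<star>\<^bsub>M\<^esub> n = \<kappa> \<beta> \<star>\<^bsub>M\<^esub> n" "\<d> \<star>\<^bsub>M\<^esub> n = \<zero>\<^bsub>M\<^esub>" if "n \<in> carrier M" for n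
      using M(2) that by (simp_all add: Some w has_label_def)
    have "(\<b> * \<b>) \<star>\<^bsub>M\<^esub> m = \<kappa> (\<beta> * \<beta>) \<star>\<^bsub>M\<^esub> m"
      using m by (simp add: star_mult h \<kappa>_mult)
    moreover have "(\<d> * \<d>) \<star>\<^bsub>M\<^esub> m = \<zero>\<^bsub>M\<^esub>"
      using m by (simp add: star_mult h star_zero_right)
    moreover have "(\<beta>, \<gamma>) \<in> weights" using M(3) by (auto simp: labels_def Some w)
    then have "\<kappa> (\<beta> * \<beta>) = (if w = (0, 0) then 0 else 1)" by (auto simp: weights_eq w)
    ultimately show ?thesis using m by (simp add: Some star_zero star_one)
  qed
  then show "(tB [^]\<^bsub>S03\<^esub> (2::nat)) \<odot>\<^bsub>M\<^esub> m = (if t = Some (0, 0) then \<zero>\<^bsub>M\<^esub> else m)"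
    "(tD [^]\<^bsub>S03\<^esub> (2::nat)) \<odot>\<^bsub>M\<^esub> m = (if t = None then m else \<zero>\<^bsub>M\<^esub>)"
    unfolding eq by blast+
qed

text \<open>A statement about all members of a class and all their vectors could hold vacuously; a
  member with a nonzero vector makes it informative about the label.\<close>

lemma label_class_representative:
  assumes "t \<in> labels"
  obtains M m where "M \<in> label_class t" "M \<in> irreps" "has_label M t" "m \<in> carrier M" "m \<noteq> \<zero>\<^bsub>M\<^esub>"
proof -
  obtain M where M: "M \<in> label_class t" using label_class_nonempty[OF assms] by blast
  then have M': "M \<in> irreps" "has_label M t" by (simp_all add: label_class_def)
  interpret s03_module M using M'(1) by (rule irreps_D)
  obtain m where "m \<in> carrier M" "m \<noteq> \<zero>\<^bsub>M\<^esub>" using irreps_D(1)[OF M'(1)] by (rule irreducible_nonzero)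
  then show ?thesis using M M' that by blast
qed

lemma card_trivial_classes:
  "card {Y \<in> irrep_classes. \<forall>M\<in>Y. has_dim M 1 \<and> trivial_rep M} = 1"
proof -
  have classes: "(\<forall>M\<in>label_class t. has_dim M 1 \<and> trivial_rep M) \<longleftrightarrow> t \<in> {Some (0, 0)}" if t: "t \<in> labels" for t
  proof
    assume *: "\<forall>M\<in>label_class t. has_dim M 1 \<and> trivial_rep M"
    obtain M m where M: "M \<in> label_class t" "M \<in> irreps" "has_label M t"
      using t by (rule label_class_representative)
    then show "t \<in> {Some (0, 0)}"
      using * irreps_label_unique[OF M(2,3)] trivial_rep_iff[OF irreps_D(2)[OF M(2)]] by blast
  next
    assume "t \<in> {Some (0, 0)}"
    then show "\<forall>M\<in>label_class t. has_dim M 1 \<and> trivial_rep M"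
      using irreps_has_dim irreps_D(2) trivial_rep_iff by (fastforce simp: label_class_def)
  qed
  have "card {Y \<in> irrep_classes. \<forall>M\<in>Y. has_dim M 1 \<and> trivial_rep M} = card {Some (0 :: complex, 0 :: complex)}"
    by (rule card_classes_where[OF classes]) (auto simp: labels_def weights_eq)
  then show ?thesis by simp
qed

lemma card_two_dimensional_classes:
  "card {Y \<in> irrep_classes. \<forall>M\<in>Y. has_dim M 2 \<and>
     (\<forall>x\<in>carrier M. (tB [^]\<^bsub>S03\<^esub> (2::nat)) \<odot>\<^bsub>M\<^esub> x = x \<and> (tD [^]\<^bsub>S03\<^esub> (2::nat)) \<odot>\<^bsub>M\<^esub> x = x)} = 1"
  (is "card {Y \<in> irrep_classes. \<forall>M\<in>Y. ?P M} = 1")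
proof -
  have classes: "(\<forall>M\<in>label_class t. ?P M) \<longleftrightarrow> t \<in> {None}" if t: "t \<in> labels" for t
  proof
    assume *: "\<forall>M\<in>label_class t. ?P M"
    obtain M m where M: "M \<in> label_class t" "M \<in> irreps" "has_label M t" and m: "m \<in> carrier M" "m \<noteq> \<zero>\<^bsub>M\<^esub>"
      using t by (rule label_class_representative)
    then have "(tD [^]\<^bsub>S03\<^esub> (2::nat)) \<odot>\<^bsub>M\<^esub> m = m" using * by blast
    then show "t \<in> {None}"
      using power2_has_label(2)[OF M(2,3) t m(1)] m(2) by (auto split: if_splits)
  next
    assume "t \<in> {None}"
    then show "\<forall>M\<in>label_class t. ?P M"
      using irreps_has_dim[of _ None] power2_has_label[of _ None] t by (auto simp: label_class_def)
  qed
  have "card {Y \<in> irrep_classes. \<forall>M\<in>Y. ?P M} = card {None :: (complex \<times> complex) option}"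
    by (rule card_classes_where[OF classes]) (auto simp: labels_def weights_eq)
  then show ?thesis by simp
qed

lemma card_one_dimensional_classes:
  "card {Y \<in> irrep_classes. \<forall>M\<in>Y. has_dim M 1 \<and>
     (\<forall>x\<in>carrier M. (tB [^]\<^bsub>S03\<^esub> (2::nat)) \<odot>\<^bsub>M\<^esub> x = x \<and> (tD [^]\<^bsub>S03\<^esub> (2::nat)) \<odot>\<^bsub>M\<^esub> x = \<zero>\<^bsub>M\<^esub>)} = 4"
  (is "card {Y \<in> irrep_classes. \<forall>M\<in>Y. ?P M} = 4")
proof -
  \<comment> \<open>The condition D^2 = 0 rules out the two-dimensional label and B^2 = 1 the
    trivial one; four of the six labels remain.\<close>
  let ?T = "labels - {None, Some (0, 0)}"
  have classes: "(\<forall>M\<in>label_class t. ?P M) \<longleftrightarrow> t \<in> ?T" if t: "t \<in> labels" for t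
  proof
    assume *: "\<forall>M\<in>label_class t. ?P M"
    obtain M m where M: "M \<in> label_class t" "M \<in> irreps" "has_label M t" and m: "m \<in> carrier M" "m \<noteq> \<zero>\<^bsub>M\<^esub>"
      using t by (rule label_class_representative)
    then have "(tB [^]\<^bsub>S03\<^esub> (2::nat)) \<odot>\<^bsub>M\<^esub> m = m" "(tD [^]\<^bsub>S03\<^esub> (2::nat)) \<odot>\<^bsub>M\<^esub> m = \<zero>\<^bsub>M\<^esub>"
      using * by blast+
    then show "t \<in> ?T"
      using power2_has_label[OF M(2,3) t m(1)] m(2) t by (auto split: if_splits)
  next
    assume "t \<in> ?T"
    then show "\<forall>M\<in>label_class t. ?P M"
      using irreps_has_dim[of _ t] power2_has_label[of _ t] t by (auto simp: label_class_def)
  qed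
  have "card {Y \<in> irrep_classes. \<forall>M\<in>Y. ?P M} = card ?T"
    by (rule card_classes_where[OF classes]) (auto simp: labels_def weights_eq)
  also have "\<dots> = card labels - card {None, Some (0 :: complex, 0 :: complex)}"
    by (rule card_Diff_subset) (auto simp: labels_def weights_eq)
  finally show ?thesis by (simp add: card_labels)
qed

lemma irreps_classification:
  assumes M: "M \<in> irreps"
  shows "module_iso S03 M Tmod \<or> (\<exists>l\<in>{1, -1}. module_iso S03 M (Vmod l))
    \<or> (\<exists>e\<in>{1, -1}. \<exists>e'\<in>{1, -1}. module_iso S03 M (Wmod e e'))"
proof -
  obtain t where t: "t \<in> labels" "has_label M t" using irreps_D(3)[OF M] by blast
  note iso = irreducible_module_iso[OF irreps_D(1)[OF M] _ t(2)]
  have "t = None \<or> t = Some (0, 0) \<or> (\<exists>e\<in>{1, -1}. \<exists>e'\<in>{1, -1}. t = Some (e, \<i> * e'))"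
    using t(1) by (auto simp: labels_def weights_eq)
  then consider "t = None" | "t = Some (0, 0)"
    | e e' where "e \<in> {1, -1}" "e' \<in> {1, -1}" "t = Some (e, \<i> * e')"
    by blast
  then show ?thesis
  proof cases
    case 1
    then have "module_iso S03 M (Vmod 1)"
      using iso[OF Vmod_pair(1)[of 1]] Vmod_pair(2)[of 1] V_1_nonzero by simp
    then show ?thesis by blast
  next
    case 2
    then have "module_iso S03 M Tmod" using iso[OF Tmod_module(1)] Tmod_module(2) by simp
    then show ?thesis by blast
  next
    case 3
    then have "module_iso S03 M (Wmod e e')"
      using iso[OF Wmod_module(1)[OF 3(1,2)]] Wmod_module(2)[OF 3(1,2)] by simp
    then show ?thesis using 3 by blast
  qed
qed

lemma wv_action:
  assumes e: "e \<in> {1, -1}" "e' \<in> {1, -1}"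
  shows "tB \<odot>\<^bsub>Qmod\<^esub> wv e e' = sc e \<odot>\<^bsub>Qmod\<^esub> wv e e'"
    "tC \<odot>\<^bsub>Qmod\<^esub> wv e e' = sc (\<i> * e') \<odot>\<^bsub>Qmod\<^esub> wv e e'"
    "tD \<odot>\<^bsub>Qmod\<^esub> wv e e' = \<zero>\<^bsub>Qmod\<^esub>"
proof -
  interpret Q: s03_module Qmod by (rule s03_module_Qmod)
  note w = wv_eigen[OF e]
  show "tB \<odot>\<^bsub>Qmod\<^esub> wv e e' = sc e \<odot>\<^bsub>Qmod\<^esub> wv e e'"
    "tC \<odot>\<^bsub>Qmod\<^esub> wv e e' = sc (\<i> * e') \<odot>\<^bsub>Qmod\<^esub> wv e e'"
    using w(3,4) unfolding Q.diff_mem_ann_iff[OF w(1)] elt_generators .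
  show "tD \<odot>\<^bsub>Qmod\<^esub> wv e e' = \<zero>\<^bsub>Qmod\<^esub>"
    using w(5) unfolding Q.mem_ann_iff elt_generators .
qed

theorem mainTheorem5:
  shows
   "(\<forall>l::complex. l \<noteq> 0 \<and> carrier (Vmod l) \<noteq> {\<zero>\<^bsub>Vmod l\<^esub>} \<longrightarrow>
       (let B = (\<lambda>x. tB \<odot>\<^bsub>Vmod l\<^esub> x); C = (\<lambda>x. tC \<odot>\<^bsub>Vmod l\<^esub> x); D = (\<lambda>x. tD \<odot>\<^bsub>Vmod l\<^esub> x);
            scale = (\<lambda>c x. sc c \<odot>\<^bsub>Vmod l\<^esub> x); v = v0 l
        in l^2 = 1
         \<and> (tB [^]\<^bsub>S03\<^esub> (2::nat)) \<odot>\<^bsub>Vmod l\<^esub> v = v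
         \<and> C v = scale (- l) (B v)
         \<and> is_basis (Vmod l) [v, B v]
         \<and> irreducible_module S03 (Vmod l)
         \<and> B (B v) = v
         \<and> C (B v) = scale l v
         \<and> D v = scale l v
         \<and> D (B v) = scale (- l) (B v)
         \<and> (\<forall>x\<in>carrier (Vmod l). (tB [^]\<^bsub>S03\<^esub> (2::nat)) \<odot>\<^bsub>Vmod l\<^esub> x = x
                            \<and> (tD [^]\<^bsub>S03\<^esub> (2::nat)) \<odot>\<^bsub>Vmod l\<^esub> x = x)))
  \<and> (is_basis (Vmod 0)
       [v0 0, tB \<odot>\<^bsub>Vmod 0\<^esub> v0 0, tC \<odot>\<^bsub>Vmod 0\<^esub> v0 0, (tB \<otimes>\<^bsub>S03\<^esub> tC) \<odot>\<^bsub>Vmod 0\<^esub> v0 0,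
        (tB [^]\<^bsub>S03\<^esub> (2::nat)) \<odot>\<^bsub>Vmod 0\<^esub> v0 0]
     \<and> reducible_module S03 (Vmod 0)
     \<and> submodule (line (Vmod 0) w0) S03 (Vmod 0) \<and> is_basis Tmod [w0] \<and> trivial_rep Tmod
     \<and> left_module S03 Qmod
     \<and> internal_direct_sum S03 Qmod ({1, -1} \<times> {1, -1}) (\<lambda>(e, e'). line Qmod (wv e e'))
     \<and> (\<forall>e\<in>{1, -1}. \<forall>e'\<in>{1, -1}.
           is_basis (Wmod e e') [wv e e']
         \<and> tB \<odot>\<^bsub>Qmod\<^esub> wv e e' = sc e \<odot>\<^bsub>Qmod\<^esub> wv e e'
         \<and> tC \<odot>\<^bsub>Qmod\<^esub> wv e e' = sc (\<i> * e') \<odot>\<^bsub>Qmod\<^esub> wv e e'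
         \<and> tD \<odot>\<^bsub>Qmod\<^esub> wv e e' = \<zero>\<^bsub>Qmod\<^esub>))
  \<and> (card irrep_classes = 6
     \<and> card {Y \<in> irrep_classes. \<forall>M\<in>Y. has_dim M 1 \<and> trivial_rep M} = 1
     \<and> card {Y \<in> irrep_classes. \<forall>M\<in>Y. has_dim M 2 \<and>
           (\<forall>x\<in>carrier M. (tB [^]\<^bsub>S03\<^esub> (2::nat)) \<odot>\<^bsub>M\<^esub> x = x
                         \<and> (tD [^]\<^bsub>S03\<^esub> (2::nat)) \<odot>\<^bsub>M\<^esub> x = x)} = 1
     \<and> card {Y \<in> irrep_classes. \<forall>M\<in>Y. has_dim M 1 \<and>
           (\<forall>x\<in>carrier M. (tB [^]\<^bsub>S03\<^esub> (2::nat)) \<odot>\<^bsub>M\<^esub> x = x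
                         \<and> (tD [^]\<^bsub>S03\<^esub> (2::nat)) \<odot>\<^bsub>M\<^esub> x = \<zero>\<^bsub>M\<^esub>)} = 4
     \<and> (\<forall>M\<in>irreps. module_iso S03 M Tmod
                  \<or> (\<exists>l\<in>{1, -1}. module_iso S03 M (Vmod l))
                  \<or> (\<exists>e\<in>{1, -1}. \<exists>e'\<in>{1, -1}. module_iso S03 M (Wmod e e'))))"
proof (intro conjI allI impI ballI)
  fix l :: complex
  assume "l \<noteq> 0 \<and> carrier (Vmod l) \<noteq> {\<zero>\<^bsub>Vmod l\<^esub>}"
  then show "let B = (\<lambda>x. tB \<odot>\<^bsub>Vmod l\<^esub> x); C = (\<lambda>x. tC \<odot>\<^bsub>Vmod l\<^esub> x); D = (\<lambda>x. tD \<odot>\<^bsub>Vmod l\<^esub> x);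
            scale = (\<lambda>c x. sc c \<odot>\<^bsub>Vmod l\<^esub> x); v = v0 l
        in l^2 = 1
         \<and> (tB [^]\<^bsub>S03\<^esub> (2::nat)) \<odot>\<^bsub>Vmod l\<^esub> v = v
         \<and> C v = scale (- l) (B v)
         \<and> is_basis (Vmod l) [v, B v]
         \<and> irreducible_module S03 (Vmod l)
         \<and> B (B v) = v
         \<and> C (B v) = scale l v
         \<and> D v = scale l v
         \<and> D (B v) = scale (- l) (B v)
         \<and> (\<forall>x\<in>carrier (Vmod l). (tB [^]\<^bsub>S03\<^esub> (2::nat)) \<odot>\<^bsub>Vmod l\<^esub> x = x
                            \<and> (tD [^]\<^bsub>S03\<^esub> (2::nat)) \<odot>\<^bsub>Vmod l\<^esub> x = x)"
    by (intro nonzero_eigenvalue_module) blast+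
next
  show "is_basis (Vmod 0)
       [v0 0, tB \<odot>\<^bsub>Vmod 0\<^esub> v0 0, tC \<odot>\<^bsub>Vmod 0\<^esub> v0 0, (tB \<otimes>\<^bsub>S03\<^esub> tC) \<odot>\<^bsub>Vmod 0\<^esub> v0 0,
        (tB [^]\<^bsub>S03\<^esub> (2::nat)) \<odot>\<^bsub>Vmod 0\<^esub> v0 0]"
    using Vmod_0_basis
    by (simp add: times_s03.rep_eq power2_eq_square flip: elt_generators elt_power)
  show "reducible_module S03 (Vmod 0)" by (rule reducible_Vmod_0)
  show "submodule (line (Vmod 0) w0) S03 (Vmod 0)" by (rule submodule_line_w0)
  show "is_basis Tmod [w0]" by (rule Tmod_module)
  have "s03_module Tmod" using Tmod_module(1) by (simp add: irreducible_module_def s03_module_def)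
  then show "trivial_rep Tmod" using Tmod_module(2) trivial_rep_iff by blast
  show "left_module S03 Qmod" using s03_module_Qmod by (simp add: s03_module_def)
  show "internal_direct_sum S03 Qmod ({1, -1} \<times> {1, -1}) (\<lambda>(e, e'). line Qmod (wv e e'))"
    by (rule Qmod_direct_sum)
  show "card irrep_classes = 6"
    by (simp add: irrep_classes_eq card_image[OF inj_on_label_class] card_labels)
next
  fix e e' :: complex
  assume e: "e \<in> {1, -1}" "e' \<in> {1, -1}"
  show "is_basis (Wmod e e') [wv e e']" by (rule Wmod_module[OF e])
  show "tB \<odot>\<^bsub>Qmod\<^esub> wv e e' = sc e \<odot>\<^bsub>Qmod\<^esub> wv e e'"
    "tC \<odot>\<^bsub>Qmod\<^esub> wv e e' = sc (\<i> * e') \<odot>\<^bsub>Qmod\<^esub> wv e e'"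
    "tD \<odot>\<^bsub>Qmod\<^esub> wv e e' = \<zero>\<^bsub>Qmod\<^esub>"
    by (rule wv_action[OF e])+
next
  fix M assume "M \<in> irreps"
  then show "module_iso S03 M Tmod
                  \<or> (\<exists>l\<in>{1, -1}. module_iso S03 M (Vmod l))
                  \<or> (\<exists>e\<in>{1, -1}. \<exists>e'\<in>{1, -1}. module_iso S03 M (Wmod e e'))"
    by (rule irreps_classification)
qed (fact card_trivial_classes card_two_dimensional_classes card_one_dimensional_classes)+

end
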